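(* Consider the $Q$-type branching random walk described in the context, satisfying the branching assumptions (B1)-(B2) and the displacement assumptions (D1)-(D3), and let $M_n=\max_{|\boldsymbol v|=n}S_{\boldsymbol v}$ be the position of the rightmost particle in generation $n$. Then for every $x>0$, $$\lim_{n\to\infty}\mathbf P(M_n<b_nx)=\mathbf E\Big[\exp\{-\kappa_\lambda Wx^{-\alpha}\}\Big],$$ where $$\kappa_\lambda=(\rho-1)^{-1}\sum_{g=1}^\infty\mathbf P(G=g)\sum_{\substack{(i_1,\dots,i_g)\in\{0,1\}^g\\ 1\le i_1+\dots+i_g\le g}}\lambda(H_{i_1,\dots,i_g}).$$
   Context: $\mathbb N=\{1,2,\dots\}$. **Branching.** Let $Q$ be a positive integer (number of types). The root $o$ has type $p$ with probability $\pi(p)$, where $(\pi(1),\dots,\pi(Q))$ is a probability vector. Independently, each particle of type $q$ produces $k_p$ children of type $p$, for all $1\le p\le Q$, with probability $p^{(q)}(k_1,\dots,k_Q)$, $(k_1,\dots,k_Q)\in\mathbb N^Q$ (each particle has at least one child of every type). $\boldsymbol Z_1^{(p)}=(Z_1^{(p)}(1),\dots,Z_1^{(p)}(Q))$ is the vector of numbers of children, by type, of a particle of type $p$; $\boldsymbol Z_n=(Z_n(1),\dots,Z_n(Q))$ counts generation-$n$ particles by type. Put $\mu_{p,q}=\mathbf E(Z_1^{(p)}(q))$, $M=(\mu_{p,q})$. (B1) $\mu_{p,q}<\infty$ for all $p,q$. Let $\rho$ be the Perron-Frobenius eigenvalue of $M$; the process is supercritical, $\rho\in(1,\infty)$. Let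 $\varsigma,\vartheta$ be the left and right eigenvectors of $M$ for $\rho$ with $\varsigma^t\boldsymbol 1=1$, $\varsigma^t\vartheta=1$. (B2) $\mathbf E(Z_1^{(p)}(q)\log Z_1^{(p)}(q))<\infty$ for all $p,q$. Under these, $\rho^{-n}\boldsymbol Z_n\to W\varsigma$ almost surely for a positive random variable $W$ (this defines $W$). **Displacements.** For each $q$, $\boldsymbol X^{(q)}=(X_1^{(q)},X_2^{(q)},\dots)$ is a random element of $\mathbb R^{\mathbb N}$ ($\boldsymbol X^{(1)},\dots,\boldsymbol X^{(Q)}$ are defined jointly, possibly dependent), and these are independent of the offspring numbers. If a particle has $k_q$ children of type $q$ ($1\le q\le Q$), the displacements of these children are given by an independent copy of $(X_1^{(1)},\dots,X_{k_1}^{(1)},\dots,X_1^{(Q)},\dots,X_{k_Q}^{(Q)})$; different families are independent. $X_{\boldsymbol\varpi}$ is the displacement of the non-root vertex $\boldsymbol\varpi$ (equivalently of the edge to $\boldsymbol\varpi$ from its parent); the root has no displacement. The position of $\boldsymbol v$ is $S_{\boldsymbol v}=\sum_{\boldsymbol\varpi\in I_{\boldsymbol v}}X_{\boldsymbol\varpi}$, where $I_{\boldsymbol v}$ is the set of edges of the path from the root to $\boldsymbol v$ (each identified with its endpoint away from the root). $|\boldsymbol v|$ is the generation of $\boldsymbol v$. Hult-Lindskog (HL) convergence on $\mathbb R_0^{\mathbb N}=\mathbb R^{\mathbb N}\setminus\{\boldsymbol 0_\infty\}$ ($\boldsymbol 0_\infty=(0,0,\dots)$, product topology): for Borel measures $\nu_n,\nu$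 on $\mathbb R_0^{\mathbb N}$ finite outside every neighbourhood of $\boldsymbol 0_\infty$, $\nu_n\to\nu$ in the HL sense if $\int f\,d\nu_n\to\int f\,d\nu$ for every bounded continuous $f\ge0$ vanishing on some neighbourhood of $\boldsymbol 0_\infty$. (D1) For each fixed $p$, the variables $X_i^{(p)}$, $i\ge1$, are identically distributed. (D2) There are $\alpha>0$ and an increasing sequence of positive constants $\{b_n\}$ such that: (a) $\rho^n\mathbf P(b_n^{-1}X_1^{(Q)}\in\cdot)$ converges vaguely on $[-\infty,\infty]\setminus\{0\}$ to $\nu_\alpha(dx)=\beta\alpha x^{-\alpha-1}\mathbf 1(x>0)dx+(1-\beta)\alpha(-x)^{-\alpha-1}\mathbf 1(x<0)dx$ for some $\beta\in[0,1]$; (b) $\rho^n\mathbf P(b_n^{-1}\boldsymbol X^{(Q)}\in\cdot)\to\lambda(\cdot)$ in the HL sense, where $\lambda$ is a measure on $\mathbb R_0^{\mathbb N}$ with $\lambda(a\,\cdot)=a^{-\alpha}\lambda(\cdot)$ for all $a>0$ and $\lambda(A)<\infty$ whenever $\boldsymbol 0_\infty\notin\bar A$. (D3) For every $1\le p\le Q-1$ there exist $\gamma>0$ and a measurable $\varepsilon:\mathbb R_+\to\mathbb R_+$ with $\lim_{t\to\infty}\varepsilon(tx)/\varepsilon(t)=x^{-\gamma}$ for all $x>0$ and $\mathbf P(|X_1^{(p)}|>x)\le\varepsilon(x)\mathbf P(|X_1^{(Q)}|>x)$. **Notation in the limit.** $G$ is a positive integer-valued random variable with $\mathbf P(G=g)=\sum_{q=1}^Q\varsigma_q\mathbf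 P(Z_1^{(q)}(Q)=g)$, $g\in\mathbb N$. Put $G_0=[-\infty,1)$, $G_1=(1,\infty]$, and for $g\in\mathbb N$ and $i_1,\dots,i_g\in\{0,1\}$ let $H_{i_1,\dots,i_g}=G_{i_1}\times\cdots\times G_{i_g}\times\mathbb R\times\mathbb R\times\cdots$, regarded as a subset of $\mathbb R^{\mathbb N}$ (coordinates intersected with $\mathbb R$). *)

theory Defs
  imports "HOL-Probability.Probability"
begin

section \<open>Perron-Frobenius eigenvalue\<close>

definition is_eigenvalue :: "complex^'q^'q::finite \<Rightarrow> complex \<Rightarrow> bool" where
  "is_eigenvalue A c \<longleftrightarrow> (\<exists>v. v \<noteq> 0 \<and> A *v v = c *s v)"

definition complexify :: "real^'q^'q::finite \<Rightarrow> complex^'q^'q" where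
  "complexify A = (\<chi> p q. complex_of_real (A $ p $ q))"

text \<open>The real eigenvalue equal to the spectral radius.  It is unique when it exists, and it
  exists for every matrix with nonnegative entries.\<close>

definition perron_frobenius_eigenvalue :: "real^'q^'q::finite \<Rightarrow> real \<Rightarrow> bool" where
  "perron_frobenius_eigenvalue A r \<longleftrightarrow>
     is_eigenvalue (complexify A) (complex_of_real r) \<and>
     (\<forall>c. is_eigenvalue (complexify A) c \<longrightarrow> cmod c \<le> r)"


section \<open>Multi-type branching random walk\<close>

text \<open>The finite type \<open>'q\<close> is the set of particle types.  Particles are addressed in Ulam-Harris
  fashion, with the most recent ancestor first: \<open>[]\<close> is the root, and \<open>(q, i) # v\<close> is the
  \<open>i\<close>-th child of type \<open>q\<close> of \<open>v\<close>, where \<open>i\<close> starts at \<open>0\<close>.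

  A realisation is given by the type \<open>r\<close> of the root, offspring vectors \<open>k\<close> and displacements
  \<open>x\<close>.  Here \<open>k (v, p) q\<close> is the number of children of type \<open>q\<close> which \<open>v\<close> has in case
  \<open>v\<close> is of type \<open>p\<close> (only the value at the actual type of \<open>v\<close> matters), and \<open>x v q i\<close> is the
  displacement of the child \<open>(q, i) # v\<close> of \<open>v\<close>.\<close>

type_synonym 'q vertex = "('q \<times> nat) list"

fun vertex_type :: "'q \<Rightarrow> 'q vertex \<Rightarrow> 'q" where
  "vertex_type r [] = r"
| "vertex_type r ((q, i) # v) = q"

fun in_tree :: "'q \<Rightarrow> ('q vertex \<times> 'q \<Rightarrow> 'q \<Rightarrow> nat) \<Rightarrow> 'q vertex \<Rightarrow> bool" where
  "in_tree r k [] \<longleftrightarrow> True"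
| "in_tree r k ((q, i) # v) \<longleftrightarrow> in_tree r k v \<and> i < k (v, vertex_type r v) q"

definition generation :: "'q \<Rightarrow> ('q vertex \<times> 'q \<Rightarrow> 'q \<Rightarrow> nat) \<Rightarrow> nat \<Rightarrow> 'q vertex set" where
  "generation r k n = {v. in_tree r k v \<and> length v = n}"

definition type_counts ::
    "'q::finite \<Rightarrow> ('q vertex \<times> 'q \<Rightarrow> 'q \<Rightarrow> nat) \<Rightarrow> nat \<Rightarrow> real^'q" where
  "type_counts r k n = (\<chi> q. real (card {v \<in> generation r k n. vertex_type r v = q}))"

fun position :: "('q vertex \<Rightarrow> 'q \<Rightarrow> nat \<Rightarrow> real) \<Rightarrow> 'q vertex \<Rightarrow> real" where
  "position x [] = 0"
| "position x ((q, i) # v) = position x v + x v q i"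

definition rightmost ::
    "'q \<Rightarrow> ('q vertex \<times> 'q \<Rightarrow> 'q \<Rightarrow> nat) \<Rightarrow> ('q vertex \<Rightarrow> 'q \<Rightarrow> nat \<Rightarrow> real) \<Rightarrow> nat \<Rightarrow> real" where
  "rightmost r k x n = Max (position x ` generation r k n)"

text \<open>Joint law of root type, offspring vectors and displacements.  The displacement law \<open>D\<close> is the
  joint law of the sequences \<open>X_q\<close> for all types \<open>q\<close>; as with children, sequences
  are indexed from \<open>0\<close>.  The product measure expresses that the root type, the offspring vectors of
  all particles and the displacements in all families are independent.\<close>

definition brw_law ::
    "'q pmf \<Rightarrow> ('q \<Rightarrow> ('q \<Rightarrow> nat) pmf) \<Rightarrow> ('q \<Rightarrow> nat \<Rightarrow> real) measure \<Rightarrow>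
     ('q \<times> ('q vertex \<times> 'q \<Rightarrow> 'q \<Rightarrow> nat) \<times> ('q vertex \<Rightarrow> 'q \<Rightarrow> nat \<Rightarrow> real)) measure" where
  "brw_law root_law offs D =
     measure_pmf root_law \<Otimes>\<^sub>M
     (PiM UNIV (\<lambda>(v, p). measure_pmf (offs p)) \<Otimes>\<^sub>M PiM UNIV (\<lambda>v. D))"

definition branching_random_walk ::
    "'a measure \<Rightarrow> 'q::finite pmf \<Rightarrow> ('q \<Rightarrow> ('q \<Rightarrow> nat) pmf) \<Rightarrow> ('q \<Rightarrow> nat \<Rightarrow> real) measure \<Rightarrow>
     ('a \<Rightarrow> 'q) \<Rightarrow> ('a \<Rightarrow> 'q vertex \<times> 'q \<Rightarrow> 'q \<Rightarrow> nat) \<Rightarrow>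
     ('a \<Rightarrow> 'q vertex \<Rightarrow> 'q \<Rightarrow> nat \<Rightarrow> real) \<Rightarrow> bool" where
  "branching_random_walk P root_law offs D T K X \<longleftrightarrow>
     prob_space P \<and>
     (\<forall>p. \<forall>k \<in> set_pmf (offs p). \<forall>q. 1 \<le> k q) \<and>
     prob_space D \<and> sets D = sets borel \<and>
     (\<lambda>\<omega>. (T \<omega>, K \<omega>, X \<omega>)) \<in> measurable P (brw_law root_law offs D) \<and>
     distr P (brw_law root_law offs D) (\<lambda>\<omega>. (T \<omega>, K \<omega>, X \<omega>)) = brw_law root_law offs D"

definition mean_matrix :: "('q::finite \<Rightarrow> ('q \<Rightarrow> nat) pmf) \<Rightarrow> real^'q^'q" where
  "mean_matrix offs = (\<chi> p q. measure_pmf.expectation (offs p) (\<lambda>k. real (k q)))"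


section \<open>Convergence of measures\<close>

text \<open>Vague convergence on the (locally compact) subspace \<open>S\<close>: test functions are the
  nonnegative continuous functions on \<open>S\<close> with compact support, extended by \<open>0\<close>.\<close>

definition vague_conv_on ::
    "'a::topological_space set \<Rightarrow> (nat \<Rightarrow> 'a measure) \<Rightarrow> 'a measure \<Rightarrow> bool" where
  "vague_conv_on S \<mu> \<nu> \<longleftrightarrow>
     (\<forall>f :: 'a \<Rightarrow> real.
        continuous_on S f \<and> (\<forall>x. 0 \<le> f x) \<and>
        (\<exists>K. compact K \<and> K \<subseteq> S \<and> (\<forall>x. x \<notin> K \<longrightarrow> f x = 0)) \<longrightarrow>
        (\<lambda>n. \<integral>\<^sup>+x. ennreal (f x) \<partial>\<mu> n) \<longlonglongrightarrow> (\<integral>\<^sup>+x. ennreal (f x) \<partial>\<nu>))"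

abbreviation punctured :: "(nat \<Rightarrow> real) set" where
  "punctured \<equiv> - {\<lambda>_. 0}"

text \<open>Hult-Lindskog convergence of Borel measures on \<open>punctured\<close>; the topology of
  \<open>nat \<Rightarrow> real\<close> is the product topology.\<close>

definition HL_conv :: "(nat \<Rightarrow> (nat \<Rightarrow> real) measure) \<Rightarrow> (nat \<Rightarrow> real) measure \<Rightarrow> bool" where
  "HL_conv \<mu> \<nu> \<longleftrightarrow>
     (\<forall>f :: (nat \<Rightarrow> real) \<Rightarrow> real.
        continuous_on punctured f \<and> bounded (range f) \<and> (\<forall>x. 0 \<le> f x) \<and>
        (\<exists>U. open U \<and> (\<lambda>_. 0) \<in> U \<and> (\<forall>x\<in>U. f x = 0)) \<longrightarrow>
        (\<lambda>n. \<integral>\<^sup>+x. ennreal (f x) \<partial>\<mu> n) \<longlonglongrightarrow> (\<integral>\<^sup>+x. ennreal (f x) \<partial>\<nu>))"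

definition power_law_measure :: "real \<Rightarrow> real \<Rightarrow> real measure" where
  "power_law_measure \<alpha> \<beta> =
     density lborel (\<lambda>x. ennreal (\<beta> * \<alpha> * x powr (-\<alpha> - 1) * indicator {0<..} x +
                                 (1 - \<beta>) * \<alpha> * (-x) powr (-\<alpha> - 1) * indicator {..<0} x))"


section \<open>The limiting constant\<close>

text \<open>The probability that the variable \<open>G\<close> of the limit law takes the value \<open>g\<close>.\<close>

definition G_prob ::
    "('q::finite \<Rightarrow> ('q \<Rightarrow> nat) pmf) \<Rightarrow> real^'q \<Rightarrow> 'q \<Rightarrow> nat \<Rightarrow> real" where
  "G_prob offs \<sigma> Q g = (\<Sum>q\<in>UNIV. \<sigma> $ q * measure_pmf.prob (offs q) {k. k Q = g})"

definition G_set :: "nat \<Rightarrow> ereal set" where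
  "G_set i = (if i = 0 then {..<1} else {1<..})"

definition H_set :: "nat list \<Rightarrow> (nat \<Rightarrow> real) set" where
  "H_set js = {x. \<forall>j<length js. ereal (x j) \<in> G_set (js ! j)}"

definition kappa ::
    "('q::finite \<Rightarrow> ('q \<Rightarrow> nat) pmf) \<Rightarrow> real \<Rightarrow> real^'q \<Rightarrow> 'q \<Rightarrow> (nat \<Rightarrow> real) measure \<Rightarrow> real" where
  "kappa offs \<rho> \<sigma> Q lam =
     inverse (\<rho> - 1) *
     (\<Sum>\<^sub>\<infinity>g\<in>{1..}. G_prob offs \<sigma> Q g *
        (\<Sum>js | length js = g \<and> set js \<subseteq> {0, 1} \<and> 1 \<le> sum_list js \<and> sum_list js \<le> g.
           measure lam (H_set js)))"

end

theory Submission
  imports Defs "HOL-Library.Sublist" "HOL-Real_Asymp.Real_Asymp"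
begin

text \<open>
  Since displacements are heavy-tailed, a path of generation \<open>n\<close> reaches level \<open>b n * x\<close> only
  by one big jump. Two displacements larger than \<open>b (3 n / 4)\<close> on the same path are unlikely,
  because \<open>\<rho> ^ n * (\<rho> powr (- 3 n / 4))\<^sup>2\<close> tends to \<open>0\<close>, and \<open>n * b (3 n / 4) / b n\<close> tends to \<open>0\<close>
  because \<open>b\<close> grows exponentially. So \<open>rightmost < b n * x\<close> is asymptotically the event that no
  displacement up to generation \<open>n\<close> exceeds \<open>b n * x\<close>.

  Displacements before generation \<open>n - r\<close> matter only with probability \<open>O(\<rho> ^ (- r))\<close>. Given
  generation \<open>n - r\<close>, its particles start independent trees, each of which has no large
  displacement with probability \<open>1 - \<rho> ^ (- n) * c\<close> up to lower order, where \<open>c\<close> depends on the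
  type of the particle and on \<open>r\<close>. Hence the conditional probability of no large displacement
  tends to the exponential of a multiple of \<open>W\<close>, and the left eigenvector property of \<open>\<sigma>\<close> turns
  the constants \<open>c\<close> into a geometric sum. Finally \<open>r\<close> tends to infinity.
\<close>

text \<open>A path, however, takes at most one displacement from each family, so the displacements
  along it are independent and a first-moment count over paths suffices. The count is weighted by a
  positive right eigenvector \<open>u\<close>, for which the mean weight of generation n is exactly
  \<open>\<rho> ^ n * u r\<close>. The fraction 3/4 is a compromise: a threshold \<open>b m\<close>
  needs m well above n / 2 for two jumps to be rare, and n - m of order n for \<open>n * b m\<close>
  to be negligible against \<open>b n\<close>. The exponential growth of \<open>b\<close> is itself
  deduced from a lower tail bound at \<open>2 * b n\<close> and an upper one at
  \<open>b (n + j)\<close>. Absence of jumps factorises over families, so its probability is exactly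
  an iterate of an offspring generating function weighted by family probabilities; only its
  first-order expansion at 1 is needed. The sum over patterns in \<open>kappa\<close> is the
  \<open>lam\<close>-mass of the vectors with some entry above 1 among the first g, because scaling
  makes the hyperplanes \<open>y i = 1\<close> null.\<close>

section \<open>Products of probability spaces\<close>

text \<open>Replacing coordinate \<open>i\<close> by an independent fresh copy preserves the product
  law and, by \<open>dep\<close>, the value of \<open>G\<close>; hence \<open>G\<close> and
  coordinate \<open>i\<close> can be integrated separately.\<close>

lemma nn_integral_PiM_coordinate:
  fixes M :: "'i \<Rightarrow> 'a measure"
  assumes M: "\<And>i. prob_space (M i)"
    and G[measurable]: "G \<in> borel_measurable (PiM UNIV M)"
    and dep: "\<And>k a. G (k(i := a)) = G k"
    and \<phi>[measurable]: "\<phi> \<in> borel_measurable (M i)"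
  shows "(\<integral>\<^sup>+k. G k * \<phi> (k i) \<partial>PiM UNIV M) = (\<integral>\<^sup>+k. G k \<partial>PiM UNIV M) * (\<integral>\<^sup>+a. \<phi> a \<partial>M i)"
proof -
  interpret Mi: prob_space "M i" by (rule M)
  interpret PM: prob_space "PiM UNIV M" by (intro prob_space_PiM M)
  have eq: "distr (M i \<Otimes>\<^sub>M PiM UNIV M) (PiM UNIV M) (\<lambda>(x, X). X(i := x)) = PiM UNIV M"
    using distr_pair_PiM_eq_PiM[of UNIV M i] M by simp
  have upd[measurable]: "(\<lambda>(x, X). X(i := x)) \<in> measurable (M i \<Otimes>\<^sub>M PiM UNIV M) (PiM UNIV M)"
  proof (rule measurable_PiM_single')
    show "(\<lambda>z. (case z of (x, X) \<Rightarrow> X(i := x)) j) \<in> measurable (M i \<Otimes>\<^sub>M PiM UNIV M) (M j)" for j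
      by (cases "j = i") (auto simp: split_beta)
  qed (auto simp: space_pair_measure space_PiM PiE_iff)
  have "(\<integral>\<^sup>+k. G k * \<phi> (k i) \<partial>PiM UNIV M)
      = (\<integral>\<^sup>+k. G k * \<phi> (k i) \<partial>distr (M i \<Otimes>\<^sub>M PiM UNIV M) (PiM UNIV M) (\<lambda>(x, X). X(i := x)))"
    by (simp add: eq)
  also have "\<dots> = (\<integral>\<^sup>+z. G (snd z) * \<phi> (fst z) \<partial>(M i \<Otimes>\<^sub>M PiM UNIV M))"
    by (subst nn_integral_distr) (auto simp: dep split_beta intro!: nn_integral_cong)
  also have "\<dots> = (\<integral>\<^sup>+x. \<integral>\<^sup>+k. G k * \<phi> x \<partial>PiM UNIV M \<partial>M i)"
    by (subst PM.nn_integral_fst[symmetric]) simp_all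
  also have "\<dots> = (\<integral>\<^sup>+k. G k \<partial>PiM UNIV M) * (\<integral>\<^sup>+a. \<phi> a \<partial>M i)"
    by (simp add: nn_integral_multc nn_integral_cmult)
  finally show ?thesis .
qed

lemma nn_integral_PiM_coordinates:
  fixes M :: "'i \<Rightarrow> 'a measure" and \<phi> :: "'i \<Rightarrow> 'a \<Rightarrow> ennreal"
  assumes M: "\<And>i. prob_space (M i)"
    and I: "finite I"
    and G: "G \<in> borel_measurable (PiM UNIV M)"
    and dep: "\<And>i k a. i \<in> I \<Longrightarrow> G (k(i := a)) = G k"
    and \<phi>: "\<And>i. i \<in> I \<Longrightarrow> \<phi> i \<in> borel_measurable (M i)"
  shows "(\<integral>\<^sup>+k. G k * (\<Prod>i\<in>I. \<phi> i (k i)) \<partial>PiM UNIV M)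
       = (\<integral>\<^sup>+k. G k \<partial>PiM UNIV M) * (\<Prod>i\<in>I. \<integral>\<^sup>+a. \<phi> i a \<partial>M i)"
  using I G dep \<phi>
proof (induction I arbitrary: G)
  case empty
  then show ?case by simp
next
  case (insert i I)
  note [measurable] = insert.prems(1) insert.prems(3)[OF insertI1]
  have [measurable]: "\<phi> j \<in> borel_measurable (M j)" if "j \<in> I" for j
    using insert.prems(3) that by auto
  have "(\<integral>\<^sup>+k. G k * (\<Prod>i\<in>insert i I. \<phi> i (k i)) \<partial>PiM UNIV M)
      = (\<integral>\<^sup>+k. (G k * \<phi> i (k i)) * (\<Prod>i\<in>I. \<phi> i (k i)) \<partial>PiM UNIV M)"
    using insert.hyps by (simp add: mult.assoc)
  \<comment> \<open>The factor for \<open>i\<close> is absorbed into \<open>G\<close>; it is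
    unaffected by changes at the remaining coordinates because \<open>i\<close> lies outside
    \<open>I\<close>.\<close>
  also have "\<dots> = (\<integral>\<^sup>+k. G k * \<phi> i (k i) \<partial>PiM UNIV M) * (\<Prod>i\<in>I. \<integral>\<^sup>+a. \<phi> i a \<partial>M i)"
  proof (rule insert.IH)
    show "G (k(j := a)) * \<phi> i ((k(j := a)) i) = G k * \<phi> i (k i)" if "j \<in> I" for j k a
    proof -
      have "G (k(j := a)) = G k" "i \<noteq> j"
        using that insert.hyps insert.prems(2) by blast+
      then show ?thesis by simp
    qed
  qed (use insert.prems in measurable)
  also have "(\<integral>\<^sup>+k. G k * \<phi> i (k i) \<partial>PiM UNIV M) = (\<integral>\<^sup>+k. G k \<partial>PiM UNIV M) * (\<integral>\<^sup>+a. \<phi> i a \<partial>M i)"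
    by (rule nn_integral_PiM_coordinate[OF M insert.prems(1) insert.prems(2)[OF insertI1] insert.prems(3)[OF insertI1]])
  finally show ?case
    using insert.hyps by (simp add: mult.assoc)
qed

text \<open>Conditioning on a discrete variable: on the event \<open>g x = i\<close> the integrand
  is \<open>F i\<close>, so measurability is needed only for fixed \<open>i\<close>. The variable
  will be a random generation, which has countably many possible values.\<close>

lemma nn_integral_countable_partition:
  fixes g :: "'a \<Rightarrow> 'i"
  assumes I: "countable I" and g[measurable]: "g \<in> measurable M (count_space I)"
    and F: "\<And>i. i \<in> I \<Longrightarrow> F i \<in> borel_measurable M"
  shows "(\<integral>\<^sup>+x. F (g x) x \<partial>M) = (\<integral>\<^sup>+i. (\<integral>\<^sup>+x. indicator {x. g x = i} x * F i x \<partial>M) \<partial>count_space I)"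
proof -
  have gI: "g x \<in> I" if "x \<in> space M" for x
    using measurable_space[OF g that] by simp
  have meas: "(\<lambda>x. indicator {x. g x = i} x * F i x) \<in> borel_measurable M" if "i \<in> I" for i
  proof -
    note F[OF that, measurable]
    have "{x \<in> space M. g x = i} \<in> sets M"
      using that by measurable
    then have [measurable]: "Measurable.pred M (\<lambda>x. g x = i)" 
      by (simp add: pred_def)
    show ?thesis by measurable
  qed
  have "(\<integral>\<^sup>+i. (\<integral>\<^sup>+x. indicator {x. g x = i} x * F i x \<partial>M) \<partial>count_space I)
      = (\<integral>\<^sup>+x. (\<integral>\<^sup>+i. indicator {x. g x = i} x * F i x \<partial>count_space I) \<partial>M)"
    using I meas by (intro nn_integral_count_space_nn_integral[symmetric]) auto
  also have "\<dots> = (\<integral>\<^sup>+x. F (g x) x \<partial>M)"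
  proof (rule nn_integral_cong)
    fix x assume "x \<in> space M"
    then have "g x \<in> I" by (rule gI)
    then have "(\<integral>\<^sup>+i. indicator {x. g x = i} x * F i x \<partial>count_space I) = (\<integral>\<^sup>+i. F i x * indicator {g x} i \<partial>count_space I)"
      by (intro nn_integral_cong) (auto split: split_indicator)
    also have "\<dots> = F (g x) x"
      using \<open>g x \<in> I\<close> by (subst nn_integral_indicator_singleton) auto
    finally show "(\<integral>\<^sup>+i. indicator {x. g x = i} x * F i x \<partial>count_space I) = F (g x) x" .
  qed
  finally show ?thesis by simp
qed

section \<open>Generations of the branching tree\<close>

lemma generation_0: "generation r k 0 = {[]}"
  by (auto simp: generation_def)

lemma generation_Suc:
  "generation r k (Suc n) =
     (\<lambda>(v, q, i). (q, i) # v) ` (SIGMA v:generation r k n. SIGMA q:UNIV. {..<k (v, vertex_type r v) q})"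
  (is "_ = ?f ` ?S")
proof (intro set_eqI iffI)
  fix w assume "w \<in> generation r k (Suc n)"
  then obtain q i v where w: "w = (q, i) # v"
    by (cases w) (auto simp: generation_def)
  with \<open>w \<in> _\<close> have "(v, q, i) \<in> ?S"
    by (auto simp: generation_def)
  with w show "w \<in> ?f ` ?S"
    by (metis (mono_tags, lifting) case_prod_conv image_eqI)
qed (auto simp: generation_def)

lemma finite_generation: "finite (generation r (k :: 'q::finite vertex \<times> 'q \<Rightarrow> 'q \<Rightarrow> nat) n)"
  by (induction n) (auto simp: generation_0 generation_Suc)

lemma inj_on_child: "inj_on (\<lambda>(v, q, i). (q, i) # v) A"
  by (auto simp: inj_on_def)

lemma sum_generation_Suc:
  fixes k :: "'q::finite vertex \<times> 'q \<Rightarrow> 'q \<Rightarrow> nat" and f :: "_ \<Rightarrow> 'b::comm_monoid_add"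
  shows "(\<Sum>w\<in>generation r k (Suc n). f w) =
     (\<Sum>v\<in>generation r k n. \<Sum>q\<in>UNIV. \<Sum>i<k (v, vertex_type r v) q. f ((q, i) # v))"
  unfolding generation_Suc
  by (subst sum.reindex[OF inj_on_child]) (simp add: sum.Sigma finite_generation split_beta)

lemma prod_generation_Suc:
  fixes k :: "'q::finite vertex \<times> 'q \<Rightarrow> 'q \<Rightarrow> nat" and f :: "_ \<Rightarrow> 'b::comm_monoid_mult"
  shows "(\<Prod>w\<in>generation r k (Suc n). f w) =
     (\<Prod>v\<in>generation r k n. \<Prod>q\<in>UNIV. \<Prod>i<k (v, vertex_type r v) q. f ((q, i) # v))"
  unfolding generation_Suc
  by (subst prod.reindex[OF inj_on_child]) (simp add: prod.Sigma finite_generation split_beta)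

text \<open>Membership of \<open>v\<close> is decided by the offspring vectors at its proper
  ancestors, which are strictly shorter than \<open>v\<close>. So generation \<open>n\<close>
  ignores all offspring vectors at depth \<open>n\<close> and beyond, and the non-strict bound is
  enough.\<close>

lemma in_tree_upd: "length v \<le> length (fst i) \<Longrightarrow> in_tree r (k(i := a)) v = in_tree r k v"
  by (induction r k v rule: in_tree.induct) (auto simp: fun_upd_def)

lemma generation_upd: "n \<le> length (fst i) \<Longrightarrow> generation r (k(i := a)) n = generation r k n"
  by (auto simp: generation_def in_tree_upd)

abbreviation offspring_measure ::
    "('q \<Rightarrow> ('q \<Rightarrow> nat) pmf) \<Rightarrow> ('q vertex \<times> 'q \<Rightarrow> 'q \<Rightarrow> nat) measure" where
  "offspring_measure offs \<equiv> PiM UNIV (\<lambda>(v, p). measure_pmf (offs p))"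

lemma prob_space_offspring: "prob_space (case i of (v, p) \<Rightarrow> measure_pmf (offs p))"
  by (cases i) (simp add: prob_space_measure_pmf)

lemma space_offspring_measure: "space (offspring_measure offs) = UNIV"
  by (auto simp: space_PiM PiE_iff extensional_def)

lemma measurable_offspring[measurable]:
  "(\<lambda>k. k i) \<in> measurable (offspring_measure offs) (count_space UNIV)"
proof -
  have "(\<lambda>k. k i) \<in> measurable (offspring_measure offs) (case i of (v, p) \<Rightarrow> measure_pmf (offs p))"
    by (rule measurable_component_singleton) simp
  then show ?thesis by (cases i) simp
qed

lemma measurable_offspring_compose:
  "(\<lambda>k. f (k i)) \<in> measurable (offspring_measure offs) (count_space UNIV)"
  using measurable_offspring measurable_count_space by (rule measurable_compose)

lemma measurable_in_tree[measurable]: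
  "Measurable.pred (offspring_measure offs) (\<lambda>k. in_tree r k v)"
proof (induction v)
  case Nil
  then show ?case by simp
next
  case (Cons x v)
  note [measurable] = Cons
  obtain q i where x: "x = (q, i)" by (cases x)
  have [measurable]: "Measurable.pred (offspring_measure offs) (\<lambda>k. i < k (v, vertex_type r v) q)"
    by (rule measurable_offspring_compose)
  show ?case unfolding x in_tree.simps by measurable
qed

lemma countable_finite_sets: "countable {A :: 'b::countable set. finite A}"
  by (rule countable_Collect_finite)

text \<open>Taking finite sets of addresses as codomain makes it countable, so measurability is
  checked on single values and the generation can be conditioned on.\<close>

lemma measurable_generation[measurable]:
  fixes offs :: "'q::finite \<Rightarrow> ('q \<Rightarrow> nat) pmf"
  shows "(\<lambda>k. generation r k n) \<in> measurable (offspring_measure offs) (count_space {A. finite A})"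
proof (unfold measurable_count_space_eq_countable[OF countable_finite_sets], intro conjI ballI)
  show "(\<lambda>k. generation r k n) \<in> space (offspring_measure offs) \<rightarrow> {A. finite A}"
    by (simp add: finite_generation)
  fix A :: "'q vertex set"
  have "(\<lambda>k. generation r k n) -` {A} \<inter> space (offspring_measure offs)
    = {k \<in> space (offspring_measure offs). \<forall>v. (in_tree r k v \<and> length v = n) = (v \<in> A)}"
    by (auto simp: generation_def)
  also have "\<dots> \<in> sets (offspring_measure offs)" by measurable
  finally show "(\<lambda>k. generation r k n) -` {A} \<inter> space (offspring_measure offs) \<in> sets (offspring_measure offs)" .
qed

lemma measurable_generation_compose:
  fixes offs :: "'q::finite \<Rightarrow> ('q \<Rightarrow> nat) pmf"
  assumes "\<And>A. finite A \<Longrightarrow> F A \<in> measurable (offspring_measure offs) N"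
  shows "(\<lambda>k. F (generation r k n) k) \<in> measurable (offspring_measure offs) N"
  by (rule measurable_compose_countable'[OF assms measurable_generation countable_finite_sets]) simp

text \<open>Freezing the generation at a value \<open>A\<close> turns sums and products over a
  random index set into ones over a fixed set. Sets containing an address of another length are
  never attained.\<close>

lemma nn_integral_generation_cong:
  fixes offs :: "'q::finite \<Rightarrow> ('q \<Rightarrow> nat) pmf"
  assumes F: "\<And>A. finite A \<Longrightarrow> F A \<in> borel_measurable (offspring_measure offs)"
    and F': "\<And>A. finite A \<Longrightarrow> F' A \<in> borel_measurable (offspring_measure offs)"
    and eq: "\<And>A. finite A \<Longrightarrow> \<forall>v\<in>A. length v = n \<Longrightarrow>
      Measurable.pred (offspring_measure offs) (\<lambda>k. generation r k n = A) \<Longrightarrow>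
      (\<integral>\<^sup>+k. indicator {k. generation r k n = A} k * F A k \<partial>offspring_measure offs) =
      (\<integral>\<^sup>+k. indicator {k. generation r k n = A} k * F' A k \<partial>offspring_measure offs)"
  shows "(\<integral>\<^sup>+k. F (generation r k n) k \<partial>offspring_measure offs) =
    (\<integral>\<^sup>+k. F' (generation r k n) k \<partial>offspring_measure offs)"
proof -
  let ?M = "offspring_measure offs"
  have part: "(\<integral>\<^sup>+k. F (generation r k n) k \<partial>?M) =
      (\<integral>\<^sup>+A. (\<integral>\<^sup>+k. indicator {k. generation r k n = A} k * F A k \<partial>?M) \<partial>count_space {A. finite A})"
    if "\<And>A. finite A \<Longrightarrow> F A \<in> borel_measurable ?M" for F
    by (rule nn_integral_countable_partition[OF countable_finite_sets measurable_generation]) (simp add: that)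
  have "(\<integral>\<^sup>+k. indicator {k. generation r k n = A} k * F A k \<partial>?M) =
      (\<integral>\<^sup>+k. indicator {k. generation r k n = A} k * F' A k \<partial>?M)" if A: "finite A" for A
  proof (cases "\<forall>v\<in>A. length v = n")
    case False
    then have "generation r k n \<noteq> A" for k by (auto simp: generation_def)
    then show ?thesis by simp
  next
    case True
    show ?thesis
      by (rule eq[OF A True measurable_generation_compose[where F = "\<lambda>B k. B = A"]]) simp
  qed
  note eq_A = this
  have "(\<integral>\<^sup>+k. F (generation r k n) k \<partial>?M) =
      (\<integral>\<^sup>+A. (\<integral>\<^sup>+k. indicator {k. generation r k n = A} k * F A k \<partial>?M) \<partial>count_space {A. finite A})"
    by (rule part[of F]) (rule F)
  also have "\<dots> = (\<integral>\<^sup>+A. (\<integral>\<^sup>+k. indicator {k. generation r k n = A} k * F' A k \<partial>?M) \<partial>count_space {A. finite A})"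
    by (rule nn_integral_cong, rule eq_A) simp
  also have "\<dots> = (\<integral>\<^sup>+k. F' (generation r k n) k \<partial>?M)"
    by (rule part[of F', symmetric]) (rule F')
  finally show ?thesis .
qed

text \<open>The branching property: by \<open>dep\<close>, \<open>G\<close> depends only on
  offspring vectors of depth below \<open>n\<close>, so those of generation \<open>n\<close> are
  independent draws from the laws of their types and can be averaged one by one.\<close>

lemma nn_integral_generation_prod:
  fixes offs :: "'q::finite \<Rightarrow> ('q \<Rightarrow> nat) pmf" and \<psi> :: "'q \<Rightarrow> ('q \<Rightarrow> nat) \<Rightarrow> ennreal"
  assumes G[measurable]: "G \<in> borel_measurable (offspring_measure offs)"
    and dep: "\<And>k i a. n \<le> length (fst i) \<Longrightarrow> G (k(i := a)) = G k"
  shows "(\<integral>\<^sup>+k. G k * (\<Prod>v\<in>generation r k n. \<psi> (vertex_type r v) (k (v, vertex_type r v))) \<partial>offspring_measure offs)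
    = (\<integral>\<^sup>+k. G k * (\<Prod>v\<in>generation r k n. \<integral>\<^sup>+\<kappa>. \<psi> (vertex_type r v) \<kappa> \<partial>measure_pmf (offs (vertex_type r v))) \<partial>offspring_measure offs)"
proof -
  let ?M = "offspring_measure offs"
  let ?P = "\<lambda>A k. G k * (\<Prod>v\<in>A. \<psi> (vertex_type r v) (k (v, vertex_type r v)))"
  let ?Q = "\<lambda>A k. G k * (\<Prod>v\<in>A. \<integral>\<^sup>+\<kappa>. \<psi> (vertex_type r v) \<kappa> \<partial>measure_pmf (offs (vertex_type r v)))"
  show ?thesis
  proof (rule nn_integral_generation_cong[where F = ?P and F' = ?Q])
    show "?P A \<in> borel_measurable ?M" "?Q A \<in> borel_measurable ?M" for A by measurable
  next
    fix A :: "'q vertex set"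
    assume A: "finite A" and True: "\<forall>v\<in>A. length v = n"
      and [measurable]: "Measurable.pred ?M (\<lambda>k. generation r k n = A)"
    \<comment> \<open>Offspring vectors are indexed by address and type; only the index carrying the
      actual type of \<open>v\<close> is read, and distinct vertices give distinct indices.\<close>
    let ?I = "(\<lambda>v. (v, vertex_type r v)) ` A"
    let ?G = "\<lambda>k. indicator {k. generation r k n = A} k * G k"
    have inj: "inj_on (\<lambda>v. (v, vertex_type r v)) A" by (auto simp: inj_on_def)
    have "(\<integral>\<^sup>+k. indicator {k. generation r k n = A} k * ?P A k \<partial>?M)
        = (\<integral>\<^sup>+k. ?G k * (\<Prod>i\<in>?I. \<psi> (snd i) (k i)) \<partial>?M)"
      by (simp add: prod.reindex[OF inj] mult.assoc)
    also have "\<dots> = (\<integral>\<^sup>+k. ?G k \<partial>?M) * (\<Prod>i\<in>?I. \<integral>\<^sup>+\<kappa>. \<psi> (snd i) \<kappa> \<partial>(case i of (v, p) \<Rightarrow> measure_pmf (offs p)))"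
    proof (rule nn_integral_PiM_coordinates)
      show "prob_space (case i of (v, p) \<Rightarrow> measure_pmf (offs p))" for i
        by (rule prob_space_offspring)
    next
      fix i k a assume "i \<in> ?I"
      then have "n \<le> length (fst i)" using True by auto
      then show "?G (k(i := a)) = ?G k"
        by (simp add: dep generation_upd split: split_indicator)
    next
      show "?G \<in> borel_measurable ?M" by measurable
    next
      show "\<psi> (snd i) \<in> borel_measurable (case i of (v, p) \<Rightarrow> measure_pmf (offs p))" for i
        by (cases i) simp
    qed (use A in simp)
    also have "(\<Prod>i\<in>?I. \<integral>\<^sup>+\<kappa>. \<psi> (snd i) \<kappa> \<partial>(case i of (v, p) \<Rightarrow> measure_pmf (offs p)))
        = (\<Prod>v\<in>A. \<integral>\<^sup>+\<kappa>. \<psi> (vertex_type r v) \<kappa> \<partial>measure_pmf (offs (vertex_type r v)))"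
      by (simp add: prod.reindex[OF inj])
    also have "(\<integral>\<^sup>+k. ?G k \<partial>?M) * \<dots> = (\<integral>\<^sup>+k. ?G k * (\<Prod>v\<in>A. \<integral>\<^sup>+\<kappa>. \<psi> (vertex_type r v) \<kappa> \<partial>measure_pmf (offs (vertex_type r v))) \<partial>?M)"
      by (rule nn_integral_multc[symmetric]) measurable
    also have "\<dots> = (\<integral>\<^sup>+k. indicator {k. generation r k n = A} k * ?Q A k \<partial>?M)"
      by (simp only: mult.assoc)
    finally show "(\<integral>\<^sup>+k. indicator {k. generation r k n = A} k * ?P A k \<partial>?M) =
      (\<integral>\<^sup>+k. indicator {k. generation r k n = A} k * ?Q A k \<partial>?M)" .
  qed
qed

text \<open>Linearity replaces independence inside the generation: each vertex has to be separated
  only from the event that fixes the generation.\<close>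

lemma nn_integral_generation_sum:
  fixes offs :: "'q::finite \<Rightarrow> ('q \<Rightarrow> nat) pmf" and \<psi> :: "'q \<Rightarrow> ('q \<Rightarrow> nat) \<Rightarrow> ennreal"
  shows "(\<integral>\<^sup>+k. (\<Sum>v\<in>generation r k n. \<psi> (vertex_type r v) (k (v, vertex_type r v))) \<partial>offspring_measure offs)
    = (\<integral>\<^sup>+k. (\<Sum>v\<in>generation r k n. \<integral>\<^sup>+\<kappa>. \<psi> (vertex_type r v) \<kappa> \<partial>measure_pmf (offs (vertex_type r v))) \<partial>offspring_measure offs)"
proof -
  let ?M = "offspring_measure offs"
  let ?P = "\<lambda>A k. (\<Sum>v\<in>A. \<psi> (vertex_type r v) (k (v, vertex_type r v)))"
  let ?Q = "\<lambda>A k. (\<Sum>v\<in>A. \<integral>\<^sup>+\<kappa>. \<psi> (vertex_type r v) \<kappa> \<partial>measure_pmf (offs (vertex_type r v)))"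
  show ?thesis
  proof (rule nn_integral_generation_cong[where F = ?P and F' = ?Q])
    show "?P A \<in> borel_measurable ?M" "?Q A \<in> borel_measurable ?M" for A by measurable
  next
    fix A :: "'q vertex set"
    assume A: "finite A" and True: "\<forall>v\<in>A. length v = n"
      and [measurable]: "Measurable.pred ?M (\<lambda>k. generation r k n = A)"
    let ?G = "\<lambda>k. indicator {k. generation r k n = A} k :: ennreal"
    have 1: "(\<integral>\<^sup>+k. ?G k * \<psi> (vertex_type r v) (k (v, vertex_type r v)) \<partial>?M)
      = (\<integral>\<^sup>+k. ?G k \<partial>?M) * (\<integral>\<^sup>+\<kappa>. \<psi> (vertex_type r v) \<kappa> \<partial>measure_pmf (offs (vertex_type r v)))"
      if v: "v \<in> A" for v
    proof -
      have "(\<integral>\<^sup>+k. ?G k * \<psi> (vertex_type r v) (k (v, vertex_type r v)) \<partial>?M)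
        = (\<integral>\<^sup>+k. ?G k \<partial>?M) * (\<integral>\<^sup>+\<kappa>. \<psi> (vertex_type r v) \<kappa> \<partial>(case (v, vertex_type r v) of (v, p) \<Rightarrow> measure_pmf (offs p)))"
        using v True
        by (intro nn_integral_PiM_coordinate)
          (auto simp: prob_space_offspring generation_upd split: split_indicator)
      then show ?thesis by simp
    qed
    show "(\<integral>\<^sup>+k. indicator {k. generation r k n = A} k * ?P A k \<partial>?M) =
      (\<integral>\<^sup>+k. indicator {k. generation r k n = A} k * ?Q A k \<partial>?M)"
      by (simp add: sum_distrib_left nn_integral_sum 1 nn_integral_multc)
  qed
qed

section \<open>Displacements along the tree\<close>

lemma measurable_generation_prod[measurable]:
  fixes offs :: "'q::finite \<Rightarrow> ('q \<Rightarrow> nat) pmf" and a :: "'q vertex \<Rightarrow> ('q \<Rightarrow> nat) \<Rightarrow> ennreal"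
  shows "(\<lambda>k. \<Prod>v\<in>generation r k j. a v (k (v, vertex_type r v))) \<in> borel_measurable (offspring_measure offs)"
  by (rule measurable_generation_compose[where F = "\<lambda>A k. \<Prod>v\<in>A. a v (k (v, vertex_type r v))"]) measurable

lemma measurable_generation_sum[measurable]:
  fixes offs :: "'q::finite \<Rightarrow> ('q \<Rightarrow> nat) pmf" and a :: "'q vertex \<Rightarrow> ('q \<Rightarrow> nat) \<Rightarrow> ennreal"
  shows "(\<lambda>k. \<Sum>v\<in>generation r k j. a v (k (v, vertex_type r v))) \<in> borel_measurable (offspring_measure offs)"
  by (rule measurable_generation_compose[where F = "\<lambda>A k. \<Sum>v\<in>A. a v (k (v, vertex_type r v))"]) measurable

text \<open>One generation multiplies the mean \<open>u\<close>-weight by \<rho>, because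
  \<open>u\<close> is a right eigenvector of the mean matrix. This gives exact first moments without
  asymptotics of matrix powers.\<close>

lemma expected_generation_harmonic:
  fixes offs :: "'q::finite \<Rightarrow> ('q \<Rightarrow> nat) pmf" and u :: "'q \<Rightarrow> ennreal"
  assumes u: "\<And>p. (\<Sum>q\<in>UNIV. (\<integral>\<^sup>+\<kappa>. of_nat (\<kappa> q) \<partial>measure_pmf (offs p)) * u q) = \<rho> * u p"
  shows "(\<integral>\<^sup>+k. (\<Sum>v\<in>generation r k n. u (vertex_type r v)) \<partial>offspring_measure offs) = \<rho> ^ n * u r"
proof (induction n)
  case 0
  interpret prob_space "offspring_measure offs"
    by (intro prob_space_PiM prob_space_offspring)
  show ?case by (simp add: generation_0 emeasure_space_1)
next
  case (Suc n)
  let ?M = "offspring_measure offs"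
  have 1: "(\<integral>\<^sup>+\<kappa>. (\<Sum>q\<in>UNIV. of_nat (\<kappa> q) * u q) \<partial>measure_pmf (offs p)) = \<rho> * u p" for p
    by (simp add: u[symmetric] nn_integral_sum nn_integral_multc)
  have "(\<integral>\<^sup>+k. (\<Sum>v\<in>generation r k (Suc n). u (vertex_type r v)) \<partial>?M)
    = (\<integral>\<^sup>+k. (\<Sum>v\<in>generation r k n. \<Sum>q\<in>UNIV. of_nat (k (v, vertex_type r v) q) * u q) \<partial>?M)"
    by (simp add: sum_generation_Suc)
  also have "\<dots> = (\<integral>\<^sup>+k. (\<Sum>v\<in>generation r k n. \<integral>\<^sup>+\<kappa>. (\<Sum>q\<in>UNIV. of_nat (\<kappa> q) * u q) \<partial>measure_pmf (offs (vertex_type r v))) \<partial>?M)"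
    by (rule nn_integral_generation_sum[where \<psi> = "\<lambda>p \<kappa>. \<Sum>q\<in>UNIV. of_nat (\<kappa> q) * u q"])
  also have "\<dots> = (\<integral>\<^sup>+k. \<rho> * (\<Sum>v\<in>generation r k n. u (vertex_type r v)) \<partial>?M)"
    by (simp add: 1 sum_distrib_left)
  also have "\<dots> = \<rho> * (\<integral>\<^sup>+k. (\<Sum>v\<in>generation r k n. u (vertex_type r v)) \<partial>?M)"
    by (intro nn_integral_cmult measurable_generation_sum)
  also have "\<dots> = \<rho> ^ Suc n * u r"
    by (simp add: Suc mult.assoc)
  finally show ?case .
qed

text \<open>For \<open>a = 1\<close> this is the generating function of the offspring law. The
  factor \<open>a\<close> weights a family, later by the probability that none of its displacements
  exceeds a threshold.\<close>

definition offspring_transform ::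
    "('q::finite \<Rightarrow> ('q \<Rightarrow> nat) pmf) \<Rightarrow> (('q \<Rightarrow> nat) \<Rightarrow> ennreal) \<Rightarrow> ('q \<Rightarrow> ennreal) \<Rightarrow> 'q \<Rightarrow> ennreal" where
  "offspring_transform offs a g p = (\<integral>\<^sup>+\<kappa>. a \<kappa> * (\<Prod>q\<in>UNIV. g q ^ \<kappa> q) \<partial>measure_pmf (offs p))"

text \<open>The last generation is averaged out first: its factors become powers of \<open>g\<close>
  in the offspring counts of the generation before, and averaging these yields the transform of
  \<open>g\<close>. The induction therefore needs \<open>g\<close> arbitrary.\<close>

lemma nn_integral_generations_prod:
  fixes offs :: "'q::finite \<Rightarrow> ('q \<Rightarrow> nat) pmf" and a :: "('q \<Rightarrow> nat) \<Rightarrow> ennreal"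
  shows "(\<integral>\<^sup>+k. (\<Prod>j\<in>{J..<J + m}. \<Prod>v\<in>generation r k j. a (k (v, vertex_type r v))) *
            (\<Prod>v\<in>generation r k (J + m). g (vertex_type r v)) \<partial>offspring_measure offs)
    = (\<integral>\<^sup>+k. (\<Prod>v\<in>generation r k J. (offspring_transform offs a ^^ m) g (vertex_type r v)) \<partial>offspring_measure offs)"
proof (induction m arbitrary: g)
  case 0
  then show ?case by simp
next
  case (Suc m)
  let ?M = "offspring_measure offs"
  let ?G = "\<lambda>k. \<Prod>j\<in>{J..<J + m}. \<Prod>v\<in>generation r k j. a (k (v, vertex_type r v))"
  let ?\<psi> = "\<lambda>p \<kappa>. a \<kappa> * (\<Prod>q\<in>UNIV. g q ^ \<kappa> q)"
  have "(\<integral>\<^sup>+k. (\<Prod>j\<in>{J..<J + Suc m}. \<Prod>v\<in>generation r k j. a (k (v, vertex_type r v))) *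
            (\<Prod>v\<in>generation r k (J + Suc m). g (vertex_type r v)) \<partial>?M)
    = (\<integral>\<^sup>+k. ?G k * (\<Prod>v\<in>generation r k (J + m). ?\<psi> (vertex_type r v) (k (v, vertex_type r v))) \<partial>?M)"
    by (simp add: prod_generation_Suc prod.distrib prod_constant mult.assoc)
  also have "\<dots> = (\<integral>\<^sup>+k. ?G k * (\<Prod>v\<in>generation r k (J + m).
       \<integral>\<^sup>+\<kappa>. ?\<psi> (vertex_type r v) \<kappa> \<partial>measure_pmf (offs (vertex_type r v))) \<partial>?M)"
  proof (rule nn_integral_generation_prod)
    show "?G \<in> borel_measurable ?M" by measurable
    fix k :: "'q vertex \<times> 'q \<Rightarrow> 'q \<Rightarrow> nat" and i :: "'q vertex \<times> 'q" and b
    assume i: "J + m \<le> length (fst i)"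
    show "?G (k(i := b)) = ?G k"
    proof (intro prod.cong refl)
      fix j assume j: "j \<in> {J..<J + m}"
      show "generation r (k(i := b)) j = generation r k j"
        using i j by (intro generation_upd) auto
      fix v assume "v \<in> generation r k j"
      then have "i \<noteq> (v, vertex_type r v)" using i j by (auto simp: generation_def)
      then show "a ((k(i := b)) (v, vertex_type r v)) = a (k (v, vertex_type r v))" by simp
    qed
  qed
  also have "\<dots> = (\<integral>\<^sup>+k. ?G k * (\<Prod>v\<in>generation r k (J + m). offspring_transform offs a g (vertex_type r v)) \<partial>?M)"
    by (simp add: offspring_transform_def)
  also have "\<dots> = (\<integral>\<^sup>+k. (\<Prod>v\<in>generation r k J. (offspring_transform offs a ^^ Suc m) g (vertex_type r v)) \<partial>?M)"
    by (subst Suc) (simp only: funpow_Suc_right o_apply)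
  finally show ?case .
qed

lemma prod_generation_types:
  fixes k :: "'q::finite vertex \<times> 'q \<Rightarrow> 'q \<Rightarrow> nat"
  shows "(\<Prod>v\<in>generation r k n. f (vertex_type r v) :: 'b::comm_monoid_mult) =
    (\<Prod>q\<in>UNIV. f q ^ card {v \<in> generation r k n. vertex_type r v = q})"
proof -
  have "(\<Prod>v\<in>generation r k n. f (vertex_type r v)) =
     (\<Prod>q\<in>UNIV. \<Prod>v | v \<in> generation r k n \<and> vertex_type r v = q. f (vertex_type r v))"
    by (rule prod.group[symmetric]) (auto simp: finite_generation)
  then show ?thesis by simp
qed

section \<open>Joint law of tree and displacements\<close>

abbreviation displacement_measure :: "('q \<Rightarrow> nat \<Rightarrow> real) measure \<Rightarrow> ('q vertex \<Rightarrow> 'q \<Rightarrow> nat \<Rightarrow> real) measure" where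
  "displacement_measure D \<equiv> PiM UNIV (\<lambda>v. D)"

abbreviation tree_measure :: "('q \<Rightarrow> ('q \<Rightarrow> nat) pmf) \<Rightarrow> ('q \<Rightarrow> nat \<Rightarrow> real) measure \<Rightarrow>
    (('q vertex \<times> 'q \<Rightarrow> 'q \<Rightarrow> nat) \<times> ('q vertex \<Rightarrow> 'q \<Rightarrow> nat \<Rightarrow> real)) measure" where
  "tree_measure offs D \<equiv> offspring_measure offs \<Otimes>\<^sub>M displacement_measure D"

definition family_below :: "real \<Rightarrow> ('q \<Rightarrow> nat) \<Rightarrow> ('q \<Rightarrow> nat \<Rightarrow> real) set" where
  "family_below c \<kappa> = {y. \<forall>q. \<forall>i<\<kappa> q. y q i \<le> c}"

text \<open>The index \<open>j\<close> is the generation of the parents, so the displacements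
  concerned lead to generations \<open>J + 1\<close> to \<open>n\<close>. The condition is
  one-sided, in contrast to \<open>large_steps\<close>, which counts absolute values.\<close>

definition no_jump where
  "no_jump r k x J n c \<longleftrightarrow> (\<forall>j\<in>{J..<n}. \<forall>v\<in>generation r k j. x v \<in> family_below c (k (v, vertex_type r v)))"

fun path_weight :: "(real \<Rightarrow> ennreal) \<Rightarrow> ('q vertex \<Rightarrow> 'q \<Rightarrow> nat \<Rightarrow> real) \<Rightarrow> 'q vertex \<Rightarrow> ennreal" where
  "path_weight f x [] = 1"
| "path_weight f x ((q, i) # v) = path_weight f x v * f (x v q i)"

locale displacement_law = prob_space D for D :: "('q::finite \<Rightarrow> nat \<Rightarrow> real) measure" +
  assumes measurable_displacement[measurable]: "\<And>q i. (\<lambda>y. y q i) \<in> borel_measurable D"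
    and space_D: "space D = UNIV"
begin

lemma sets_Collect_D: "Measurable.pred D E \<Longrightarrow> {y. E y} \<in> events"
  by (simp add: pred_def space_D)

lemma sets_abs_gt: "{y. t < \<bar>y q i\<bar>} \<in> events"
  by (rule sets_Collect_D) measurable

lemma prob_space_displacement: "prob_space (displacement_measure D)"
  by (intro prob_space_PiM prob_space_axioms)

lemma sets_family_below[measurable]: "family_below c \<kappa> \<in> sets D"
proof -
  have "{y \<in> space D. \<forall>q. \<forall>i\<in>{..<\<kappa> q}. y q i \<le> c} \<in> sets D" by measurable
  also have "{y \<in> space D. \<forall>q. \<forall>i\<in>{..<\<kappa> q}. y q i \<le> c} = family_below c \<kappa>"
    by (auto simp: family_below_def space_D)
  finally show ?thesis .
qed

lemma space_displacement: "space (displacement_measure D) = UNIV"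
  by (simp add: space_PiM space_D PiE_def extensional_def)

lemma space_tree: "space (tree_measure offs D) = UNIV"
  by (simp add: space_pair_measure space_displacement space_offspring_measure)

lemma measurable_family[measurable]: "(\<lambda>x. x v) \<in> measurable (displacement_measure D) D"
  by measurable

lemma measurable_displacement'[measurable]: "(\<lambda>x. x v q i) \<in> borel_measurable (displacement_measure D)"
  by (rule measurable_compose[OF measurable_family]) measurable

lemma measurable_path_weight[measurable]:
  assumes [measurable]: "f \<in> borel_measurable borel"
  shows "(\<lambda>x. path_weight f x v) \<in> borel_measurable (displacement_measure D)"
proof (induction v)
  case (Cons a v)
  note [measurable] = this
  obtain q i where a: "a = (q, i)" by (cases a)
  show ?case unfolding a path_weight.simps by measurable
qed simp

lemma measurable_tree_generation_compose:
  assumes "\<And>A. finite A \<Longrightarrow> F A \<in> measurable (tree_measure offs D) N"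
  shows "(\<lambda>z. F (generation r (fst z) n) z) \<in> measurable (tree_measure offs D) N"
  by (rule measurable_compose_countable'[OF assms measurable_compose[OF measurable_fst measurable_generation] countable_finite_sets]) simp

lemma pred_family_below[measurable]:
  "Measurable.pred (tree_measure offs D) (\<lambda>z. snd z v \<in> family_below c (fst z (v, p)))"
proof -
  have "(\<lambda>z. (\<lambda>\<kappa> z. snd z v \<in> family_below c \<kappa>) (fst z (v, p)) z) \<in> measurable (tree_measure offs D) (count_space UNIV)"
    by (rule measurable_compose_countable) measurable
  then show ?thesis by simp
qed

lemma pred_no_jump[measurable]:
  "Measurable.pred (tree_measure offs D) (\<lambda>z. no_jump r (fst z) (snd z) J n c)"
proof -
  have "Measurable.pred (tree_measure offs D)
     (\<lambda>z. \<forall>v\<in>generation r (fst z) j. snd z v \<in> family_below c (fst z (v, vertex_type r v)))" for j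
    by (rule measurable_tree_generation_compose[where F = "\<lambda>A z. \<forall>v\<in>A. snd z v \<in> family_below c (fst z (v, vertex_type r v))"]) measurable
  note [measurable] = this
  show ?thesis unfolding no_jump_def by measurable
qed

lemma nn_integral_tree:
  assumes f: "f \<in> borel_measurable (tree_measure offs D)"
  shows "(\<integral>\<^sup>+z. f z \<partial>tree_measure offs D) = (\<integral>\<^sup>+k. \<integral>\<^sup>+x. f (k, x) \<partial>displacement_measure D \<partial>offspring_measure offs)"
proof -
  interpret X: prob_space "displacement_measure D" by (rule prob_space_displacement)
  show ?thesis by (rule X.nn_integral_fst[symmetric, OF f])
qed

text \<open>For a fixed tree the families of distinct parents are independent, so the probability is
  a product over the parents; averaging over the tree iterates the transform \<open>m\<close> times.
  Dependence between siblings stays inside the probability of \<open>family_below\<close>.\<close>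

lemma emeasure_no_jump:
  "emeasure (tree_measure offs D) {z. no_jump r (fst z) (snd z) J (J + m) c}
    = (\<integral>\<^sup>+k. (\<Prod>v\<in>generation r k J.
        (offspring_transform offs (\<lambda>\<kappa>. emeasure D (family_below c \<kappa>)) ^^ m) (\<lambda>_. 1) (vertex_type r v)) \<partial>offspring_measure offs)"
proof -
  let ?a = "\<lambda>\<kappa>. emeasure D (family_below c \<kappa>)"
  let ?E = "{z. no_jump r (fst z) (snd z) J (J + m) c}"
  have 1: "(\<integral>\<^sup>+x. indicator ?E (k, x) \<partial>displacement_measure D)
    = (\<Prod>j\<in>{J..<J + m}. \<Prod>v\<in>generation r k j. ?a (k (v, vertex_type r v)))" for k :: "'q vertex \<times> 'q \<Rightarrow> 'q \<Rightarrow> nat"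
  proof -
    let ?V = "\<Union>j\<in>{J..<J + m}. generation r k j"
    interpret X: prob_space "displacement_measure D" by (rule prob_space_displacement)
    have fin: "finite ?V" by (simp add: finite_generation)
    have "(\<integral>\<^sup>+x. indicator ?E (k, x) \<partial>displacement_measure D)
      = (\<integral>\<^sup>+x. 1 * (\<Prod>v\<in>?V. indicator (family_below c (k (v, vertex_type r v))) (x v)) \<partial>displacement_measure D)"
    proof (intro nn_integral_cong)
      fix x :: "'q vertex \<Rightarrow> 'q \<Rightarrow> nat \<Rightarrow> real"
      show "indicator ?E (k, x) =
        1 * (\<Prod>v\<in>?V. indicator (family_below c (k (v, vertex_type r v))) (x v) :: ennreal)"
      proof (cases "no_jump r k x J (J + m) c")
        case True
        then have "(\<Prod>v\<in>?V. indicator (family_below c (k (v, vertex_type r v))) (x v) :: ennreal) = 1"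
          by (intro prod.neutral) (auto simp: no_jump_def)
        with True show ?thesis by simp
      next
        case False
        then obtain v where "v \<in> ?V" "x v \<notin> family_below c (k (v, vertex_type r v))"
          by (auto simp: no_jump_def)
        with False fin show ?thesis
          by (subst prod_zero) (auto intro!: bexI[of _ v])
      qed
    qed
    also have "\<dots> = (\<integral>\<^sup>+x. 1 \<partial>displacement_measure D) * (\<Prod>v\<in>?V. \<integral>\<^sup>+y. indicator (family_below c (k (v, vertex_type r v))) y \<partial>D)"
      by (rule nn_integral_PiM_coordinates) (auto simp: fin prob_space_axioms)
    also have "\<dots> = (\<Prod>v\<in>?V. ?a (k (v, vertex_type r v)))"
      by (simp add: X.emeasure_space_1)
    also have "\<dots> = (\<Prod>j\<in>{J..<J + m}. \<Prod>v\<in>generation r k j. ?a (k (v, vertex_type r v)))"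
      by (rule prod.UNION_disjoint) (auto simp: finite_generation, auto simp: generation_def)
    finally show ?thesis .
  qed
  have "emeasure (tree_measure offs D) ?E
    = (\<integral>\<^sup>+z. indicator ?E z \<partial>tree_measure offs D)"
    using pred_no_jump[where offs = offs and r = r and J = J and n = "J + m" and c = c] by (simp add: pred_def space_tree)
  also have "\<dots> = (\<integral>\<^sup>+k. \<integral>\<^sup>+x. indicator ?E (k, x) \<partial>displacement_measure D \<partial>offspring_measure offs)"
    using pred_no_jump[where offs = offs and r = r and J = J and n = "J + m" and c = c] by (intro nn_integral_tree) (simp add: pred_def space_tree)
  also have "\<dots> = (\<integral>\<^sup>+k. (\<Prod>j\<in>{J..<J + m}. \<Prod>v\<in>generation r k j. ?a (k (v, vertex_type r v))) *
            (\<Prod>v\<in>generation r k (J + m). 1) \<partial>offspring_measure offs)"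
    by (simp add: 1)
  also have "\<dots> = (\<integral>\<^sup>+k. (\<Prod>v\<in>generation r k J.
        (offspring_transform offs ?a ^^ m) (\<lambda>_. 1) (vertex_type r v)) \<partial>offspring_measure offs)"
    by (rule nn_integral_generations_prod)
  finally show ?thesis .
qed

text \<open>A union bound over families. \<open>B\<close> measures the mean cost of one family in
  units of \<open>u p\<close>, so a whole generation is controlled by the exact growth of the
  \<open>u\<close>-weight.\<close>

lemma emeasure_early_jump_le:
  fixes u :: "'q \<Rightarrow> ennreal"
  assumes u: "\<And>p. (\<Sum>q\<in>UNIV. (\<integral>\<^sup>+\<kappa>. of_nat (\<kappa> q) \<partial>measure_pmf (offs p)) * u q) = \<rho> * u p"
    and B: "\<And>p. (\<integral>\<^sup>+\<kappa>. emeasure D (- family_below c \<kappa>) \<partial>measure_pmf (offs p)) \<le> B * u p"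
  shows "emeasure (tree_measure offs D) {z. \<not> no_jump r (fst z) (snd z) 0 n c} \<le> B * (\<Sum>j<n. \<rho> ^ j) * u r"
proof -
  let ?e = "\<lambda>\<kappa>. emeasure D (- family_below c \<kappa>)"
  let ?J = "{z. \<not> no_jump r (fst z) (snd z) 0 n c}"
  let ?I = "\<lambda>k x j. \<Sum>v\<in>generation r k j. indicator (- family_below c (k (v, vertex_type r v))) (x v) :: ennreal"
  let ?E = "\<lambda>k j. \<Sum>v\<in>generation r k j. ?e (k (v, vertex_type r v))"
  have compl: "- family_below c \<kappa> \<in> sets D" for \<kappa>
    using sets.compl_sets[OF sets_family_below[of c \<kappa>]] by (simp add: space_D Compl_eq_Diff_UNIV)
  have 1: "(\<integral>\<^sup>+x. indicator ?J (k, x) \<partial>displacement_measure D)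
    \<le> (\<Sum>j<n. ?E k j)" for k :: "'q vertex \<times> 'q \<Rightarrow> 'q \<Rightarrow> nat"
  proof -
    have "(\<integral>\<^sup>+x. indicator ?J (k, x) \<partial>displacement_measure D)
      \<le> (\<integral>\<^sup>+x. (\<Sum>j<n. ?I k x j) \<partial>displacement_measure D)"
    proof (intro nn_integral_mono)
      fix x :: "'q vertex \<Rightarrow> 'q \<Rightarrow> nat \<Rightarrow> real"
      show "indicator ?J (k, x)
        \<le> (\<Sum>j<n. ?I k x j)"
      proof (cases "no_jump r k x 0 n c")
        case False
        then obtain j v where j: "j < n" and v: "v \<in> generation r k j" and nf: "x v \<notin> family_below c (k (v, vertex_type r v))"
          by (auto simp: no_jump_def)
        have "1 = (indicator (- family_below c (k (v, vertex_type r v))) (x v) :: ennreal)"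
          using nf by simp
        also have "\<dots> \<le> (?I k x j)"
          by (rule member_le_sum[OF v]) (auto simp: finite_generation)
        also have "\<dots> \<le> (\<Sum>j<n. ?I k x j)"
          using j by (intro member_le_sum[where f = "\<lambda>j. ?I k x j"]) auto
        finally show ?thesis using False by simp
      qed simp
    qed
    also have "\<dots> = (\<Sum>j<n. \<Sum>v\<in>generation r k j. \<integral>\<^sup>+x. indicator (- family_below c (k (v, vertex_type r v))) (x v) \<partial>displacement_measure D)"
      using compl by (simp add: nn_integral_sum)
    also have "\<dots> = (\<Sum>j<n. ?E k j)"
    proof (intro sum.cong refl)
      fix v
      interpret X: prob_space "displacement_measure D" by (rule prob_space_displacement)
      have "(\<integral>\<^sup>+x. 1 * indicator (- family_below c (k (v, vertex_type r v))) (x v) \<partial>displacement_measure D)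
        = (\<integral>\<^sup>+x. 1 \<partial>displacement_measure D) * (\<integral>\<^sup>+y. indicator (- family_below c (k (v, vertex_type r v))) y \<partial>D)"
        using compl by (intro nn_integral_PiM_coordinate) (auto simp: prob_space_axioms)
      then show "(\<integral>\<^sup>+x. indicator (- family_below c (k (v, vertex_type r v))) (x v) \<partial>displacement_measure D) = ?e (k (v, vertex_type r v))"
        using compl by (simp add: X.emeasure_space_1)
    qed
    finally show ?thesis .
  qed
  have "emeasure (tree_measure offs D) ?J
    = (\<integral>\<^sup>+z. indicator ?J z \<partial>tree_measure offs D)"
    using pred_no_jump[where offs = offs and r = r and J = 0 and n = n and c = c, THEN pred_intros_logic(2)] by (simp add: pred_def space_tree)
  also have "\<dots> = (\<integral>\<^sup>+k. \<integral>\<^sup>+x. indicator ?J (k, x) \<partial>displacement_measure D \<partial>offspring_measure offs)"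
    using pred_no_jump[where offs = offs and r = r and J = 0 and n = n and c = c, THEN pred_intros_logic(2)] by (intro nn_integral_tree) (simp add: pred_def space_tree)
  also have "\<dots> \<le> (\<integral>\<^sup>+k. (\<Sum>j<n. ?E k j) \<partial>offspring_measure offs)"
    by (intro nn_integral_mono 1)
  also have "\<dots> = (\<Sum>j<n. \<integral>\<^sup>+k. (?E k j) \<partial>offspring_measure offs)"
    by (rule nn_integral_sum) measurable
  also have "\<dots> \<le> (\<Sum>j<n. B * (\<rho> ^ j * u r))"
  proof (rule sum_mono)
    fix j
    have "(\<integral>\<^sup>+k. (?E k j) \<partial>offspring_measure offs)
      = (\<integral>\<^sup>+k. (\<Sum>v\<in>generation r k j. \<integral>\<^sup>+\<kappa>. ?e \<kappa> \<partial>measure_pmf (offs (vertex_type r v))) \<partial>offspring_measure offs)"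
      by (rule nn_integral_generation_sum)
    also have "\<dots> \<le> (\<integral>\<^sup>+k. B * (\<Sum>v\<in>generation r k j. u (vertex_type r v)) \<partial>offspring_measure offs)"
      using B by (intro nn_integral_mono) (auto simp: sum_distrib_left intro!: sum_mono)
    also have "\<dots> = B * (\<integral>\<^sup>+k. (\<Sum>v\<in>generation r k j. u (vertex_type r v)) \<partial>offspring_measure offs)"
      by (rule nn_integral_cmult) measurable
    also have "\<dots> = B * (\<rho> ^ j * u r)"
      by (subst expected_generation_harmonic[OF u]) simp
    finally show "(\<integral>\<^sup>+k. (?E k j) \<partial>offspring_measure offs) \<le> B * (\<rho> ^ j * u r)" .
  qed
  also have "\<dots> = B * (\<Sum>j<n. \<rho> ^ j) * u r"
    by (simp add: sum_distrib_left sum_distrib_right mult.assoc)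
  finally show ?thesis .
qed

text \<open>Each step of a path comes from the family of a different parent, so the steps are
  independent even when siblings are not, and the mean of the product is the product of the
  means.\<close>

lemma nn_integral_path_weight_le:
  assumes f[measurable]: "f \<in> borel_measurable borel"
    and B: "\<And>q i. (\<integral>\<^sup>+y. f (y q i) \<partial>D) \<le> B"
  shows "(\<integral>\<^sup>+x. path_weight f x v \<partial>displacement_measure D) \<le> B ^ length v"
proof (induction v)
  case Nil
  interpret X: prob_space "displacement_measure D" by (rule prob_space_displacement)
  show ?case by (simp add: X.emeasure_space_1)
next
  case (Cons a v)
  obtain q i where a: "a = (q, i)" by (cases a)
  \<comment> \<open>The weight of \<open>v'\<close> reads only the families of proper ancestors of
    \<open>v'\<close>, hence not the family of a vertex at least as long as
    \<open>v'\<close>.\<close>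
  have dep: "path_weight f (x(w := y)) v' = path_weight f x v'" if "length v' \<le> length w"
    for x :: "'q vertex \<Rightarrow> 'q \<Rightarrow> nat \<Rightarrow> real" and w v' :: "'q vertex" and y
    using that by (induction f x v' rule: path_weight.induct) auto
  have "(\<integral>\<^sup>+x. path_weight f x (a # v) \<partial>displacement_measure D)
    = (\<integral>\<^sup>+x. path_weight f x v \<partial>displacement_measure D) * (\<integral>\<^sup>+y. f (y q i) \<partial>D)"
    unfolding a path_weight.simps
    by (rule nn_integral_PiM_coordinate[where \<phi> = "\<lambda>y. f (y q i)"]) (simp_all add: prob_space_axioms dep)
  also have "\<dots> \<le> B ^ length v * B"
    by (intro mult_mono Cons B) auto
  finally show ?case by (simp add: mult.commute)
qed

text \<open>Tree and displacements are independent: averaging the displacements first yields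
  \<open>B ^ n\<close>, and harmonicity of \<open>u\<close> yields the rest.\<close>

lemma expected_path_weight_le:
  fixes u :: "'q \<Rightarrow> ennreal"
  assumes u: "\<And>p. (\<Sum>q\<in>UNIV. (\<integral>\<^sup>+\<kappa>. of_nat (\<kappa> q) \<partial>measure_pmf (offs p)) * u q) = \<rho> * u p"
    and f[measurable]: "f \<in> borel_measurable borel"
    and B: "\<And>q i. (\<integral>\<^sup>+y. f (y q i) \<partial>D) \<le> B"
  shows "(\<integral>\<^sup>+z. (\<Sum>v\<in>generation r (fst z) n. u (vertex_type r v) * path_weight f (snd z) v) \<partial>tree_measure offs D)
     \<le> (B * \<rho>) ^ n * u r"
proof -
  have "(\<integral>\<^sup>+z. (\<Sum>v\<in>generation r (fst z) n. u (vertex_type r v) * path_weight f (snd z) v) \<partial>tree_measure offs D)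
    = (\<integral>\<^sup>+k. \<integral>\<^sup>+x. (\<Sum>v\<in>generation r k n. u (vertex_type r v) * path_weight f x v) \<partial>displacement_measure D \<partial>offspring_measure offs)"
  proof (subst nn_integral_tree)
    note [measurable] = measurable_compose[OF measurable_snd measurable_path_weight[OF f]]
    show "(\<lambda>z. \<Sum>v\<in>generation r (fst z) n. u (vertex_type r v) * path_weight f (snd z) v)
        \<in> borel_measurable (tree_measure offs D)"
      by (rule measurable_tree_generation_compose[where F = "\<lambda>A z. \<Sum>v\<in>A. u (vertex_type r v) * path_weight f (snd z) v"]) measurable
  qed simp
  also have "\<dots> = (\<integral>\<^sup>+k. (\<Sum>v\<in>generation r k n. u (vertex_type r v) * \<integral>\<^sup>+x. path_weight f x v \<partial>displacement_measure D) \<partial>offspring_measure offs)"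
    by (simp add: nn_integral_sum nn_integral_cmult)
  also have "\<dots> \<le> (\<integral>\<^sup>+k. B ^ n * (\<Sum>v\<in>generation r k n. u (vertex_type r v)) \<partial>offspring_measure offs)"
  proof (intro nn_integral_mono)
    fix k :: "'q vertex \<times> 'q \<Rightarrow> 'q \<Rightarrow> nat"
    show "(\<Sum>v\<in>generation r k n. u (vertex_type r v) * \<integral>\<^sup>+x. path_weight f x v \<partial>displacement_measure D)
      \<le> B ^ n * (\<Sum>v\<in>generation r k n. u (vertex_type r v))"
      unfolding sum_distrib_left
    proof (rule sum_mono)
      fix v assume "v \<in> generation r k n"
      then have "length v = n" by (simp add: generation_def)
      then show "u (vertex_type r v) * (\<integral>\<^sup>+x. path_weight f x v \<partial>displacement_measure D) \<le> B ^ n * u (vertex_type r v)"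
        using nn_integral_path_weight_le[OF f B, of v] by (subst mult.commute) (auto intro: mult_right_mono)
    qed
  qed
  also have "\<dots> = B ^ n * (\<integral>\<^sup>+k. (\<Sum>v\<in>generation r k n. u (vertex_type r v)) \<partial>offspring_measure offs)"
    by (intro nn_integral_cmult measurable_generation_sum)
  also have "\<dots> = (B * \<rho>) ^ n * u r"
    by (subst expected_generation_harmonic[OF u]) (simp add: power_mult_distrib mult.assoc)
  finally show ?thesis .
qed

end

section \<open>Deterministic comparison of positions with single displacements on a path\<close>

fun large_steps :: "real \<Rightarrow> ('q vertex \<Rightarrow> 'q \<Rightarrow> nat \<Rightarrow> real) \<Rightarrow> 'q vertex \<Rightarrow> nat" where
  "large_steps c x [] = 0"
| "large_steps c x ((q, i) # v) = large_steps c x v + (if c < \<bar>x v q i\<bar> then 1 else 0)"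

lemma abs_position_le:
  "large_steps c x v = 0 \<Longrightarrow> \<bar>position x v\<bar> \<le> real (length v) * c"
proof (induction c x v rule: large_steps.induct)
  case (2 c x q i v)
  then have "\<bar>position x v\<bar> \<le> real (length v) * c" "\<bar>x v q i\<bar> \<le> c"
    by (auto split: if_splits)
  then show ?case by (simp add: algebra_simps)
qed simp

text \<open>At most one step exceeds \<open>c\<close> in absolute value; it is at most
  \<open>z\<close> by the absence of jumps, and the others add at most \<open>c\<close>
  each.\<close>

lemma position_le:
  assumes "in_tree r k v" "no_jump r k x 0 (length v) z" "large_steps c x v \<le> 1" "0 \<le> z" "0 \<le> c"
  shows "position x v \<le> z + real (length v) * c"
  using assms
proof (induction v)
  case (Cons a v)
  obtain q i where a: "a = (q, i)" by (cases a)
  have tree: "in_tree r k v" "i < k (v, vertex_type r v) q" using Cons.prems(1) by (auto simp: a)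
  have nj: "no_jump r k x 0 (length v) z" using Cons.prems(2) by (auto simp: no_jump_def)
  have "v \<in> generation r k (length v)" using tree by (simp add: generation_def)
  then have "x v \<in> family_below z (k (v, vertex_type r v))"
    using Cons.prems(2) by (auto simp: no_jump_def)
  then have step: "x v q i \<le> z" using tree by (auto simp: family_below_def)
  show ?case
  proof (cases "c < \<bar>x v q i\<bar>")
    case True
    then have "large_steps c x v = 0" using Cons.prems(3) by (simp add: a)
    from abs_position_le[OF this] step show ?thesis
      using Cons.prems(5) by (simp add: a algebra_simps)
  next
    case False
    then have "large_steps c x v \<le> 1" using Cons.prems(3) by (simp add: a)
    from Cons.IH[OF tree(1) nj this Cons.prems(4,5)] False show ?thesis
      by (simp add: a algebra_simps)
  qed
qed simp

text \<open>Addresses list the latest ancestor first, so ancestors are suffixes and the step into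
  \<open>(q, i) # u\<close> lies on the path to \<open>v\<close>.\<close>

lemma large_steps_suffix:
  "suffix ((q, i) # u) v \<Longrightarrow> c < \<bar>x u q i\<bar> \<Longrightarrow> 1 \<le> large_steps c x v"
proof (induction v)
  case (Cons a v)
  then show ?case by (cases a) (auto simp: suffix_Cons)
qed (auto simp: suffix_def)

text \<open>The step into \<open>(q, i) # u\<close> exceeds \<open>c\<close>, so it is the only one
  that does; the remaining steps can pull the position down by at most \<open>c\<close>
  each.\<close>

lemma position_ge:
  assumes "suffix ((q, i) # u) v" "large_steps c x v \<le> 1" "z \<le> x u q i" "c < z" "0 \<le> c"
  shows "z - real (length v) * c \<le> position x v"
  using assms
proof (induction v)
  case (Cons a v)
  obtain p j where a: "a = (p, j)" by (cases a)
  from Cons.prems(1) consider "(q, i) # u = (p, j) # v" | "suffix ((q, i) # u) v"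
    by (auto simp: suffix_Cons a)
  then show ?case
  proof cases
    case 1
    then have "large_steps c x v = 0" using Cons.prems(2-5) by (auto simp: a)
    from abs_position_le[OF this] 1 show ?thesis
      using Cons.prems(3,5) by (auto simp: a algebra_simps)
  next
    case 2
    have "1 \<le> large_steps c x v"
      using 2 Cons.prems(3-5) by (intro large_steps_suffix) auto
    \<comment> \<open>The single large step already lies on the path to \<open>v\<close>, so the
      newest step is small.\<close>
    with Cons.prems(2) have "large_steps c x v \<le> 1" and step: "\<bar>x v p j\<bar> \<le> c"
      by (auto simp: a split: if_splits)
    from Cons.IH[OF 2 this(1) Cons.prems(3-5)] step show ?thesis
      by (simp add: a algebra_simps)
  qed
qed (auto simp: suffix_def)

text \<open>No line of descent dies out, as every particle has children of every type; this carries
  the effect of an early jump on to generation \<open>n\<close>.\<close>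

lemma exists_descendant:
  fixes k :: "'q vertex \<times> 'q \<Rightarrow> 'q \<Rightarrow> nat"
  assumes k: "\<And>i q. 1 \<le> k i q" and w: "w \<in> generation r k j" and "j \<le> n"
  shows "\<exists>v\<in>generation r k n. suffix w v"
  using \<open>j \<le> n\<close>
proof (induction n rule: dec_induct)
  case base
  then show ?case using w by auto
next
  case (step n)
  then obtain v where v: "v \<in> generation r k n" "suffix w v" by auto
  \<comment> \<open>Any type will do, so \<open>undefined\<close> serves; index \<open>0\<close>
    denotes the first child of that type.\<close>
  have "(undefined, 0) # v \<in> generation r k (Suc n)"
    using v(1) k[of "(v, vertex_type r v)" undefined] by (auto simp: generation_def)
  moreover have "suffix w ((undefined, 0) # v)" using v(2) by (rule suffix_ConsI)
  ultimately show ?case by blast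
qed

lemma rightmost_less:
  fixes k :: "'q::finite vertex \<times> 'q \<Rightarrow> 'q \<Rightarrow> nat"
  assumes k: "\<And>i q. 1 \<le> k i q"
    and steps: "\<And>v. v \<in> generation r k n \<Longrightarrow> large_steps c x v \<le> 1"
    and nj: "no_jump r k x 0 n z" and z: "0 \<le> z" "0 \<le> c" "z + real n * c < y"
  shows "rightmost r k x n < y"
proof -
  have "[] \<in> generation r k 0" by (simp add: generation_0)
  from exists_descendant[of k, OF k this] have ne: "generation r k n \<noteq> {}" by auto
  have "position x v < y" if v: "v \<in> generation r k n" for v
    using position_le[of r k v x z c] v steps[OF v] nj z by (auto simp: generation_def)
  then show ?thesis
    using ne by (simp add: rightmost_def finite_generation)
qed

text \<open>By contradiction: the target of a displacement above \<open>z\<close> has a descendant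
  in generation \<open>n\<close>, and its position is at least \<open>z - n * c\<close>, hence not
  below \<open>y\<close>.\<close>

lemma no_jump_if_rightmost_less:
  fixes k :: "'q::finite vertex \<times> 'q \<Rightarrow> 'q \<Rightarrow> nat"
  assumes k: "\<And>i q. 1 \<le> k i q"
    and steps: "\<And>v. v \<in> generation r k n \<Longrightarrow> large_steps c x v \<le> 1"
    and less: "rightmost r k x n < y" and z: "0 \<le> c" "c < z" "y \<le> z - real n * c"
  shows "no_jump r k x 0 n z"
  unfolding no_jump_def family_below_def
proof (intro ballI CollectI allI impI, rule ccontr)
  fix j u q i assume j: "j \<in> {0..<n}" and u: "u \<in> generation r k j"
    and i: "i < k (u, vertex_type r u) q" and "\<not> x u q i \<le> z"
  have "(q, i) # u \<in> generation r k (Suc j)" using u i by (simp add: generation_def)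
  then have "\<exists>v\<in>generation r k n. suffix ((q, i) # u) v"
    using j by (intro exists_descendant[of k, OF k]) auto
  then obtain v where v: "v \<in> generation r k n" "suffix ((q, i) # u) v" by blast
  have "z - real (length v) * c \<le> position x v"
    using \<open>\<not> x u q i \<le> z\<close> z by (intro position_ge[OF v(2) steps[OF v(1)]]) auto
  moreover have "position x v \<le> rightmost r k x n"
    unfolding rightmost_def using v(1) by (intro Max_ge) (auto simp: finite_generation)
  moreover have "length v = n" using v(1) by (simp add: generation_def)
  ultimately show False using less z by simp
qed

lemma path_weight_large_steps:
  assumes "0 \<le> s"
  shows "path_weight (\<lambda>t::real. if c < \<bar>t\<bar> then ennreal (1 + s) else 1) x v = ennreal ((1 + s) ^ large_steps c x v)"
proof (induction v)
  case (Cons a v)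
  obtain q i where a: "a = (q, i)" by (cases a)
  show ?case using assms by (auto simp: Cons a ennreal_mult[symmetric] mult.commute simp del: ennreal_plus)
qed simp

context displacement_law
begin

lemma pred_exists_large_steps[measurable]:
  "Measurable.pred (tree_measure offs D) (\<lambda>z. \<exists>v\<in>generation r (fst z) n. 2 \<le> large_steps c (snd z) v)"
proof -
  have 1: "(\<lambda>x. large_steps c x v) \<in> measurable (displacement_measure D) (count_space UNIV)" for v :: "'q vertex"
  proof (induction v)
    case (Cons a v)
    note [measurable] = this
    obtain q i where a: "a = (q, i)" by (cases a)
    show ?case unfolding a large_steps.simps by measurable
  qed simp
  have [measurable]: "(\<lambda>z. large_steps c (snd z) v) \<in> measurable (tree_measure offs D) (count_space UNIV)" for v :: "'q vertex"
    by (rule measurable_compose[OF measurable_snd 1])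
  show ?thesis
    by (rule measurable_tree_generation_compose[where F = "\<lambda>A z. \<exists>v\<in>A. 2 \<le> large_steps c (snd z) v"]) measurable
qed

text \<open>Markov's inequality for the number of vertices, each weighted by \<open>u\<close> and by \<open>(1 + s)\<close> to the
  power of the number of large steps on its path; the parameter \<open>s\<close> is optimised later.\<close>

lemma emeasure_two_large_steps_le:
  fixes u :: "'q \<Rightarrow> ennreal"
  assumes u: "\<And>p. (\<Sum>q\<in>UNIV. (\<integral>\<^sup>+\<kappa>. of_nat (\<kappa> q) \<partial>measure_pmf (offs p)) * u q) = \<rho> * u p"
    and s: "0 \<le> s" and \<tau>: "0 \<le> \<tau>" "\<And>q i. emeasure D {y. c < \<bar>y q i\<bar>} \<le> ennreal \<tau>"
    and u0: "\<And>p. u0 \<le> u p"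
  shows "u0 * ennreal ((1 + s)\<^sup>2) * emeasure (tree_measure offs D) {z. \<exists>v\<in>generation r (fst z) n. 2 \<le> large_steps c (snd z) v}
    \<le> (ennreal (1 + s * \<tau>) * \<rho>) ^ n * u r"
proof -
  let ?f = "\<lambda>t::real. if c < \<bar>t\<bar> then ennreal (1 + s) else 1"
  let ?E = "{z. \<exists>v\<in>generation r (fst z) n. 2 \<le> large_steps c (snd z) v}"
  have E: "?E \<in> sets (tree_measure offs D)"
    using pred_exists_large_steps[where offs = offs and r = r and n = n and c = c] by (simp add: pred_def space_tree)
  have f: "?f \<in> borel_measurable borel" by measurable
  have B: "(\<integral>\<^sup>+y. ?f (y q i) \<partial>D) \<le> ennreal (1 + s * \<tau>)" for q i
  proof -
    note [measurable] = sets_abs_gt[of c q i]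
    have "(\<integral>\<^sup>+y. ?f (y q i) \<partial>D) = (\<integral>\<^sup>+y. 1 + ennreal s * indicator {y. c < \<bar>y q i\<bar>} y \<partial>D)"
      using s by (intro nn_integral_cong) (auto simp: ennreal_plus split: split_indicator)
    also have "\<dots> = 1 + ennreal s * emeasure D {y. c < \<bar>y q i\<bar>}"
      by (subst nn_integral_add) (auto simp: nn_integral_cmult emeasure_space_1)
    also have "\<dots> \<le> 1 + ennreal s * ennreal \<tau>"
      by (intro add_left_mono mult_left_mono \<tau>(2)) auto
    also have "\<dots> = ennreal (1 + s * \<tau>)" using s \<tau> by (simp add: ennreal_mult ennreal_plus)
    finally show ?thesis .
  qed
  have "u0 * ennreal ((1 + s)\<^sup>2) * emeasure (tree_measure offs D) ?E
    = (\<integral>\<^sup>+z. u0 * ennreal ((1 + s)\<^sup>2) * indicator ?E z \<partial>tree_measure offs D)"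
    using E by (subst nn_integral_cmult) auto
  also have "\<dots> \<le> (\<integral>\<^sup>+z. (\<Sum>v\<in>generation r (fst z) n. u (vertex_type r v) * path_weight ?f (snd z) v) \<partial>tree_measure offs D)"
  proof (intro nn_integral_mono)
    fix z :: "('q vertex \<times> 'q \<Rightarrow> 'q \<Rightarrow> nat) \<times> ('q vertex \<Rightarrow> 'q \<Rightarrow> nat \<Rightarrow> real)"
    show "u0 * ennreal ((1 + s)\<^sup>2) * indicator ?E z
      \<le> (\<Sum>v\<in>generation r (fst z) n. u (vertex_type r v) * path_weight ?f (snd z) v)"
    proof (cases "z \<in> ?E")
      case True
      then obtain v where v: "v \<in> generation r (fst z) n" "2 \<le> large_steps c (snd z) v" by auto
      have "u0 * ennreal ((1 + s)\<^sup>2) \<le> u (vertex_type r v) * path_weight ?f (snd z) v"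
        unfolding path_weight_large_steps[OF s]
        using s v(2) by (intro mult_mono u0 ennreal_leI power_increasing) auto
      also have "\<dots> \<le> (\<Sum>v\<in>generation r (fst z) n. u (vertex_type r v) * path_weight ?f (snd z) v)"
        by (rule member_le_sum[OF v(1)]) (auto simp: finite_generation)
      finally show ?thesis using True by simp
    qed simp
  qed
  also have "\<dots> \<le> (ennreal (1 + s * \<tau>) * \<rho>) ^ n * u r"
    by (rule expected_path_weight_le[OF u f B])
  finally show ?thesis .
qed

end

lemma (in displacement_law) measurable_position:
  "(\<lambda>x. position x v) \<in> borel_measurable (displacement_measure D)"
proof (induction v)
  case (Cons a v)
  note [measurable] = Cons
  obtain q i where a: "a = (q, i)" by (cases a)
  show ?case unfolding a position.simps by measurable
qed simp

lemma (in displacement_law) pred_rightmost_less: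
  "Measurable.pred (tree_measure offs D) (\<lambda>z. rightmost r (fst z) (snd z) n < y)"
proof -
  have [measurable]: "(\<lambda>z. position (snd z) v) \<in> borel_measurable (tree_measure offs D)" for v :: "'q vertex"
    by (rule measurable_compose[OF measurable_snd measurable_position])
  have "Measurable.pred (tree_measure offs D) (\<lambda>z. Max (position (snd z) ` A) < y)" if "finite A" for A :: "'q vertex set"
  proof (cases "A = {}")
    case False
    then have eq: "Max (position x ` A) < y \<longleftrightarrow> (\<forall>v\<in>A. position x v < y)" for x
      using that by simp
    show ?thesis
      unfolding eq using that by measurable
  qed simp
  then show ?thesis
    unfolding rightmost_def
    by (rule measurable_tree_generation_compose[where F = "\<lambda>A z. Max (position (snd z) ` A) < y"])
qed

section \<open>Transfer to the probability space of the walk\<close>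

context displacement_law
begin

text \<open>A union bound with a bound depending on the type alone. The set \<open>S\<close> of
  types is left free so that the types other than \<open>Q\<close> can be estimated
  separately.\<close>

lemma prob_family_above_le:
  assumes \<tau>: "\<And>q i. prob {y. c < \<bar>y q i\<bar>} \<le> \<tau> q" and S: "finite S"
  shows "prob {y. \<exists>q\<in>S. \<exists>i<\<kappa> q. c < y q i} \<le> (\<Sum>q\<in>S. real (\<kappa> q) * \<tau> q)"
proof -
  have sub: "{y. \<exists>q\<in>S. \<exists>i<\<kappa> q. c < y q i} \<subseteq> (\<Union>q\<in>S. \<Union>i\<in>{..<\<kappa> q}. {y. c < \<bar>y q i\<bar>})"
  proof
    fix y assume "y \<in> {y. \<exists>q\<in>S. \<exists>i<\<kappa> q. c < y q i}"
    then obtain q i where "q \<in> S" "i < \<kappa> q" "c < y q i" by auto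
    then have "q \<in> S" "i \<in> {..<\<kappa> q}" "c < \<bar>y q i\<bar>" by auto
    then show "y \<in> (\<Union>q\<in>S. \<Union>i\<in>{..<\<kappa> q}. {y. c < \<bar>y q i\<bar>})" by blast
  qed
  have "prob {y. \<exists>q\<in>S. \<exists>i<\<kappa> q. c < y q i} \<le> prob (\<Union>q\<in>S. \<Union>i\<in>{..<\<kappa> q}. {y. c < \<bar>y q i\<bar>})"
    using S by (intro finite_measure_mono sub) (auto intro: sets_abs_gt)
  also have "\<dots> \<le> (\<Sum>q\<in>S. prob (\<Union>i\<in>{..<\<kappa> q}. {y. c < \<bar>y q i\<bar>}))"
    using S by (intro finite_measure_subadditive_finite) (auto intro: sets_abs_gt)
  also have "\<dots> \<le> (\<Sum>q\<in>S. \<Sum>i\<in>{..<\<kappa> q}. prob {y. c < \<bar>y q i\<bar>})"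
    by (intro sum_mono finite_measure_subadditive_finite) (auto intro: sets_abs_gt)
  also have "\<dots> \<le> (\<Sum>q\<in>S. \<Sum>i\<in>{..<\<kappa> q}. \<tau> q)"
    by (intro sum_mono \<tau>)
  finally show ?thesis by simp
qed

lemma Compl_family_below: "- family_below c \<kappa> = {y. \<exists>q\<in>UNIV. \<exists>i<\<kappa> q. c < y q i}"
  unfolding family_below_def by (rule set_eqI) (simp, meson not_le)

end

abbreviation mean_offspring :: "('q \<Rightarrow> ('q \<Rightarrow> nat) pmf) \<Rightarrow> 'q \<Rightarrow> 'q \<Rightarrow> real" where
  "mean_offspring offs p q \<equiv> measure_pmf.expectation (offs p) (\<lambda>k. real (k q))"

text \<open>The real-valued iterate of \<open>offspring_transform\<close> started at 1, that is, the
  probability that a tree with root type \<open>p\<close> has no displacement above \<open>c\<close>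
  up to generation \<open>m\<close>.\<close>

primrec no_jump_prob ::
    "('q::finite \<Rightarrow> ('q \<Rightarrow> nat) pmf) \<Rightarrow> ('q \<Rightarrow> nat \<Rightarrow> real) measure \<Rightarrow> real \<Rightarrow> nat \<Rightarrow> 'q \<Rightarrow> real" where
  "no_jump_prob offs D c 0 p = 1"
| "no_jump_prob offs D c (Suc m) p =
     measure_pmf.expectation (offs p)
       (\<lambda>\<kappa>. measure D (family_below c \<kappa>) * (\<Prod>q\<in>UNIV. no_jump_prob offs D c m q ^ \<kappa> q))"

context displacement_law
begin

lemma no_jump_prob_nonneg: "0 \<le> no_jump_prob offs D c m p"
proof (induction m arbitrary: p)
  case (Suc m)
  then show ?case
    unfolding no_jump_prob.simps by (intro integral_nonneg_AE AE_I2 mult_nonneg_nonneg prod_nonneg) auto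
qed simp

lemma no_jump_prob_le_1: "no_jump_prob offs D c m p \<le> 1"
proof (induction m arbitrary: p)
  case (Suc m)
  have "measure D (family_below c \<kappa>) * (\<Prod>q\<in>UNIV. no_jump_prob offs D c m q ^ \<kappa> q) \<le> 1 * 1" for \<kappa>
    by (intro mult_mono prod_le_1 prod_nonneg) (auto simp: no_jump_prob_nonneg Suc power_le_one)
  then show ?case
    unfolding no_jump_prob.simps by (intro measure_pmf.integral_le_const) 
      (auto intro!: measure_pmf.integrable_const_bound[where B = 1] simp: no_jump_prob_nonneg prod_nonneg)
qed simp

lemma offspring_transform_no_jump_prob:
  "(offspring_transform offs (\<lambda>\<kappa>. emeasure D (family_below c \<kappa>)) ^^ m) (\<lambda>_. 1) p = ennreal (no_jump_prob offs D c m p)"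
proof (induction m arbitrary: p)
  case (Suc m)
  have bound: "measure D (family_below c \<kappa>) * (\<Prod>q\<in>UNIV. no_jump_prob offs D c m q ^ \<kappa> q) \<le> 1" for \<kappa>
  proof -
    have "measure D (family_below c \<kappa>) * (\<Prod>q\<in>UNIV. no_jump_prob offs D c m q ^ \<kappa> q) \<le> 1 * 1"
      by (intro mult_mono prod_le_1 prod_nonneg) (auto simp: no_jump_prob_nonneg no_jump_prob_le_1 power_le_one)
    then show ?thesis by simp
  qed
  have "(offspring_transform offs (\<lambda>\<kappa>. emeasure D (family_below c \<kappa>)) ^^ Suc m) (\<lambda>_. 1) p
    = (\<integral>\<^sup>+\<kappa>. emeasure D (family_below c \<kappa>) * (\<Prod>q\<in>UNIV. ennreal (no_jump_prob offs D c m q) ^ \<kappa> q) \<partial>measure_pmf (offs p))"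
    by (simp add: offspring_transform_def Suc)
  also have "\<dots> = (\<integral>\<^sup>+\<kappa>. ennreal (measure D (family_below c \<kappa>) * (\<Prod>q\<in>UNIV. no_jump_prob offs D c m q ^ \<kappa> q)) \<partial>measure_pmf (offs p))"
    by (simp add: emeasure_eq_measure ennreal_mult' prod_ennreal[symmetric] ennreal_power no_jump_prob_nonneg)
  also have "\<dots> = ennreal (no_jump_prob offs D c (Suc m) p)"
    unfolding no_jump_prob.simps using bound
    by (intro nn_integral_eq_integral measure_pmf.integrable_const_bound[where B = 1])
      (auto simp: no_jump_prob_nonneg prod_nonneg)
  finally show ?case .
qed simp

end

locale branching_walk =
  fixes P :: "'a measure"
    and root_law :: "'q::finite pmf"
    and offs :: "'q \<Rightarrow> ('q \<Rightarrow> nat) pmf"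
    and D :: "('q \<Rightarrow> nat \<Rightarrow> real) measure"
    and T :: "'a \<Rightarrow> 'q"
    and K :: "'a \<Rightarrow> 'q vertex \<times> 'q \<Rightarrow> 'q \<Rightarrow> nat"
    and X :: "'a \<Rightarrow> 'q vertex \<Rightarrow> 'q \<Rightarrow> nat \<Rightarrow> real"
  assumes model: "branching_random_walk P root_law offs D T K X"
begin

sublocale prob_space P
  using model by (simp add: branching_random_walk_def)

sublocale D: prob_space D
  using model by (simp add: branching_random_walk_def)

lemma sets_D: "sets D = sets borel"
  using model by (simp add: branching_random_walk_def)

sublocale D: displacement_law D
proof
  show "space D = UNIV" using sets_eq_imp_space_eq[OF sets_D] by simp
  show "(\<lambda>y. y q i) \<in> borel_measurable D" for q i
  proof -
    have "continuous_on UNIV (\<lambda>y::'q \<Rightarrow> nat \<Rightarrow> real. y q i)"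
      by (rule continuous_on_compose2[OF continuous_on_product_coordinates[of i] continuous_on_product_coordinates[of q]]) simp
    then have "(\<lambda>y::'q \<Rightarrow> nat \<Rightarrow> real. y q i) \<in> borel_measurable borel"
      by (rule borel_measurable_continuous_onI)
    then show ?thesis by (simp cong: measurable_cong_sets add: sets_D)
  qed
qed

abbreviation type_count :: "'a \<Rightarrow> nat \<Rightarrow> 'q \<Rightarrow> nat" where
  "type_count \<omega> n q \<equiv> card {v \<in> generation (T \<omega>) (K \<omega>) n. vertex_type (T \<omega>) v = q}"

abbreviation no_jump_event :: "nat \<Rightarrow> nat \<Rightarrow> real \<Rightarrow> 'a set" where
  "no_jump_event m n c \<equiv> {\<omega> \<in> space P. no_jump (T \<omega>) (K \<omega>) (X \<omega>) m n c}"

abbreviation jump_event :: "nat \<Rightarrow> nat \<Rightarrow> real \<Rightarrow> 'a set" where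
  "jump_event m n c \<equiv> {\<omega> \<in> space P. \<not> no_jump (T \<omega>) (K \<omega>) (X \<omega>) m n c}"

abbreviation two_jumps_event :: "nat \<Rightarrow> real \<Rightarrow> 'a set" where
  "two_jumps_event n c \<equiv> {\<omega> \<in> space P. \<exists>v\<in>generation (T \<omega>) (K \<omega>) n. 2 \<le> large_steps c (X \<omega>) v}"

lemma measurable_brw_section:
  assumes "\<And>r. f r \<in> measurable (tree_measure offs D) N"
  shows "(\<lambda>w. f (fst w) (snd w)) \<in> measurable (brw_law root_law offs D) N"
proof -
  have 1: "fst \<in> measurable (brw_law root_law offs D) (count_space UNIV)"
    unfolding brw_law_def using measurable_fst by (simp cong: measurable_cong_sets)
  have 2: "snd \<in> measurable (brw_law root_law offs D) (tree_measure offs D)"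
    unfolding brw_law_def by (rule measurable_snd)
  show ?thesis
    by (rule measurable_compose_countable'[where f = "\<lambda>r w. f r (snd w)", OF measurable_compose[OF 2 assms] 1]) simp
qed

lemma measurable_model: "(\<lambda>\<omega>. (T \<omega>, K \<omega>, X \<omega>)) \<in> measurable P (brw_law root_law offs D)"
  and distr_model: "distr P (brw_law root_law offs D) (\<lambda>\<omega>. (T \<omega>, K \<omega>, X \<omega>)) = brw_law root_law offs D"
  using model by (simp_all add: branching_random_walk_def)

lemma measurable_model_compose:
  assumes "\<And>r. f r \<in> measurable (tree_measure offs D) N"
  shows "(\<lambda>\<omega>. f (T \<omega>) (K \<omega>, X \<omega>)) \<in> measurable P N"
  using measurable_compose[OF measurable_model measurable_brw_section[OF assms]] by simp

lemma pred_model_compose: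
  assumes "\<And>r. Measurable.pred (tree_measure offs D) (E r)"
  shows "{\<omega> \<in> space P. E (T \<omega>) (K \<omega>, X \<omega>)} \<in> sets P"
  using measurable_model_compose[of E, OF assms] by (simp add: pred_def)

lemma nn_integral_model:
  fixes f :: "'q \<Rightarrow> _ \<Rightarrow> ennreal"
  assumes f: "\<And>r. f r \<in> borel_measurable (tree_measure offs D)"
  shows "(\<integral>\<^sup>+\<omega>. f (T \<omega>) (K \<omega>, X \<omega>) \<partial>P) = (\<integral>\<^sup>+r. (\<integral>\<^sup>+z. f r z \<partial>tree_measure offs D) \<partial>measure_pmf root_law)"
proof -
  interpret A: prob_space "offspring_measure offs"
    by (intro prob_space_PiM prob_space_offspring)
  interpret B: prob_space "displacement_measure D"
    by (rule D.prob_space_displacement)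
  interpret Z: pair_prob_space "offspring_measure offs" "displacement_measure D" ..
  have "(\<integral>\<^sup>+\<omega>. f (T \<omega>) (K \<omega>, X \<omega>) \<partial>P)
    = (\<integral>\<^sup>+w. f (fst w) (snd w) \<partial>distr P (brw_law root_law offs D) (\<lambda>\<omega>. (T \<omega>, K \<omega>, X \<omega>)))"
    by (subst nn_integral_distr[OF measurable_model]) (simp_all add: measurable_brw_section[of f, OF f])
  also have "\<dots> = (\<integral>\<^sup>+w. f (fst w) (snd w) \<partial>brw_law root_law offs D)"
    by (simp only: distr_model)
  also have "\<dots> = (\<integral>\<^sup>+r. (\<integral>\<^sup>+z. f r z \<partial>tree_measure offs D) \<partial>measure_pmf root_law)"
    using measurable_brw_section[OF f] unfolding brw_law_def
    by (subst Z.nn_integral_fst[symmetric]) simp_all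
  finally show ?thesis .
qed

lemma emeasure_model:
  assumes E: "\<And>r. Measurable.pred (tree_measure offs D) (E r)"
  shows "emeasure P {\<omega> \<in> space P. E (T \<omega>) (K \<omega>, X \<omega>)}
    = (\<integral>\<^sup>+r. emeasure (tree_measure offs D) {z. E r z} \<partial>measure_pmf root_law)"
proof -
  have E': "{z. E r z} \<in> sets (tree_measure offs D)" for r
    using E[of r] by (simp add: pred_def D.space_tree)
  have "emeasure P {\<omega> \<in> space P. E (T \<omega>) (K \<omega>, X \<omega>)}
     = (\<integral>\<^sup>+\<omega>. indicator {\<omega> \<in> space P. E (T \<omega>) (K \<omega>, X \<omega>)} \<omega> \<partial>P)"
    using pred_model_compose[of E, OF E] by simp
  also have "\<dots> = (\<integral>\<^sup>+\<omega>. indicator {z. E (T \<omega>) z} (K \<omega>, X \<omega>) \<partial>P)"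
    by (intro nn_integral_cong) (auto split: split_indicator)
  also have "\<dots> = (\<integral>\<^sup>+r. (\<integral>\<^sup>+z. indicator {z. E r z} z \<partial>tree_measure offs D) \<partial>measure_pmf root_law)"
    using E' by (intro nn_integral_model) auto
  also have "\<dots> = (\<integral>\<^sup>+r. emeasure (tree_measure offs D) {z. E r z} \<partial>measure_pmf root_law)"
    using E' by simp
  finally show ?thesis .
qed

lemma emeasure_model_le:
  assumes E: "\<And>r. Measurable.pred (tree_measure offs D) (E r)"
    and le: "\<And>r. emeasure (tree_measure offs D) {z. E r z} \<le> C"
  shows "emeasure P {\<omega> \<in> space P. E (T \<omega>) (K \<omega>, X \<omega>)} \<le> C"
proof -
  have "emeasure P {\<omega> \<in> space P. E (T \<omega>) (K \<omega>, X \<omega>)} \<le> (\<integral>\<^sup>+r. C \<partial>measure_pmf root_law)"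
    unfolding emeasure_model[of E, OF E] by (intro nn_integral_mono le)
  then show ?thesis by (simp add: measure_pmf.emeasure_space_1)
qed

text \<open>The support condition holds almost surely at each pair of address and type, and there
  are only countably many such pairs.\<close>

lemma AE_offspring_ge_1: "AE \<omega> in P. \<forall>i q. 1 \<le> K \<omega> i q"
proof -
  have "AE \<omega> in P. 1 \<le> K \<omega> i q" for i q
  proof -
    obtain v p where i: "i = (v, p)" by (cases i)
    have ge: "\<forall>\<kappa>\<in>set_pmf (offs p). 1 \<le> \<kappa> q"
      using model by (simp add: branching_random_walk_def)
    let ?f = "\<lambda>r::'q. \<lambda>z. indicator {\<kappa>. \<not> 1 \<le> \<kappa> q} (fst z i) :: ennreal"
    have meas: "?f r \<in> borel_measurable (tree_measure offs D)" for r :: 'q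
      by (rule measurable_compose[OF measurable_compose[OF measurable_fst measurable_offspring]]) simp
    have "(\<integral>\<^sup>+z. ?f r z \<partial>tree_measure offs D) = 0" for r :: 'q
    proof -
      interpret B: prob_space "displacement_measure D" by (rule D.prob_space_displacement)
      have "(\<integral>\<^sup>+z. ?f r z \<partial>tree_measure offs D) = (\<integral>\<^sup>+k. 1 * indicator {\<kappa>. \<not> 1 \<le> \<kappa> q} (k i) \<partial>offspring_measure offs)"
        by (subst D.nn_integral_tree[OF meas]) (simp add: B.emeasure_space_1)
      also have "\<dots> = (\<integral>\<^sup>+k. 1 \<partial>offspring_measure offs) * (\<integral>\<^sup>+\<kappa>. indicator {\<kappa>. \<not> 1 \<le> \<kappa> q} \<kappa> \<partial>(case i of (v, p) \<Rightarrow> measure_pmf (offs p)))"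
        by (rule nn_integral_PiM_coordinate) (auto simp: prob_space_offspring i)
      also have "(\<integral>\<^sup>+\<kappa>. indicator {\<kappa>. \<not> 1 \<le> \<kappa> q} \<kappa> \<partial>(case i of (v, p) \<Rightarrow> measure_pmf (offs p))) = 0"
        unfolding i prod.case using ge
        by (subst nn_integral_cong_AE[where v = "\<lambda>_. 0"]) (auto simp: AE_measure_pmf_iff)
      finally show ?thesis by simp
    qed
    then have "(\<integral>\<^sup>+\<omega>. ?f (T \<omega>) (K \<omega>, X \<omega>) \<partial>P) = 0"
      by (subst nn_integral_model[of ?f, OF meas]) simp
    then have "AE \<omega> in P. ?f (T \<omega>) (K \<omega>, X \<omega>) = 0"
      using measurable_model_compose[of ?f, OF meas] by (subst (asm) nn_integral_0_iff_AE) auto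
    then show ?thesis by eventually_elim (auto split: split_indicator_asm)
  qed
  then show ?thesis by (simp add: AE_all_countable)
qed

lemma measurable_generation_count:
  "(\<lambda>\<omega>. type_count \<omega> n q) \<in> measurable P (count_space UNIV)"
proof -
  have "(\<lambda>z. card {v \<in> generation r (fst z) n. vertex_type r v = q}) \<in> measurable (tree_measure offs D) (count_space UNIV)" for r
    by (rule D.measurable_tree_generation_compose[where F = "\<lambda>A z. card {v \<in> A. vertex_type r v = q}"]) simp
  from measurable_model_compose[of "\<lambda>r z. card {v \<in> generation r (fst z) n. vertex_type r v = q}", OF this]
  show ?thesis by simp
qed

text \<open>The integral over trees is carried back to the space of the walk, so that the type
  counts are those of the given realisation, to which the limit involving \<open>W\<close>
  applies.\<close>

lemma prob_no_jump:
  "prob (no_jump_event J (J + m) c)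
    = (\<integral>\<omega>. (\<Prod>q\<in>UNIV. no_jump_prob offs D c m q ^ type_count \<omega> J q) \<partial>P)"
proof -
  let ?g = "\<lambda>r k. \<Prod>v\<in>generation r k J. ennreal (no_jump_prob offs D c m (vertex_type r v))"
  let ?h = "\<lambda>\<omega>. \<Prod>q\<in>UNIV. no_jump_prob offs D c m q ^ type_count \<omega> J q"
  interpret B: prob_space "displacement_measure D" by (rule D.prob_space_displacement)
  have g: "?g r \<in> borel_measurable (offspring_measure offs)" for r
    by (rule measurable_generation_prod)
  have g': "(\<lambda>z. ?g r (fst z)) \<in> borel_measurable (tree_measure offs D)" for r
    by (rule measurable_compose[OF measurable_fst g])
  have h_nonneg: "0 \<le> ?h \<omega>" for \<omega>
    by (intro prod_nonneg) (simp add: D.no_jump_prob_nonneg)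
  have h_le: "?h \<omega> \<le> 1" for \<omega>
    by (intro prod_le_1) (simp add: D.no_jump_prob_nonneg D.no_jump_prob_le_1 power_le_one)
  have h_meas: "?h \<in> borel_measurable P"
    by (intro borel_measurable_prod measurable_compose[OF measurable_generation_count]) simp
  have "emeasure P (no_jump_event J (J + m) c)
    = (\<integral>\<^sup>+r. emeasure (tree_measure offs D) {z. no_jump r (fst z) (snd z) J (J + m) c} \<partial>measure_pmf root_law)"
    using emeasure_model[of "\<lambda>r z. no_jump r (fst z) (snd z) J (J + m) c", OF D.pred_no_jump] by simp
  also have "\<dots> = (\<integral>\<^sup>+r. (\<integral>\<^sup>+z. ?g r (fst z) \<partial>tree_measure offs D) \<partial>measure_pmf root_law)"
    by (simp add: D.nn_integral_tree[OF g'] B.emeasure_space_1 D.emeasure_no_jump D.offspring_transform_no_jump_prob)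
  also have "\<dots> = (\<integral>\<^sup>+\<omega>. ?g (T \<omega>) (K \<omega>) \<partial>P)"
    using nn_integral_model[of "\<lambda>r z. ?g r (fst z)", OF g'] by simp
  also have "\<dots> = (\<integral>\<^sup>+\<omega>. ennreal (?h \<omega>) \<partial>P)"
    by (simp add: prod_generation_types[of "\<lambda>q. ennreal (no_jump_prob offs D c m q)"] ennreal_power
        D.no_jump_prob_nonneg prod_ennreal)
  also have "\<dots> = ennreal (\<integral>\<omega>. ?h \<omega> \<partial>P)"
    using h_nonneg h_le h_meas by (intro nn_integral_eq_integral integrable_const_bound[where B = 1]) auto
  finally show ?thesis
    using h_nonneg by (simp add: emeasure_eq_measure integral_nonneg_AE)
qed

end

text \<open>Here \<open>u\<close> is a right eigenvector of the mean matrix. Its positivity makes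
  the \<open>u\<close>-weight of a generation comparable to its size, with constants
  \<open>Min (range u)\<close> and \<open>Max (range u)\<close>.\<close>

locale branching_walk_harmonic = branching_walk +
  fixes \<rho> :: real and u :: "'b \<Rightarrow> real"
  assumes integrable_offspring: "\<And>p q. integrable (measure_pmf (offs p)) (\<lambda>k. real (k q))"
    and u_pos: "\<And>p. 0 < u p"
    and \<rho>_pos: "1 < \<rho>"
    and harmonic: "\<And>p. (\<Sum>q\<in>UNIV. mean_offspring offs p q * u q) = \<rho> * u p"
begin

lemma ennreal_harmonic:
  "(\<Sum>q\<in>UNIV. (\<integral>\<^sup>+\<kappa>. of_nat (\<kappa> q) \<partial>measure_pmf (offs p)) * ennreal (u q)) = ennreal \<rho> * ennreal (u p)"
proof -
  have "(\<integral>\<^sup>+\<kappa>. of_nat (\<kappa> q) \<partial>measure_pmf (offs p)) = ennreal (mean_offspring offs p q)" for q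
    using integrable_offspring[of p q]
    by (subst nn_integral_eq_integral[symmetric]) (auto simp: ennreal_of_nat_eq_real_of_nat)
  moreover have "0 \<le> mean_offspring offs p q * u q" for q
    using u_pos[of q] by (intro mult_nonneg_nonneg integral_nonneg_AE) auto
  ultimately show ?thesis
    using u_pos \<rho>_pos harmonic[of p]
    by (simp add: ennreal_mult'[symmetric] ennreal_mult''[symmetric] less_imp_le sum_ennreal)
qed

text \<open>As \<open>u q / Min (range u)\<close> is at least 1, harmonicity bounds the mean number
  of children of a type-\<open>p\<close> parent by \<open>\<rho> * u p / Min (range u)\<close>; the
  union bound over families then produces the geometric sum.\<close>

lemma prob_early_jump_le:
  assumes \<tau>: "0 \<le> \<tau>" "\<And>q i. measure D {y. c < \<bar>y q i\<bar>} \<le> \<tau>"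
  shows "prob (jump_event 0 n c)
    \<le> \<tau> * (\<rho> / Min (range u)) * (\<Sum>j<n. \<rho> ^ j) * Max (range u)"
proof -
  define u0 where "u0 = Min (range u)"
  define u1 where "u1 = Max (range u)"
  have u0: "0 < u0" "\<And>q. u0 \<le> u q" and u1: "\<And>q. u q \<le> u1" "0 < u1"
    using u_pos by (auto simp: u0_def u1_def Max_gr_iff)
  have bound: "measure D (- family_below c \<kappa>) \<le> (\<Sum>q\<in>UNIV. real (\<kappa> q) * \<tau>)" for \<kappa>
    unfolding D.Compl_family_below by (rule D.prob_family_above_le) (simp_all add: \<tau>(2))
  have B: "(\<integral>\<^sup>+\<kappa>. emeasure D (- family_below c \<kappa>) \<partial>measure_pmf (offs p)) \<le> ennreal (\<tau> * \<rho> / u0) * ennreal (u p)" for p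
  proof -
    have "(\<Sum>q\<in>UNIV. mean_offspring offs p q)
      \<le> (\<Sum>q\<in>UNIV. mean_offspring offs p q * (u q / u0))"
    proof (rule sum_mono)
      fix q
      have "mean_offspring offs p q * 1
        \<le> mean_offspring offs p q * (u q / u0)"
        using u0 by (intro mult_left_mono integral_nonneg_AE) auto
      then show "mean_offspring offs p q
        \<le> mean_offspring offs p q * (u q / u0)" by simp
    qed
    also have "\<dots> = \<rho> * u p / u0"
      using harmonic[of p] by (simp add: sum_divide_distrib[symmetric])
    finally have S: "(\<Sum>q\<in>UNIV. mean_offspring offs p q) \<le> \<rho> * u p / u0" .
    have "(\<integral>\<^sup>+\<kappa>. emeasure D (- family_below c \<kappa>) \<partial>measure_pmf (offs p))
       \<le> (\<integral>\<^sup>+\<kappa>. ennreal (\<Sum>q\<in>UNIV. real (\<kappa> q) * \<tau>) \<partial>measure_pmf (offs p))"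
      using bound by (intro nn_integral_mono) (simp add: D.emeasure_eq_measure ennreal_leI)
    also have "\<dots> = ennreal (measure_pmf.expectation (offs p) (\<lambda>\<kappa>. \<Sum>q\<in>UNIV. real (\<kappa> q) * \<tau>))"
      using integrable_offspring \<tau>(1) by (intro nn_integral_eq_integral) (auto intro!: sum_nonneg)
    also have "measure_pmf.expectation (offs p) (\<lambda>\<kappa>. \<Sum>q\<in>UNIV. real (\<kappa> q) * \<tau>)
      = \<tau> * (\<Sum>q\<in>UNIV. mean_offspring offs p q)"
      using integrable_offspring by (subst Bochner_Integration.integral_sum) (auto simp: sum_distrib_left mult.commute)
    also have "ennreal (\<tau> * (\<Sum>q\<in>UNIV. mean_offspring offs p q))
      \<le> ennreal (\<tau> * (\<rho> * u p / u0))"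
      by (intro ennreal_leI mult_left_mono S \<tau>(1))
    finally show ?thesis
      using \<tau>(1) u0(1) u_pos[of p] \<rho>_pos
      by (simp add: ennreal_mult'[symmetric] ennreal_mult''[symmetric] less_imp_le mult.assoc)
  qed
  have "emeasure P {\<omega> \<in> space P. \<not> no_jump (T \<omega>) (fst (K \<omega>, X \<omega>)) (snd (K \<omega>, X \<omega>)) 0 n c}
    \<le> ennreal (\<tau> * \<rho> / u0) * (\<Sum>j<n. ennreal \<rho> ^ j) * ennreal u1"
  proof (rule emeasure_model_le[of "\<lambda>r z. \<not> no_jump r (fst z) (snd z) 0 n c"])
    show "Measurable.pred (tree_measure offs D) (\<lambda>z. \<not> no_jump r (fst z) (snd z) 0 n c)" for r
      using D.pred_no_jump by (rule pred_intros_logic(2))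
    fix r
    have "emeasure (tree_measure offs D) {z. \<not> no_jump r (fst z) (snd z) 0 n c}
      \<le> ennreal (\<tau> * \<rho> / u0) * (\<Sum>j<n. ennreal \<rho> ^ j) * ennreal (u r)"
      by (rule D.emeasure_early_jump_le[OF ennreal_harmonic B])
    also have "\<dots> \<le> ennreal (\<tau> * \<rho> / u0) * (\<Sum>j<n. ennreal \<rho> ^ j) * ennreal u1"
      by (intro mult_left_mono ennreal_leI u1) simp
    finally show "emeasure (tree_measure offs D) {z. \<not> no_jump r (fst z) (snd z) 0 n c}
      \<le> ennreal (\<tau> * \<rho> / u0) * (\<Sum>j<n. ennreal \<rho> ^ j) * ennreal u1" .
  qed
  also have "\<dots> = ennreal (\<tau> * (\<rho> / u0) * (\<Sum>j<n. \<rho> ^ j) * u1)"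
    using \<tau>(1) u0(1) u1(2) \<rho>_pos
    by (simp add: ennreal_power sum_ennreal ennreal_mult'[symmetric] ennreal_mult''[symmetric] sum_nonneg)
  finally show ?thesis
    using \<tau>(1) u0(1) u1(2) \<rho>_pos
    by (simp add: emeasure_eq_measure u0_def[symmetric] u1_def[symmetric] sum_nonneg)
qed

lemma prob_two_large_steps_le:
  assumes s: "0 \<le> s" and \<tau>: "0 \<le> \<tau>" "\<And>q i. measure D {y. c < \<bar>y q i\<bar>} \<le> \<tau>"
  shows "prob (two_jumps_event n c)
    \<le> ((1 + s * \<tau>) * \<rho>) ^ n * Max (range u) / (Min (range u) * (1 + s)\<^sup>2)"
proof -
  define u0 where "u0 = Min (range u)"
  define u1 where "u1 = Max (range u)"
  have u0: "0 < u0" "\<And>q. u0 \<le> u q" and u1: "\<And>q. u q \<le> u1" "0 < u1"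
    using u_pos by (auto simp: u0_def u1_def Max_gr_iff)
  have pos: "0 < u0 * (1 + s)\<^sup>2" using u0 s by simp
  have "emeasure P {\<omega> \<in> space P. \<exists>v\<in>generation (T \<omega>) (fst (K \<omega>, X \<omega>)) n. 2 \<le> large_steps c (snd (K \<omega>, X \<omega>)) v}
    \<le> ennreal (((1 + s * \<tau>) * \<rho>) ^ n * u1 / (u0 * (1 + s)\<^sup>2))"
  proof (rule emeasure_model_le[of "\<lambda>r z. \<exists>v\<in>generation r (fst z) n. 2 \<le> large_steps c (snd z) v", OF D.pred_exists_large_steps])
    fix r
    let ?E = "emeasure (tree_measure offs D) {z. \<exists>v\<in>generation r (fst z) n. 2 \<le> large_steps c (snd z) v}"
    have "ennreal u0 * ennreal ((1 + s)\<^sup>2) * ?E \<le> (ennreal (1 + s * \<tau>) * ennreal \<rho>) ^ n * ennreal (u r)"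
      using \<tau> u0 s by (intro D.emeasure_two_large_steps_le[OF ennreal_harmonic])
        (auto simp: D.emeasure_eq_measure ennreal_leI)
    also have "\<dots> \<le> (ennreal (1 + s * \<tau>) * ennreal \<rho>) ^ n * ennreal u1"
      by (intro mult_left_mono ennreal_leI u1) simp
    also have "\<dots> = ennreal (((1 + s * \<tau>) * \<rho>) ^ n * u1)"
      using s \<tau>(1) \<rho>_pos u1(2) by (simp add: ennreal_power ennreal_mult'[symmetric] ennreal_mult''[symmetric] del: ennreal_plus)
    finally have le: "ennreal (u0 * (1 + s)\<^sup>2) * ?E \<le> ennreal (((1 + s * \<tau>) * \<rho>) ^ n * u1)"
      using u0(1) by (simp add: ennreal_mult'')
    have "?E = ennreal (1 / (u0 * (1 + s)\<^sup>2)) * (ennreal (u0 * (1 + s)\<^sup>2) * ?E)"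
    proof -
      have "ennreal (1 / a) * ennreal a = 1" if "0 < a" for a :: real
        using that by (simp add: ennreal_mult'[symmetric])
      from this[OF pos] show ?thesis by (simp only: mult.assoc[symmetric] mult_1)
    qed
    also have "\<dots> \<le> ennreal (1 / (u0 * (1 + s)\<^sup>2)) * ennreal (((1 + s * \<tau>) * \<rho>) ^ n * u1)"
      by (intro mult_left_mono le) simp
    also have "\<dots> = ennreal (((1 + s * \<tau>) * \<rho>) ^ n * u1 / (u0 * (1 + s)\<^sup>2))"
      using pos by (simp add: ennreal_mult'[symmetric])
    finally show "?E \<le> ennreal (((1 + s * \<tau>) * \<rho>) ^ n * u1 / (u0 * (1 + s)\<^sup>2))" .
  qed
  then show ?thesis
    using s \<tau>(1) \<rho>_pos u1(2) pos
    by (simp add: emeasure_eq_measure u0_def[symmetric] u1_def[symmetric] del: ennreal_plus)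
qed

end

section \<open>Regular variation of the displacements\<close>

text \<open>A sandwich with an approximation parameter: for fixed \<open>i\<close> the two bounds
  may have different limits, which close up only as \<open>i\<close> moves along \<open>F\<close>.
  It serves for limits taken first in \<open>n\<close> and then in a cut-off.\<close>

lemma tendsto_between:
  fixes a :: "nat \<Rightarrow> real"
  assumes L: "\<And>i. (L i \<longlongrightarrow> l i) sequentially" and U: "\<And>i. (U i \<longlongrightarrow> u i) sequentially"
    and le: "\<And>i. \<forall>\<^sub>F n in sequentially. L i n \<le> a n" "\<And>i. \<forall>\<^sub>F n in sequentially. a n \<le> U i n"
    and l: "(l \<longlongrightarrow> c) F" and u: "(u \<longlongrightarrow> c) F" and F: "F \<noteq> bot"
  shows "a \<longlonglongrightarrow> c"
proof (rule order_tendstoI)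
  fix y assume "y < c"
  then have "\<forall>\<^sub>F i in F. y < l i" by (rule order_tendstoD(1)[OF l])
  then obtain i where "y < l i" using eventually_happens'[OF F] by auto
  from order_tendstoD(1)[OF L this] le(1)[of i]
  show "\<forall>\<^sub>F n in sequentially. y < a n" by eventually_elim simp
next
  fix y assume "c < y"
  then have "\<forall>\<^sub>F i in F. u i < y" by (rule order_tendstoD(2)[OF u])
  then obtain i where "u i < y" using eventually_happens'[OF F] by auto
  from order_tendstoD(2)[OF U this] le(2)[of i]
  show "\<forall>\<^sub>F n in sequentially. a n < y" by eventually_elim simp
qed

definition exceed_set :: "nat \<Rightarrow> real \<Rightarrow> (nat \<Rightarrow> real) set" where
  "exceed_set g c = {y. \<exists>i<g. c < y i}"

lemma not_in_exceed_set: "y \<notin> exceed_set g c \<longleftrightarrow> (\<forall>i<g. y i \<le> c)"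
  unfolding exceed_set_def mem_Collect_eq by (blast intro: leI dest: leD)

lemma open_exceed_set: "open (exceed_set g c)"
proof -
  have "exceed_set g c = (\<Union>i<g. {y. c < y i})" by (auto simp: exceed_set_def)
  moreover have "open {y :: nat \<Rightarrow> real. c < y i}" for i
    by (intro open_Collect_less) (auto intro: continuous_on_product_coordinates)
  ultimately show ?thesis by auto
qed

lemma open_all_less: "open {y :: nat \<Rightarrow> real. \<forall>i\<in>{..<g}. y i < c}"
proof -
  have "{y :: nat \<Rightarrow> real. \<forall>i\<in>{..<g}. y i < c} = (\<Inter>i\<in>{..<g}. {y. y i < c})" by auto
  moreover have "open {y :: nat \<Rightarrow> real. y i < c}" for i
    by (intro open_Collect_less) (auto intro: continuous_on_product_coordinates)
  ultimately show ?thesis by (auto intro!: open_INT)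
qed

locale heavy_tails = displacement_law D for D :: "('q::finite \<Rightarrow> nat \<Rightarrow> real) measure" +
  fixes Q :: 'q and \<rho> \<alpha> \<beta> :: real and b :: "nat \<Rightarrow> real" and lam :: "(nat \<Rightarrow> real) measure"
  assumes \<rho>: "1 < \<rho>"
    and D1: "\<And>p i. distr D borel (\<lambda>y. y p i) = distr D borel (\<lambda>y. y p 0)"
    and \<alpha>: "0 < \<alpha>"
    and b_pos: "\<And>n. 1 \<le> n \<Longrightarrow> 0 < b n" and b_mono: "mono_on {1..} b"
    and \<beta>: "0 \<le> \<beta>" "\<beta> \<le> 1"
    and vague: "vague_conv_on (- {0 :: ereal})
                 (\<lambda>n. scale_measure (ennreal (\<rho> ^ n))
                        (distr D borel (\<lambda>y. ereal (inverse (b n) * y Q 0))))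
                 (distr (power_law_measure \<alpha> \<beta>) borel ereal)"
    and sets_lam: "sets lam = sets (restrict_space borel punctured)"
    and lam_scaling: "\<And>a A. 0 < a \<Longrightarrow> A \<in> sets lam \<Longrightarrow>
          emeasure lam ((\<lambda>y i. a * y i) ` A) = ennreal (a powr (-\<alpha>)) * emeasure lam A"
    and lam_finite: "\<And>A. A \<in> sets lam \<Longrightarrow> (\<lambda>_. 0) \<notin> closure A \<Longrightarrow> emeasure lam A < \<infinity>"
    and HL: "HL_conv
                 (\<lambda>n. scale_measure (ennreal (\<rho> ^ n))
                        (restrict_space (distr D borel (\<lambda>y i. inverse (b n) * y Q i)) punctured))
                 lam"
    and D3: "\<And>p. p \<noteq> Q \<Longrightarrow> \<exists>\<gamma>>0. \<exists>\<epsilon> \<in> borel_measurable borel.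
          (\<forall>t. 0 \<le> \<epsilon> t) \<and>
          (\<forall>s>0. ((\<lambda>t. \<epsilon> (t * s) / \<epsilon> t) \<longlongrightarrow> s powr (-\<gamma>)) at_top) \<and>
          (\<forall>s>0. measure D {y. s < \<bar>y p 0\<bar>} \<le> \<epsilon> s * measure D {y. s < \<bar>y Q 0\<bar>})"
begin

text \<open>As \<open>f\<close> vanishes near the origin, the point removed by
  \<open>punctured\<close> carries no integral, and HL convergence becomes a statement about
  expectations under \<open>D\<close>.\<close>

lemma nn_integral_HL:
  assumes f: "continuous_on UNIV f" and bound: "\<And>y. 0 \<le> f y" "\<And>y. f y \<le> 1"
    and U: "open U" "(\<lambda>_. 0) \<in> U" "\<And>y. y \<in> U \<Longrightarrow> f y = 0"
  shows "(\<lambda>n. ennreal (\<rho> ^ n) * (\<integral>\<^sup>+y. ennreal (f (\<lambda>i. inverse (b n) * y Q i)) \<partial>D)) \<longlonglongrightarrow> (\<integral>\<^sup>+y. ennreal (f y) \<partial>lam)"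
proof -
  have "bounded (range f)"
    using bound by (auto simp: bounded_iff intro!: exI[of _ 1])
  with f bound(1) U have
    "(\<lambda>n. \<integral>\<^sup>+y. ennreal (f y) \<partial>scale_measure (ennreal (\<rho> ^ n))
        (restrict_space (distr D borel (\<lambda>y i. inverse (b n) * y Q i)) punctured)) \<longlonglongrightarrow> (\<integral>\<^sup>+y. ennreal (f y) \<partial>lam)"
    by (intro HL[unfolded HL_conv_def, rule_format]) (auto intro: continuous_on_subset)
  moreover have "(\<integral>\<^sup>+y. ennreal (f y) \<partial>scale_measure (ennreal (\<rho> ^ n))
        (restrict_space (distr D borel (\<lambda>y i. inverse (b n) * y Q i)) punctured))
      = ennreal (\<rho> ^ n) * (\<integral>\<^sup>+y. ennreal (f (\<lambda>i. inverse (b n) * y Q i)) \<partial>D)" for n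
  proof -
    have [measurable]: "f \<in> borel_measurable borel" by (rule borel_measurable_continuous_onI[OF f])
    have g[measurable]: "(\<lambda>y i. inverse (b n) * y Q i) \<in> measurable D borel"
      by (rule measurable_coordinatewise_then_product) measurable
    have "punctured \<in> sets (borel :: (nat \<Rightarrow> real) measure)" by (intro borel_open open_Compl) simp
    then have "(\<integral>\<^sup>+y. ennreal (f y) \<partial>scale_measure (ennreal (\<rho> ^ n))
        (restrict_space (distr D borel (\<lambda>y i. inverse (b n) * y Q i)) punctured))
      = ennreal (\<rho> ^ n) * (\<integral>\<^sup>+y. ennreal (f y) * indicator punctured y \<partial>distr D borel (\<lambda>y i. inverse (b n) * y Q i))"
      by (subst nn_integral_scale_measure) (auto simp: nn_integral_restrict_space intro!: measurable_restrict_space1)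
    also have "(\<integral>\<^sup>+y. ennreal (f y) * indicator punctured y \<partial>distr D borel (\<lambda>y i. inverse (b n) * y Q i))
      = (\<integral>\<^sup>+y. ennreal (f y) \<partial>distr D borel (\<lambda>y i. inverse (b n) * y Q i))"
      using U by (intro nn_integral_cong) (auto split: split_indicator)
    also have "\<dots> = (\<integral>\<^sup>+y. ennreal (f (\<lambda>i. inverse (b n) * y Q i)) \<partial>D)"
      by (subst nn_integral_distr) auto
    finally show ?thesis .
  qed
  ultimately show ?thesis by simp
qed

lemma sets_lam_open: "open A \<Longrightarrow> (\<lambda>_. 0) \<notin> A \<Longrightarrow> A \<in> sets lam"
  unfolding sets_lam by (subst sets_restrict_space_iff) (auto intro!: borel_open open_Compl)

lemma exceed_set_lam: "0 \<le> c \<Longrightarrow> exceed_set g c \<in> sets lam"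
  by (rule sets_lam_open[OF open_exceed_set]) (auto simp: exceed_set_def)

lemma emeasure_exceed_finite: "0 < c \<Longrightarrow> emeasure lam (exceed_set g c) < \<infinity>"
proof (rule lam_finite[OF exceed_set_lam])
  assume "0 < c"
  have "{y :: nat \<Rightarrow> real. \<exists>i<g. c \<le> y i} = - {y. \<forall>i\<in>{..<g}. y i < c}"
    by (rule set_eqI) (simp, meson not_le lessThan_iff)
  then have cl: "closed {y :: nat \<Rightarrow> real. \<exists>i<g. c \<le> y i}"
    using open_all_less[of g c] by (simp add: closed_def)
  have "closure (exceed_set g c) \<subseteq> {y. \<exists>i<g. c \<le> y i}"
    by (rule closure_minimal[OF _ cl]) (auto simp: exceed_set_def intro: less_imp_le)
  then show "(\<lambda>_. 0) \<notin> closure (exceed_set g c)" using \<open>0 < c\<close> by auto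
qed simp

text \<open>This is the sum over patterns in \<open>kappa\<close> for family size \<open>g\<close>,
  as \<open>sum_H_set\<close> shows.\<close>

definition exceed_mass :: "nat \<Rightarrow> real" where
  "exceed_mass g = measure lam (exceed_set g 1)"

lemma measure_exceed:
  assumes "0 < c" shows "measure lam (exceed_set g c) = c powr (-\<alpha>) * exceed_mass g"
proof -
  have "(\<lambda>y i. c * y i) ` exceed_set g 1 = exceed_set g c"
  proof (intro set_eqI iffI)
    fix y assume "y \<in> exceed_set g c"
    then have "(\<lambda>i. y i / c) \<in> exceed_set g 1" using assms by (auto simp: exceed_set_def field_simps)
    then show "y \<in> (\<lambda>y i. c * y i) ` exceed_set g 1"
      using assms by (intro image_eqI[of _ _ "\<lambda>i. y i / c"]) auto
  qed (use assms in \<open>auto simp: exceed_set_def field_simps\<close>)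
  then have "emeasure lam (exceed_set g c) = ennreal (c powr (-\<alpha>)) * emeasure lam (exceed_set g 1)"
    using lam_scaling[OF assms exceed_set_lam[of 1 g]] by simp
  then show ?thesis by (simp add: measure_def exceed_mass_def enn2real_mult)
qed

text \<open>HL convergence tests only continuous functions, so the indicator is squeezed between
  ramps; their limits close up because scaling makes the mass of \<open>exceed_set g c\<close>
  continuous in \<open>c\<close>.\<close>

lemma tendsto_exceed:
  assumes c: "0 < c"
  shows "(\<lambda>n. \<rho> ^ n * prob {y. \<exists>i<g. b n * c < y Q i}) \<longlonglongrightarrow> c powr (-\<alpha>) * exceed_mass g"
proof -
  \<comment> \<open>For \<open>d > 0\<close> the ramp vanishes outside \<open>exceed_set g c\<close>
    and equals 1 on \<open>exceed_set g (c + d)\<close>; the cap at 1 keeps the sum of the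
    \<open>g\<close> terms bounded.\<close>
  define f where "f c d y = min 1 (\<Sum>i<g. max 0 ((y i - c) / d))" for c d :: real and y :: "nat \<Rightarrow> real"
  define I where "I c d n = enn2real (ennreal (\<rho> ^ n) * (\<integral>\<^sup>+y. ennreal (f c d (\<lambda>i. inverse (b n) * y Q i)) \<partial>D))" for c d n
  define J where "J c d = enn2real (\<integral>\<^sup>+y. ennreal (f c d y) \<partial>lam)" for c d
  let ?I = "\<lambda>c d n. \<integral>\<^sup>+y. ennreal (f c d (\<lambda>i. inverse (b n) * y Q i)) \<partial>D"
  let ?J = "\<lambda>c d. \<integral>\<^sup>+y. ennreal (f c d y) \<partial>lam"
  let ?S = "\<lambda>n c. {y. (\<lambda>i. inverse (b n) * y Q i) \<in> exceed_set g c}"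
  let ?E = "\<lambda>n. {y. \<exists>i<g. b n * c < y Q i}"
  have f_bound: "0 \<le> f c d y" "f c d y \<le> 1" for c d y
    by (auto simp: f_def intro!: sum_nonneg)
  have f_0: "f c d y = 0" if "0 < d" "y \<notin> exceed_set g c" for c d y
  proof -
    have "max 0 ((y i - c) / d) = 0" if i: "i < g" for i
    proof -
      have "y i - c \<le> 0" using \<open>y \<notin> _\<close> i by (simp add: not_in_exceed_set)
      with \<open>0 < d\<close> have "(y i - c) / d \<le> 0" by (intro divide_nonpos_pos)
      then show ?thesis by simp
    qed
    then have "(\<Sum>i<g. max 0 ((y i - c) / d)) = 0"
      by (intro sum.neutral) simp
    then show ?thesis by (simp add: f_def)
  qed
  have f_1: "f c d y = 1" if "0 < d" "y \<in> exceed_set g (c + d)" for c d y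
  proof -
    have "\<exists>i<g. c + d < y i" using that(2) by (simp add: exceed_set_def)
    then obtain i where i: "i < g" "c + d < y i" by blast
    then have "1 \<le> (y i - c) / d" using that(1) by (simp add: field_simps)
    then have "1 \<le> max 0 ((y i - c) / d)" by simp
    also have "\<dots> \<le> (\<Sum>i<g. max 0 ((y i - c) / d))"
      using i by (intro member_le_sum[where f = "\<lambda>i. max 0 ((y i - c) / d)"]) auto
    finally show ?thesis by (simp add: f_def)
  qed
  have cont: "continuous_on UNIV (f c d)" if "0 < d" for c d
    unfolding f_def using that by (intro continuous_intros continuous_on_product_coordinates) auto
  have J_le: "(?J c d) \<le> emeasure lam (exceed_set g c)" if "0 < c" "0 < d" for c d
  proof -
    have "(?J c d) \<le> (\<integral>\<^sup>+y. indicator (exceed_set g c) y \<partial>lam)"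
      using f_0[OF that(2), of _ c] f_bound by (intro nn_integral_mono) (auto split: split_indicator)
    then show ?thesis using exceed_set_lam[of c g] that by simp
  qed
  have J_ge: "emeasure lam (exceed_set g (c + d)) \<le> (?J c d)" if "0 < c" "0 < d" for c d
  proof -
    have "(\<integral>\<^sup>+y. indicator (exceed_set g (c + d)) y \<partial>lam) \<le> (?J c d)"
      using f_1[OF that(2), of _ c] by (intro nn_integral_mono) (auto split: split_indicator)
    then show ?thesis using exceed_set_lam[of "c + d" g] that by simp
  qed
  have J_fin: "(?J c d) < \<infinity>" if "0 < c" "0 < d" for c d
    using J_le[OF that] emeasure_exceed_finite[OF that(1), of g] by (rule le_less_trans)
  have J_upper: "J c d \<le> c powr (-\<alpha>) * exceed_mass g" if "0 < c" "0 < d" for c d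
    unfolding J_def measure_exceed[OF that(1), symmetric] measure_def
    using J_le[OF that] emeasure_exceed_finite[OF that(1), of g] by (intro enn2real_mono) auto
  have J_lower: "(c + d) powr (-\<alpha>) * exceed_mass g \<le> J c d" if "0 < c" "0 < d" for c d
    unfolding J_def measure_exceed[OF add_pos_pos[OF that], symmetric] measure_def
    using J_ge[OF that] J_fin[OF that] by (intro enn2real_mono) auto
  have lim: "I c d \<longlonglongrightarrow> J c d" if "0 < c" "0 < d" for c d
    unfolding I_def[abs_def] J_def
  proof (rule tendsto_enn2real)
    have z0: "f c d y = 0" if "y \<in> {y. \<forall>i\<in>{..<g}. y i < c}" for y
      using that \<open>0 < d\<close> by (intro f_0) (simp_all add: not_in_exceed_set less_imp_le)
    have "(\<lambda>n. ennreal (\<rho> ^ n) * (?I c d n)) \<longlonglongrightarrow> (?J c d)"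
      by (rule nn_integral_HL[OF cont[OF that(2)] f_bound open_all_less[of g c] _ z0]) (simp_all add: that)
    then show "(\<lambda>n. ennreal (\<rho> ^ n) * (?I c d n))
      \<longlonglongrightarrow> ennreal (enn2real (?J c d))"
      using J_fin[OF that] by simp
  qed simp
  have E: "?E n \<in> events" for n
    by (rule sets_Collect_D) measurable
  have meas_E: "?S n c \<in> events" for n c
    unfolding exceed_set_def mem_Collect_eq by (rule sets_Collect_D) measurable
  have E_eq: "?E n = ?S n c" if "1 \<le> n" for n
    using b_pos[OF that] by (auto simp: exceed_set_def field_simps)
  have I_le: "I c d n \<le> \<rho> ^ n * prob (?S n c)" if "0 < d" for c d n
  proof -
    have "(?I c d n) \<le> (\<integral>\<^sup>+y. indicator (?S n c) y \<partial>D)"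
      using f_0[OF that] f_bound by (intro nn_integral_mono) (auto split: split_indicator)
    also have "\<dots> = ennreal (prob (?S n c))"
      using meas_E by (simp add: emeasure_eq_measure)
    finally have "ennreal (\<rho> ^ n) * (?I c d n)
      \<le> ennreal (\<rho> ^ n * prob (?S n c))"
      using \<rho> by (simp add: ennreal_mult mult_left_mono)
    then show ?thesis unfolding I_def using \<rho> by (intro enn2real_leI) auto
  qed
  have I_ge: "\<rho> ^ n * prob (?S n (c + d)) \<le> I c d n" if "0 < d" for c d n
  proof -
    have "(?I c d n) \<le> (\<integral>\<^sup>+y. 1 \<partial>D)"
      using f_bound by (intro nn_integral_mono) auto
    also have "\<dots> < \<top>" by (simp add: emeasure_space_1)
    finally have fin: "ennreal (\<rho> ^ n) * (?I c d n) < \<top>"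
      by (simp add: ennreal_mult_less_top)
    have "ennreal (prob (?S n (c + d))) = (\<integral>\<^sup>+y. indicator (?S n (c + d)) y \<partial>D)"
      using meas_E by (simp add: emeasure_eq_measure)
    also have "\<dots> \<le> (?I c d n)"
      using f_1[OF that] by (intro nn_integral_mono) (auto split: split_indicator)
    finally have "ennreal (\<rho> ^ n * prob (?S n (c + d)))
      \<le> ennreal (\<rho> ^ n) * (?I c d n)"
      using \<rho> by (simp add: ennreal_mult mult_left_mono)
    from enn2real_mono[OF this] fin show ?thesis using \<rho> by (simp add: I_def)
  qed
  show ?thesis
  proof (rule tendsto_between)
    \<comment> \<open>Widths below \<open>c\<close> keep \<open>c - ?d i\<close> positive. The ramp
      that starts at \<open>c\<close> bounds from below, the one that starts at
      \<open>c - ?d i\<close> and reaches 1 at \<open>c\<close> from above.\<close>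
    let ?d = "\<lambda>i::nat. c / (2 + real i)"
    have d: "0 < ?d i" "?d i < c" for i
    proof -
      have "c * 1 < c * (2 + real i)" using c by (intro mult_strict_left_mono) auto
      then show "0 < ?d i" "?d i < c" using c by (simp_all add: divide_less_eq)
    qed
    show "I c (?d i) \<longlonglongrightarrow> J c (?d i)" "I (c - ?d i) (?d i) \<longlonglongrightarrow> J (c - ?d i) (?d i)" for i
      using d[of i] c by (auto intro!: lim)
    show "\<forall>\<^sub>F n in sequentially. I c (?d i) n \<le> \<rho> ^ n * prob (?E n)" for i
      using eventually_ge_at_top[of 1] by eventually_elim (use I_le[OF d(1)] E_eq in auto)
    show "\<forall>\<^sub>F n in sequentially. \<rho> ^ n * prob (?E n) \<le> I (c - ?d i) (?d i) n" for i
      using eventually_ge_at_top[of 1]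
    proof eventually_elim
      case (elim n)
      then show ?case using I_ge[OF d(1)[of i], of n "c - ?d i"] E_eq[OF elim] by simp
    qed
    have up: "J (c - ?d i) (?d i) \<le> (c - ?d i) powr (-\<alpha>) * exceed_mass g"
      and up': "J c (?d i) \<le> c powr (-\<alpha>) * exceed_mass g" for i
      using J_upper[of "c - ?d i" "?d i"] J_upper[of c "?d i"] d[of i] c by simp_all
    have low: "c powr (-\<alpha>) * exceed_mass g \<le> J (c - ?d i) (?d i)"
      and low': "(c + ?d i) powr (-\<alpha>) * exceed_mass g \<le> J c (?d i)" for i
      using J_lower[of "c - ?d i" "?d i"] J_lower[of c "?d i"] d[of i] c by simp_all
    have d0: "?d \<longlonglongrightarrow> 0" by real_asymp
    have "(\<lambda>i. (c - ?d i) powr (-\<alpha>) * exceed_mass g) \<longlonglongrightarrow> (c - 0) powr (-\<alpha>) * exceed_mass g"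
      using c by (intro tendsto_intros d0) auto
    then have u: "(\<lambda>i. (c - ?d i) powr (-\<alpha>) * exceed_mass g) \<longlonglongrightarrow> c powr (-\<alpha>) * exceed_mass g" by simp
    have "(\<lambda>i. (c + ?d i) powr (-\<alpha>) * exceed_mass g) \<longlonglongrightarrow> (c + 0) powr (-\<alpha>) * exceed_mass g"
      using c by (intro tendsto_intros d0) auto
    then have l: "(\<lambda>i. (c + ?d i) powr (-\<alpha>) * exceed_mass g) \<longlonglongrightarrow> c powr (-\<alpha>) * exceed_mass g" by simp
    show "(\<lambda>i. J c (?d i)) \<longlonglongrightarrow> c powr (-\<alpha>) * exceed_mass g"
      by (rule tendsto_sandwich[OF always_eventually[OF allI[OF low']] always_eventually[OF allI[OF up']] l tendsto_const])
    show "(\<lambda>i. J (c - ?d i) (?d i)) \<longlonglongrightarrow> c powr (-\<alpha>) * exceed_mass g"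
      by (rule tendsto_sandwich[OF always_eventually[OF allI[OF low]] always_eventually[OF allI[OF up]] tendsto_const u])
  qed simp
qed

end

text \<open>The density is positive on the right half-line if \<open>\<beta> > 0\<close> and on the
  left one if \<open>\<beta> = 0\<close>; a unit interval beyond \<open>c\<close> on that side
  already has positive mass.\<close>

lemma power_law_positive:
  fixes \<alpha> \<beta> c :: real
  assumes \<alpha>: "0 < \<alpha>" and \<beta>: "0 \<le> \<beta>" "\<beta> \<le> 1" and c: "0 < c"
  shows "0 < (\<integral>\<^sup>+t. ennreal (min 1 (max 0 (\<bar>t\<bar> - c))) \<partial>power_law_measure \<alpha> \<beta>)"
proof (rule ccontr)
  let ?dens = "\<lambda>x. \<beta> * \<alpha> * x powr (-\<alpha> - 1) * indicator {0<..} x + (1 - \<beta>) * \<alpha> * (-x) powr (-\<alpha> - 1) * indicator {..<0} x"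
  assume "\<not> ?thesis"
  then have "(\<integral>\<^sup>+t. ennreal (?dens t) * ennreal (min 1 (max 0 (\<bar>t\<bar> - c))) \<partial>lborel) = 0"
    by (simp add: power_law_measure_def nn_integral_density)
  then have ae: "AE t in lborel. ennreal (?dens t) * ennreal (min 1 (max 0 (\<bar>t\<bar> - c))) = 0"
    by (rule nn_integral_0_iff_AE[THEN iffD1, rotated]) measurable
  have False if I: "\<And>t. t \<in> {a<..<a + 1} \<Longrightarrow> 0 < ?dens t \<and> c < \<bar>t\<bar>" for a
  proof -
    have "AE t in lborel. t \<notin> {a<..<a + 1}"
      using ae
    proof eventually_elim
      case (elim t)
      then have "?dens t \<le> 0 \<or> min 1 (max 0 (\<bar>t\<bar> - c)) \<le> 0"
        by (simp only: mult_eq_0_iff ennreal_eq_0_iff)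
      then have "\<not> (0 < ?dens t \<and> c < \<bar>t\<bar>)" by linarith
      then show ?case using I[of t] by blast
    qed
    then have "{a<..<a + 1} \<in> null_sets lborel"
      by (subst AE_iff_null_sets) simp_all
    then have "emeasure lborel {a<..<a + 1} = 0" by (rule null_setsD1)
    then show False by simp
  qed
  note * = this
  show False
  proof (cases "0 < \<beta>")
    case True
    have "0 < ?dens t \<and> c < \<bar>t\<bar>" if "t \<in> {c<..<c + 1}" for t
    proof -
      have "0 < t" "c < t" using that c by auto
      then show ?thesis using True \<alpha> by (simp add: mult_pos_pos)
    qed
    then show False by (rule *)
  next
    case False
    then have "\<beta> = 0" using \<beta> by simp
    have "0 < ?dens t \<and> c < \<bar>t\<bar>" if "t \<in> {- c - 1<..<- c - 1 + 1}" for t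
    proof -
      have "t < 0" "c < - t" using that c by auto
      then show ?thesis using \<open>\<beta> = 0\<close> \<alpha> by (simp add: mult_pos_pos)
    qed
    then show False by (rule *)
  qed
qed

section \<open>Tails of a single displacement and growth of the normalising sequence\<close>

context heavy_tails
begin

definition tail :: "'q \<Rightarrow> real \<Rightarrow> real" where
  "tail q t = prob {y. t < \<bar>y q 0\<bar>}"

text \<open>Identical distribution within a type (D1) lets the first displacement stand for
  all.\<close>

lemma prob_abs_gt: "prob {y. t < \<bar>y q i\<bar>} = tail q t"
proof -
  have eq: "prob {y. t < \<bar>y q i\<bar>} = measure (distr D borel (\<lambda>y. y q i)) {x. t < \<bar>x\<bar>}" for i
    by (subst measure_distr) (auto simp: space_D vimage_def)
  show ?thesis unfolding tail_def eq D1[of q i] ..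
qed

lemma tail_mono: "s \<le> t \<Longrightarrow> tail q t \<le> tail q s"
  unfolding tail_def by (intro finite_measure_mono sets_abs_gt) auto

lemma tail_nonneg: "0 \<le> tail q t" by (simp add: tail_def)

text \<open>The test function is two-sided, so its limit integral is positive for every \<beta>. Its
  support is compact because both infinite points belong to the space.\<close>

lemma tail_lower:
  assumes c: "0 < c"
  shows "\<exists>C>0. \<forall>\<^sub>F n in sequentially. C \<le> \<rho> ^ n * tail Q (b n * c)"
proof -
  \<comment> \<open>Clamping to the interval from \<open>c\<close> to \<open>c + 1\<close> before
    applying \<open>real_of_ereal\<close> avoids the infinite points, where that function is not
    continuous.\<close>
  define f :: "ereal \<Rightarrow> real" where
    "f z = real_of_ereal (min (ereal (c + 1)) (max (ereal c) (max z (- z)))) - c" for z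
  let ?w = "\<lambda>z. min (ereal (c + 1)) (max (ereal c) (max z (- z)))"
  let ?I = "\<lambda>n. \<integral>\<^sup>+y. ennreal (min 1 (max 0 (\<bar>inverse (b n) * y Q 0\<bar> - c))) \<partial>D"
  let ?J = "\<integral>\<^sup>+t. ennreal (min 1 (max 0 (\<bar>t\<bar> - c))) \<partial>power_law_measure \<alpha> \<beta>"
  have f_ereal: "f (ereal t) = min 1 (max 0 (\<bar>t\<bar> - c))" for t
  proof -
    have 1: "max (ereal t) (- ereal t) = ereal \<bar>t\<bar>" by (simp add: max_def abs_if)
    have 2: "min (ereal x) (max (ereal y) (ereal z)) = ereal (min x (max y z))" for x y z
      by (simp add: min_def max_def)
    have "min (ereal (c + 1)) (max (ereal c) (max (ereal t) (- ereal t))) = ereal (min (c + 1) (max c \<bar>t\<bar>))"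
      by (subst 1, rule 2)
    then have "f (ereal t) = min (c + 1) (max c \<bar>t\<bar>) - c"
      by (simp only: f_def real_of_ereal.simps)
    then show ?thesis by (simp add: min_def max_def)
  qed
  have bounds: "ereal c \<le> ?w z" "?w z \<le> ereal (c + 1)" for z
    by auto
  have "w \<notin> {\<infinity>, -\<infinity>}" if "ereal c \<le> w" "w \<le> ereal (c + 1)" for w
    using that by auto
  from this[OF bounds] have fin: "?w z \<notin> {\<infinity>, -\<infinity>}" for z .
  have cont: "continuous_on UNIV f"
  proof -
    have "continuous_on UNIV (\<lambda>z::ereal. ?w z)"
      by (intro continuous_on_const continuous_on_min continuous_on_max continuous_on_id continuous_uminus_ereal)
    moreover have "range (\<lambda>z. ?w z) \<subseteq> UNIV - {\<infinity>, -\<infinity>}"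
      by (rule image_subsetI, rule DiffI[OF UNIV_I fin])
    ultimately have "continuous_on UNIV (\<lambda>z. real_of_ereal (?w z))"
      by (rule continuous_on_compose2[OF continuous_on_real])
    then show ?thesis
      unfolding f_def by (intro continuous_on_diff continuous_on_const)
  qed
  have nonneg: "0 \<le> f z" for z
    unfolding f_def using bounds[of z] fin[of z]
    by (cases "?w z") auto
  have f_0: "f z = 0" if "z \<notin> {z. ereal c \<le> max z (- z)}" for z
  proof -
    have "max (ereal c) (max z (- z)) = ereal c" using that by (intro max_absorb1) (simp add: not_le less_imp_le)
    then show ?thesis by (simp add: f_def)
  qed
  have comp: "compact {z. ereal c \<le> max z (- z)}"
    unfolding compact_eq_closed
    by (intro closed_Collect_le continuous_on_const continuous_on_max continuous_on_id continuous_uminus_ereal)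
  have "(\<lambda>n. \<integral>\<^sup>+x. ennreal (f x) \<partial>scale_measure (ennreal (\<rho> ^ n)) (distr D borel (\<lambda>y. ereal (inverse (b n) * y Q 0))))
     \<longlonglongrightarrow> (\<integral>\<^sup>+x. ennreal (f x) \<partial>distr (power_law_measure \<alpha> \<beta>) borel ereal)"
    using cont nonneg comp f_0 c
    by (intro vague[unfolded vague_conv_on_def, rule_format] conjI allI exI[of _ "{z. ereal c \<le> max z (- z)}"])
      (auto intro: continuous_on_subset)
  moreover have [measurable]: "f \<in> borel_measurable borel"
    by (rule borel_measurable_continuous_onI[OF cont])
  have "(\<integral>\<^sup>+x. ennreal (f x) \<partial>distr (power_law_measure \<alpha> \<beta>) borel ereal) = ?J"
    by (subst nn_integral_distr) (auto simp: power_law_measure_def f_ereal)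
  moreover have "(\<integral>\<^sup>+x. ennreal (f x) \<partial>scale_measure (ennreal (\<rho> ^ n)) (distr D borel (\<lambda>y. ereal (inverse (b n) * y Q 0))))
     = ennreal (\<rho> ^ n) * (?I n)" for n
    by (subst nn_integral_scale_measure) (auto simp: nn_integral_distr f_ereal)
  ultimately have lim: "(\<lambda>n. ennreal (\<rho> ^ n) * (?I n))
     \<longlonglongrightarrow> ?J"
    by simp
  obtain C where C: "0 < C" "C < ?J"
    using dense[OF power_law_positive[OF \<alpha> \<beta> c]] by auto
  have C_top: "C < \<top>" using C(2) top_greatest by (rule less_le_trans)
  then have fC: "C = ennreal (enn2real C)" by simp
  have "\<forall>\<^sub>F n in sequentially. enn2real C \<le> \<rho> ^ n * tail Q (b n * c)"
    using order_tendstoD(1)[OF lim C(2)] eventually_ge_at_top[of 1]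
  proof eventually_elim
    case (elim n)
    have "(?I n) \<le> (\<integral>\<^sup>+y. indicator {y. b n * c < \<bar>y Q 0\<bar>} y \<partial>D)"
      using b_pos[OF elim(2)] by (intro nn_integral_mono) (auto simp: abs_mult field_simps split: split_indicator)
    also have "\<dots> = ennreal (tail Q (b n * c))"
      by (simp add: sets_abs_gt emeasure_eq_measure tail_def)
    finally have "ennreal (\<rho> ^ n) * (?I n) \<le> ennreal (\<rho> ^ n * tail Q (b n * c))"
      using \<rho> by (simp add: ennreal_mult tail_nonneg mult_left_mono)
    with elim(1) have "ennreal (enn2real C) \<le> ennreal (\<rho> ^ n * tail Q (b n * c))"
      unfolding fC[symmetric] by (meson less_imp_le less_le_trans)
    then show ?case using \<rho> by (subst (asm) ennreal_le_iff) (auto simp: tail_nonneg)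
  qed
  moreover have "0 < enn2real C" using C(1) C_top by (simp add: enn2real_positive_iff)
  ultimately show ?thesis by blast
qed

text \<open>A ramp in the first entry, 0 below \<open>c / 2\<close> and 1 from \<open>c\<close> on,
  dominates the indicator; its \<open>lam\<close>-integral is finite because \<open>lam\<close> is
  finite away from the origin.\<close>

lemma tail_upper:
  assumes c: "0 < c"
  shows "\<exists>C>0. \<forall>\<^sub>F n in sequentially. \<rho> ^ n * tail Q (b n * c) \<le> C"
proof -
  define f :: "(nat \<Rightarrow> real) \<Rightarrow> real" where "f y = min 1 (max 0 (2 * \<bar>y 0\<bar> / c - 1))" for y
  let ?U = "{y :: nat \<Rightarrow> real. \<bar>y 0\<bar> < c / 2}"
  let ?I = "\<lambda>n. \<integral>\<^sup>+y. ennreal (f (\<lambda>i. inverse (b n) * y Q i)) \<partial>D"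
  have cont: "continuous_on UNIV f"
    unfolding f_def using c by (intro continuous_intros continuous_on_product_coordinates) auto
  have U: "open ?U"
    by (intro open_Collect_less continuous_intros continuous_on_product_coordinates)
  have f_U: "f y = 0" if "y \<in> ?U" for y
    using that c by (auto simp: f_def field_simps)
  have lim: "(\<lambda>n. ennreal (\<rho> ^ n) * (?I n)) \<longlonglongrightarrow> (\<integral>\<^sup>+y. ennreal (f y) \<partial>lam)"
    by (rule nn_integral_HL[OF cont _ _ U _ f_U]) (use c in \<open>auto simp: f_def\<close>)
  have A: "- ?U \<in> sets lam"
    unfolding sets_lam using U c by (subst sets_restrict_space_iff) (auto intro!: borel_open open_Compl)
  have "closure (- ?U) = - ?U" using U by (simp add: closed_def)
  then have fin: "emeasure lam (- ?U) < \<top>" using lam_finite[OF A] c by auto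
  have "(\<integral>\<^sup>+y. ennreal (f y) \<partial>lam) \<le> (\<integral>\<^sup>+y. indicator (- ?U) y \<partial>lam)"
    using f_U by (intro nn_integral_mono) (auto simp: f_def split: split_indicator)
  also have "\<dots> = emeasure lam (- ?U)" using A by simp
  finally have "(\<integral>\<^sup>+y. ennreal (f y) \<partial>lam) < \<top>" using fin by (rule le_less_trans)
  then obtain C where C: "(\<integral>\<^sup>+y. ennreal (f y) \<partial>lam) < C" "C < \<top>" using dense by blast
  have fC: "C = ennreal (enn2real C)" using C(2) by simp
  have "\<forall>\<^sub>F n in sequentially. \<rho> ^ n * tail Q (b n * c) \<le> enn2real C"
    using order_tendstoD(2)[OF lim C(1)] eventually_ge_at_top[of 1]
  proof eventually_elim
    case (elim n)
    have "ennreal (tail Q (b n * c)) = (\<integral>\<^sup>+y. indicator {y. b n * c < \<bar>y Q 0\<bar>} y \<partial>D)"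
      by (simp add: sets_abs_gt emeasure_eq_measure tail_def)
    also have "\<dots> \<le> (?I n)"
    proof (intro nn_integral_mono)
      fix y
      have "f (\<lambda>i. inverse (b n) * y Q i) = 1" if "b n * c < \<bar>y Q 0\<bar>"
      proof -
        have "c \<le> \<bar>inverse (b n) * y Q 0\<bar>" using that b_pos[OF elim(2)] by (simp add: abs_mult field_simps)
        moreover have "1 \<le> 2 * t / c - 1" if "c \<le> t" for t using that c by (simp add: field_simps)
        ultimately have "1 \<le> 2 * \<bar>inverse (b n) * y Q 0\<bar> / c - 1" by blast
        then show ?thesis by (simp add: f_def)
      qed
      then show "indicator {y. b n * c < \<bar>y Q 0\<bar>} y \<le> ennreal (f (\<lambda>i. inverse (b n) * y Q i))"
        by (auto split: split_indicator)
    qed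
    finally have "ennreal (\<rho> ^ n * tail Q (b n * c)) \<le> ennreal (\<rho> ^ n) * (?I n)"
      using \<rho> by (simp add: ennreal_mult tail_nonneg mult_left_mono)
    with elim(1) have "ennreal (\<rho> ^ n * tail Q (b n * c)) \<le> ennreal (enn2real C)"
      unfolding fC[symmetric] by (meson less_imp_le le_less_trans)
    then show ?case by (subst (asm) ennreal_le_iff) auto
  qed
  moreover have "0 < C" using zero_le C(1) by (rule le_less_trans)
  then have "0 < enn2real C" using C(2) by (simp add: enn2real_positive_iff)
  ultimately show ?thesis by blast
qed

text \<open>If \<open>b (n + j)\<close> were below \<open>2 * b n\<close>, the tail at
  \<open>2 * b n\<close>, at least of order \<open>\<rho> ^ (- n)\<close>, would be bounded by the
  tail at \<open>b (n + j)\<close>, at most of order \<open>\<rho> ^ (- n - j)\<close>. For large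
  \<open>j\<close> the constants forbid this.\<close>

lemma b_doubling: "\<exists>j\<ge>1. \<forall>\<^sub>F n in sequentially. 2 * b n \<le> b (n + j)"
proof -
  obtain c where c: "0 < c" "\<forall>\<^sub>F n in sequentially. c \<le> \<rho> ^ n * tail Q (b n * 2)"
    using tail_lower[of 2] by auto
  obtain C where C: "0 < C" "\<forall>\<^sub>F n in sequentially. \<rho> ^ n * tail Q (b n * 1) \<le> C"
    using tail_upper[of 1] by auto
  \<comment> \<open>The lag is chosen so that \<open>\<rho> ^ j\<close> beats the ratio of the two
    constants; using \<open>Suc j\<close> makes it positive.\<close>
  obtain j where j: "C / c < \<rho> ^ j" using real_arch_pow[OF \<rho>] by blast
  have "C / c < \<rho> ^ Suc j" using j \<rho> by (simp add: less_le_trans)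
  have "\<forall>\<^sub>F n in sequentially. 2 * b n \<le> b (n + Suc j)"
    using c(2) eventually_sequentially_seg[THEN iffD2, OF C(2), of "Suc j"]
  proof eventually_elim
    case (elim n)
    show ?case
    proof (rule ccontr)
      assume "\<not> 2 * b n \<le> b (n + Suc j)"
      then have "tail Q (b n * 2) \<le> tail Q (b (n + Suc j) * 1)" by (intro tail_mono) simp
      then have "\<rho> ^ n * tail Q (b n * 2) \<le> \<rho> ^ n * tail Q (b (n + Suc j) * 1)"
        using \<rho> by (intro mult_left_mono) auto
      with elim(1) have "c \<le> \<rho> ^ n * tail Q (b (n + Suc j) * 1)" by (rule order_trans)
      then have "c * \<rho> ^ Suc j \<le> \<rho> ^ n * tail Q (b (n + Suc j) * 1) * \<rho> ^ Suc j"
        using \<rho> by (intro mult_right_mono) auto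
      also have "\<dots> \<le> C" using elim(2) by (simp add: power_add mult_ac)
      finally show False using \<open>C / c < \<rho> ^ Suc j\<close> c(1) by (simp add: field_simps)
    qed
  qed
  then show ?thesis by (intro exI[of _ "Suc j"]) auto
qed

end

lemma ratio_limit_imp_tendsto_0:
  fixes e :: "nat \<Rightarrow> real"
  assumes nonneg: "\<And>k. 0 \<le> e k" and lim: "(\<lambda>k. e (Suc k) / e k) \<longlonglongrightarrow> l" and l: "0 < l" "l < 1"
  shows "e \<longlonglongrightarrow> 0"
proof -
  obtain c where c: "l < c" "c < 1" using dense l by blast
  from order_tendstoD[OF lim] c l
  have "\<forall>\<^sub>F k in sequentially. 0 < e (Suc k) / e k \<and> e (Suc k) / e k < c"
    by (simp add: eventually_conj)
  then obtain N where N: "\<And>k. k \<ge> N \<Longrightarrow> 0 < e (Suc k) / e k \<and> e (Suc k) / e k < c"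
    unfolding eventually_sequentially by blast
  have "norm (e (Suc k)) \<le> c * norm (e k)" if "k \<ge> N" for k
  proof -
    \<comment> \<open>Division by zero yields 0, so a positive ratio forces \<open>e k\<close> to be
      nonzero.\<close>
    have "0 < e k" using N[OF that] nonneg[of k] by (cases "e k = 0") auto
    then show ?thesis using N[OF that] nonneg[of "Suc k"] by (simp add: divide_less_eq)
  qed
  then have "summable e" by (rule summable_ratio_test[OF c(2)])
  then show ?thesis by (rule summable_LIMSEQ_zero)
qed

lemma ex_dyadic:
  fixes t :: real assumes "1 \<le> t" shows "\<exists>k::nat. 2 ^ k \<le> t \<and> t < 2 ^ Suc k"
proof -
  obtain m where m: "t < 2 ^ m" using real_arch_pow[of 2 t] by auto
  define k where "k = (LEAST m. t < 2 ^ m)"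
  have k: "t < 2 ^ k" unfolding k_def using m by (rule LeastI)
  then have "k \<noteq> 0" using assms by (cases k) auto
  then have "\<not> t < 2 ^ (k - 1)" unfolding k_def by (intro not_less_Least) simp
  then show ?thesis using k \<open>k \<noteq> 0\<close> by (intro exI[of _ "k - 1"]) (simp add: not_less)
qed

context heavy_tails
begin

lemma b_growth: "\<exists>j\<ge>1. \<exists>N\<ge>1. \<forall>n\<ge>N. \<forall>i. 2 ^ i * b n \<le> b (n + i * j)"
proof -
  obtain j N where j: "1 \<le> j" and N: "\<And>n. n \<ge> N \<Longrightarrow> 2 * b n \<le> b (n + j)"
    using b_doubling unfolding eventually_sequentially by blast
  have "2 ^ i * b n \<le> b (n + i * j)" if "n \<ge> max N 1" for n i
  proof (induction i)
    case (Suc i)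
    have "2 ^ Suc i * b n \<le> 2 * b (n + i * j)" using Suc by simp
    also have "\<dots> \<le> b (n + i * j + j)" using that by (intro N) simp
    finally show ?case by (simp add: algebra_simps)
  qed simp
  then show ?thesis using j by (intro exI[of _ j] conjI exI[of _ "max N 1"]) auto
qed

lemma b_le: "1 \<le> m \<Longrightarrow> m \<le> n \<Longrightarrow> b m \<le> b n"
  using b_mono by (auto simp: mono_on_def)

lemma b_at_top: "filterlim b at_top sequentially"
  unfolding filterlim_at_top
proof
  fix Z :: real
  obtain j N where j: "1 \<le> j" and N: "1 \<le> N" and g: "\<forall>n\<ge>N. \<forall>i. 2 ^ i * b n \<le> b (n + i * j)"
    using b_growth by blast
  obtain i where i: "Z / b N < 2 ^ i" using real_arch_pow[of 2 "Z / b N"] by auto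
  have "Z \<le> 2 ^ i * b N" using i b_pos[OF N] by (simp add: divide_less_eq less_imp_le)
  also have "\<dots> \<le> b (N + i * j)" using g by blast
  finally have Z: "Z \<le> b (N + i * j)" .
  show "\<forall>\<^sub>F n in sequentially. Z \<le> b n"
    using eventually_ge_at_top[of "N + i * j"]
    by eventually_elim (rule order_trans[OF Z b_le], use N in auto)
qed

text \<open>The last quarter of the indices contains about \<open>n / (4 * j)\<close> doublings of
  \<open>b\<close>, so \<open>b (n - n div 4) / b n\<close> decays exponentially and absorbs the
  factor \<open>n\<close>.\<close>

lemma b_ratio:
  assumes \<delta>: "0 < \<delta>"
  shows "\<forall>\<^sub>F n in sequentially. real n * b (n - n div 4) \<le> \<delta> * b n"
proof -
  obtain j N where j: "1 \<le> j" and N: "1 \<le> N" and g: "\<forall>n\<ge>N. \<forall>i. 2 ^ i * b n \<le> b (n + i * j)"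
    using b_growth by blast
  define L where "L = 4 * j"
  have L: "0 < real L" using j by (simp add: L_def)
  \<comment> \<open>Then \<open>x ^ n\<close> is 2 to the power \<open>- n / L\<close>. Passing to
    the integer part \<open>n div L\<close> costs at most a factor 2, which explains
    \<open>\<delta> / 2\<close> below.\<close>
  define x :: real where "x = 2 powr (- 1 / real L)"
  have x: "0 < x" "x < 1"
    unfolding x_def using L by (auto intro!: powr_less_one)
  have "(\<lambda>n. real n * x ^ n) \<longlonglongrightarrow> 0"
    using x powser_times_n_limit_0[of x] by simp
  then have "\<forall>\<^sub>F n in sequentially. real n * x ^ n < \<delta> / 2"
    by (rule order_tendstoD) (use \<delta> in simp)
  then show ?thesis
    using eventually_ge_at_top[of "2 * N"]
  proof eventually_elim
    case (elim n)
    define m where "m = n - n div 4"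
    define i where "i = n div L"
    have i: "i = (n div 4) div j" by (simp add: i_def L_def div_mult2_eq)
    have m: "N \<le> m" using elim(2) by (simp add: m_def)
    have "i * j \<le> n div 4" unfolding i by (rule div_times_less_eq_dividend)
    then have "m + i * j \<le> n" by (simp add: m_def)
    have "2 ^ i * b m \<le> b (m + i * j)" using g m by blast
    also have "\<dots> \<le> b n" using N m \<open>m + i * j \<le> n\<close> by (intro b_le) auto
    finally have 1: "2 ^ i * b m \<le> b n" .
    have bm: "0 < b m" using N m by (intro b_pos) simp
    have "real n < real L * (real i + 1)"
    proof -
      have "n < L * (i + 1)"
        using L by (simp add: i_def dividend_less_times_div)
      then have "real n < real (L * (i + 1))" by (rule of_nat_less_iff[THEN iffD2])
      then show ?thesis by (simp add: algebra_simps)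
    qed
    then have "real n / real L \<le> real i + 1" using L by (simp add: divide_le_eq mult.commute less_imp_le)
    then have "2 powr (real n / real L) \<le> 2 powr (real i + 1)" by (intro powr_mono) auto
    also have "\<dots> = 2 * 2 ^ i" by (simp add: powr_add powr_realpow)
    finally have "inverse (x ^ n) \<le> 2 * 2 ^ i"
      by (simp add: x_def powr_realpow[symmetric] powr_powr powr_minus[symmetric])
    then have 2: "1 \<le> 2 * 2 ^ i * x ^ n" using x by (simp add: field_simps)
    have "real n * b m \<le> real n * b m * (2 * 2 ^ i * x ^ n)"
      using mult_left_mono[OF 2, of "real n * b m"] bm by simp
    also have "\<dots> = 2 * (real n * x ^ n) * (2 ^ i * b m)" by (simp add: mult_ac)
    also have "\<dots> \<le> \<delta> * (2 ^ i * b m)"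
      using elim(1) bm by (intro mult_right_mono) auto
    also have "\<dots> \<le> \<delta> * b n" using 1 \<delta> by simp
    finally show ?case by (simp add: m_def)
  qed
qed

text \<open>Since tails are monotone, only the values \<open>\<epsilon> (2 ^ k)\<close> matter, and these tend to \<open>0\<close> geometrically. This
  replaces the uniform convergence theorem for regularly varying functions.\<close>

lemma tail_negligible:
  assumes p: "p \<noteq> Q" and c: "0 < c"
  shows "(\<lambda>n. \<rho> ^ n * tail p (b n * c)) \<longlonglongrightarrow> 0"
proof -
  obtain \<gamma> \<epsilon> where \<gamma>: "0 < \<gamma>" and *: "(\<forall>t. 0 \<le> \<epsilon> t) \<and>
      (\<forall>s>0. ((\<lambda>t. \<epsilon> (t * s) / \<epsilon> t) \<longlongrightarrow> s powr (-\<gamma>)) at_top) \<and>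
      (\<forall>s>0. tail p s \<le> \<epsilon> s * tail Q s)"
    using D3[OF p, folded tail_def] by blast
  have \<epsilon>_nonneg: "0 \<le> \<epsilon> t" for t using * by simp
  have \<epsilon>_lim: "((\<lambda>t. \<epsilon> (t * s) / \<epsilon> t) \<longlongrightarrow> s powr (-\<gamma>)) at_top" if "0 < s" for s
    using * that by simp
  have \<epsilon>: "tail p s \<le> \<epsilon> s * tail Q s" if "0 < s" for s
    using * that by simp
  define e where "e k = \<epsilon> (2 ^ k)" for k :: nat
  have "e \<longlonglongrightarrow> 0"
  proof (rule ratio_limit_imp_tendsto_0)
    have "filterlim (\<lambda>k::nat. (2::real) ^ k) at_top sequentially" by real_asymp
    from filterlim_compose[OF \<epsilon>_lim[of 2] this]
    show "(\<lambda>k. e (Suc k) / e k) \<longlonglongrightarrow> 2 powr (-\<gamma>)"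
      by (simp add: e_def mult.commute)
    show "2 powr (-\<gamma>) < 1" using \<gamma> by (intro powr_less_one) auto
  qed (auto simp: e_def \<epsilon>_nonneg)
  obtain C where C: "0 < C" "\<forall>\<^sub>F n in sequentially. \<rho> ^ n * tail Q (b n * (c / 2)) \<le> C"
    using tail_upper[of "c / 2"] c by auto
  show ?thesis
  proof (rule LIMSEQ_I)
    fix r :: real assume r: "0 < r"
    have "\<forall>\<^sub>F k in sequentially. e k < r / (2 * C)"
      using \<open>e \<longlonglongrightarrow> 0\<close> by (rule order_tendstoD) (use r C in simp)
    then obtain k0 where k0: "\<And>k. k \<ge> k0 \<Longrightarrow> e k < r / (2 * C)"
      unfolding eventually_sequentially by blast
    have "\<forall>\<^sub>F n in sequentially. 2 ^ k0 / c \<le> b n" using b_at_top by (simp add: filterlim_at_top)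
    with C(2) have "\<forall>\<^sub>F n in sequentially. norm (\<rho> ^ n * tail p (b n * c) - 0) < r"
    proof eventually_elim
      case (elim n)
      have ge: "2 ^ k0 \<le> b n * c" using elim(2) c by (simp add: divide_le_eq)
      then have "1 \<le> b n * c" using one_le_power[of "2::real" k0] by linarith
      \<comment> \<open>Rounding the argument down to a power of 2 at most halves it, so
        \<open>tail Q\<close> is taken at no less than \<open>b n * (c / 2)\<close>, where it is
        still of order \<open>\<rho> ^ (- n)\<close>.\<close>
      then obtain k where k: "2 ^ k \<le> b n * c" "b n * c < 2 ^ Suc k" using ex_dyadic by blast
      have "(2::real) ^ k0 < 2 ^ Suc k" using ge k(2) by linarith
      then have "k0 < Suc k" by (rule power_less_imp_less_exp[rotated]) simp
      then have ek: "e k < r / (2 * C)" using k0[of k] by simp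
      have "tail p (b n * c) \<le> tail p (2 ^ k)" using k by (intro tail_mono)
      also have "\<dots> \<le> e k * tail Q (2 ^ k)" unfolding e_def by (rule \<epsilon>) simp
      also have "\<dots> \<le> e k * tail Q (b n * (c / 2))"
        using k by (intro mult_left_mono tail_mono) (auto simp: e_def \<epsilon>_nonneg)
      finally have "\<rho> ^ n * tail p (b n * c) \<le> \<rho> ^ n * (e k * tail Q (b n * (c / 2)))"
        using \<rho> by (intro mult_left_mono) auto
      also have "\<dots> = e k * (\<rho> ^ n * tail Q (b n * (c / 2)))" by (simp add: mult_ac)
      also have "\<dots> \<le> e k * C" using elim(1) by (intro mult_left_mono) (auto simp: e_def \<epsilon>_nonneg)
      also have "\<dots> \<le> r / (2 * C) * C" using ek C by (intro mult_right_mono) auto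
      also have "\<dots> < r" using r C by simp
      finally show ?case using \<rho> by (simp add: tail_nonneg)
    qed
    then show "\<exists>no. \<forall>n\<ge>no. norm (\<rho> ^ n * tail p (b n * c) - 0) < r"
      unfolding eventually_sequentially .
  qed
qed

lemma tail_bound:
  assumes c: "0 < c"
  shows "\<exists>C>0. \<forall>\<^sub>F n in sequentially. \<forall>q. \<rho> ^ n * tail q (b n * c) \<le> C"
proof -
  obtain C where C: "0 < C" "\<forall>\<^sub>F n in sequentially. \<rho> ^ n * tail Q (b n * c) \<le> C"
    using tail_upper[OF c] by auto
  have "\<forall>\<^sub>F n in sequentially. \<rho> ^ n * tail q (b n * c) \<le> C" for q
  proof (cases "q = Q")
    case False
    have "\<forall>\<^sub>F n in sequentially. \<rho> ^ n * tail q (b n * c) < C"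
      using tail_negligible[OF False c] by (rule order_tendstoD) (rule C)
    then show ?thesis by eventually_elim simp
  qed (use C in simp)
  then have "\<forall>\<^sub>F n in sequentially. \<forall>q. \<rho> ^ n * tail q (b n * c) \<le> C"
    by (rule eventually_all_finite)
  with C(1) show ?thesis by blast
qed

end

section \<open>Scaled survival probabilities\<close>

lemma one_minus_prod_le:
  fixes x :: "'i \<Rightarrow> real"
  assumes "finite A" "\<And>i. i \<in> A \<Longrightarrow> 0 \<le> x i" "\<And>i. i \<in> A \<Longrightarrow> x i \<le> 1"
  shows "1 - (\<Prod>i\<in>A. x i) \<le> (\<Sum>i\<in>A. 1 - x i)"
  using assms
proof (induction A rule: finite_induct)
  case (insert i A)
  have "0 \<le> (1 - x i) * (1 - (\<Prod>i\<in>A. x i))"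
    using insert.prems by (intro mult_nonneg_nonneg) (auto intro!: prod_le_1)
  then show ?case using insert by (simp add: algebra_simps)
qed simp

lemma one_minus_power_le:
  fixes x :: real
  assumes "0 \<le> x" "x \<le> 1"
  shows "1 - x ^ k \<le> real k * (1 - x)"
  using one_minus_prod_le[of "{..<k}" "\<lambda>_. x"] assms by simp

text \<open>Failure rates add to first order: \<open>1 - x * y\<close> equals
  \<open>(1 - x) + x * (1 - y)\<close>, and \<open>x\<close> tends to 1.\<close>

lemma tendsto_scaled_mult:
  fixes s x y :: "nat \<Rightarrow> real"
  assumes x: "(\<lambda>n. s n * (1 - x n)) \<longlonglongrightarrow> c" and y: "(\<lambda>n. s n * (1 - y n)) \<longlonglongrightarrow> d" and x1: "x \<longlonglongrightarrow> 1"
  shows "(\<lambda>n. s n * (1 - x n * y n)) \<longlonglongrightarrow> c + d"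
proof -
  have "(\<lambda>n. s n * (1 - x n) + x n * (s n * (1 - y n))) \<longlonglongrightarrow> c + 1 * d"
    by (intro tendsto_intros x y x1)
  moreover have "s n * (1 - x n) + x n * (s n * (1 - y n)) = s n * (1 - x n * y n)" for n
    by (simp add: algebra_simps)
  ultimately show ?thesis by simp
qed

lemma tendsto_scaled_power:
  fixes s x :: "nat \<Rightarrow> real"
  assumes x: "(\<lambda>n. s n * (1 - x n)) \<longlonglongrightarrow> c" and x1: "x \<longlonglongrightarrow> 1"
  shows "(\<lambda>n. s n * (1 - x n ^ k)) \<longlonglongrightarrow> real k * c"
proof (induction k)
  case (Suc k)
  from tendsto_scaled_mult[OF x Suc x1] show ?case by (simp add: algebra_simps)
qed simp

lemma tendsto_scaled_prod:
  fixes s :: "nat \<Rightarrow> real" and x :: "'i \<Rightarrow> nat \<Rightarrow> real"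
  assumes A: "finite A" and x: "\<And>i. i \<in> A \<Longrightarrow> (\<lambda>n. s n * (1 - x i n)) \<longlonglongrightarrow> c i"
    and x1: "\<And>i. i \<in> A \<Longrightarrow> x i \<longlonglongrightarrow> 1"
  shows "(\<lambda>n. s n * (1 - (\<Prod>i\<in>A. x i n))) \<longlonglongrightarrow> (\<Sum>i\<in>A. c i)"
  using A x x1
proof (induction A rule: finite_induct)
  case (insert i A)
  have "(\<lambda>n. s n * (1 - x i n * (\<Prod>i\<in>A. x i n))) \<longlonglongrightarrow> c i + (\<Sum>i\<in>A. c i)"
    by (intro tendsto_scaled_mult insert.IH insert.prems) auto
  then show ?case using insert.hyps by simp
qed simp

lemma tendsto_one_if_scaled:
  fixes x :: "nat \<Rightarrow> real"
  assumes \<rho>: "1 < \<rho>" and x: "(\<lambda>n. \<rho> ^ n * (1 - x n)) \<longlonglongrightarrow> c"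
  shows "x \<longlonglongrightarrow> 1"
proof -
  have "(\<lambda>n. inverse \<rho> ^ n) \<longlonglongrightarrow> 0" using \<rho> by (intro LIMSEQ_power_zero) (simp add: inverse_less_1_iff)
  from tendsto_diff[OF tendsto_const[of 1] tendsto_mult[OF this x]]
  have "(\<lambda>n. 1 - inverse \<rho> ^ n * (\<rho> ^ n * (1 - x n))) \<longlonglongrightarrow> 1" by simp
  moreover have "1 - inverse \<rho> ^ n * (\<rho> ^ n * (1 - x n)) = x n" for n
  proof -
    have "inverse \<rho> ^ n * \<rho> ^ n = 1" using \<rho> by (simp add: power_mult_distrib[symmetric])
    then show ?thesis by (simp add: mult.assoc[symmetric])
  qed
  ultimately show ?thesis by simp
qed

text \<open>The classical limit of \<open>(1 - c / s) ^ (w * s)\<close> with perturbed base and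
  exponent, obtained from two-sided bounds on the logarithm near 1.\<close>

lemma tendsto_power_exp:
  fixes x :: "nat \<Rightarrow> real" and N :: "nat \<Rightarrow> nat"
  assumes \<rho>: "1 < \<rho>" and x: "(\<lambda>n. \<rho> ^ n * (1 - x n)) \<longlonglongrightarrow> c" and le: "\<And>n. x n \<le> 1"
    and N: "(\<lambda>n. real (N n) / \<rho> ^ n) \<longlonglongrightarrow> w"
  shows "(\<lambda>n. x n ^ N n) \<longlonglongrightarrow> exp (- (c * w))"
proof -
  have x1: "x \<longlonglongrightarrow> 1" by (rule tendsto_one_if_scaled[OF \<rho> x])
  have half: "\<forall>\<^sub>F n in sequentially. 1 / 2 < x n" using x1 by (rule order_tendstoD) simp
  have low: "(\<lambda>n. - (\<rho> ^ n * (1 - x n)) - 2 * ((\<rho> ^ n * (1 - x n)) * (1 - x n))) \<longlonglongrightarrow> - c - 2 * (c * (1 - 1))"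
    by (intro tendsto_intros x x1)
  have up: "(\<lambda>n. - (\<rho> ^ n * (1 - x n))) \<longlonglongrightarrow> - c"
    by (intro tendsto_intros x)
  have ln: "(\<lambda>n. \<rho> ^ n * ln (x n)) \<longlonglongrightarrow> - c"
  proof (rule tendsto_sandwich)
    show "\<forall>\<^sub>F n in sequentially. - (\<rho> ^ n * (1 - x n)) - 2 * ((\<rho> ^ n * (1 - x n)) * (1 - x n)) \<le> \<rho> ^ n * ln (x n)"
      using half
    proof eventually_elim
      case (elim n)
      have "- (1 - x n) - 2 * (1 - x n)\<^sup>2 \<le> ln (1 - (1 - x n))"
        using elim le[of n] by (intro ln_one_minus_pos_lower_bound) auto
      then have "\<rho> ^ n * (- (1 - x n) - 2 * (1 - x n)\<^sup>2) \<le> \<rho> ^ n * ln (x n)"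
        using \<rho> by (intro mult_left_mono) auto
      then show ?case by (simp add: algebra_simps power2_eq_square)
    qed
    show "\<forall>\<^sub>F n in sequentially. \<rho> ^ n * ln (x n) \<le> - (\<rho> ^ n * (1 - x n))"
      using half
    proof eventually_elim
      case (elim n)
      have "\<rho> ^ n * ln (x n) \<le> \<rho> ^ n * (x n - 1)"
        using elim \<rho> by (intro mult_left_mono ln_le_minus_one) auto
      then show ?case by (simp add: algebra_simps)
    qed
  qed (use low up in simp_all)
  have "(\<lambda>n. exp (real (N n) / \<rho> ^ n * (\<rho> ^ n * ln (x n)))) \<longlonglongrightarrow> exp (w * - c)"
    by (intro tendsto_intros N ln)
  moreover have "\<forall>\<^sub>F n in sequentially. exp (real (N n) / \<rho> ^ n * (\<rho> ^ n * ln (x n))) = x n ^ N n"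
    using half
  proof eventually_elim
    case (elim n)
    have "real (N n) / \<rho> ^ n * (\<rho> ^ n * ln (x n)) = real (N n) * ln (x n)" using \<rho> by simp
    also have "exp \<dots> = x n ^ N n" using elim by (simp add: exp_of_nat_mult)
    finally show ?case .
  qed
  ultimately have "(\<lambda>n. x n ^ N n) \<longlonglongrightarrow> exp (w * - c)" by (rule Lim_transform_eventually)
  then show ?thesis by (simp add: mult.commute)
qed

section \<open>First-order expansion of the no-jump probabilities\<close>

context heavy_tails
begin

lemma sets_family_above: "{y. \<exists>q\<in>S. \<exists>i<\<kappa> q. c < y q i} \<in> events"
proof -
  have "{y \<in> space D. \<exists>q\<in>S. \<exists>i\<in>{..<\<kappa> q}. c < y q i} \<in> events" by measurable
  moreover have "{y \<in> space D. \<exists>q\<in>S. \<exists>i\<in>{..<\<kappa> q}. c < y q i} = {y. \<exists>q\<in>S. \<exists>i<\<kappa> q. c < y q i}"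
    by (auto simp: space_D)
  ultimately show ?thesis by simp
qed

lemma one_minus_family_below: "1 - prob (family_below c \<kappa>) = prob {y. \<exists>q\<in>UNIV. \<exists>i<\<kappa> q. c < y q i}"
  using prob_compl[OF sets_family_below[of c \<kappa>]] Compl_family_below[of c \<kappa>]
  by (simp add: space_D Compl_eq_Diff_UNIV)

lemma one_minus_family_below_le: "1 - prob (family_below c \<kappa>) \<le> (\<Sum>q\<in>UNIV. real (\<kappa> q) * tail q c)"
  unfolding one_minus_family_below by (rule prob_family_above_le) (simp_all add: prob_abs_gt)

text \<open>Types other than \<open>Q\<close> are negligible on the scale \<open>\<rho> ^ n\<close>
  by (D3), so only the \<open>\<kappa> Q\<close> displacements of type \<open>Q\<close> survive. The
  offspring vector is fixed here; averaging over it needs a dominating function.\<close>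

lemma tendsto_family_below:
  assumes z: "0 < z"
  shows "(\<lambda>n. \<rho> ^ n * (1 - prob (family_below (b n * z) \<kappa>))) \<longlonglongrightarrow> z powr (-\<alpha>) * exceed_mass (\<kappa> Q)"
proof (rule tendsto_sandwich)
  let ?E = "\<lambda>n. prob {y. \<exists>i<\<kappa> Q. b n * z < y Q i}"
  have E: "{y. \<exists>i<\<kappa> Q. b n * z < y Q i} = {y. \<exists>q\<in>{Q}. \<exists>i<\<kappa> q. b n * z < y q i}" for n by auto
  show "\<forall>\<^sub>F n in sequentially. \<rho> ^ n * ?E n \<le> \<rho> ^ n * (1 - prob (family_below (b n * z) \<kappa>))"
    unfolding one_minus_family_below E using \<rho>
    by (intro always_eventually allI mult_left_mono finite_measure_mono sets_family_above) auto
  show "(\<lambda>n. \<rho> ^ n * ?E n) \<longlonglongrightarrow> z powr (-\<alpha>) * exceed_mass (\<kappa> Q)"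
    by (rule tendsto_exceed[OF z])
  show "\<forall>\<^sub>F n in sequentially. \<rho> ^ n * (1 - prob (family_below (b n * z) \<kappa>))
     \<le> \<rho> ^ n * ?E n + (\<Sum>q\<in>UNIV - {Q}. real (\<kappa> q) * (\<rho> ^ n * tail q (b n * z)))"
  proof (intro always_eventually allI)
    fix n
    let ?F = "{y. \<exists>q\<in>UNIV - {Q}. \<exists>i<\<kappa> q. b n * z < y q i}"
    have "1 - prob (family_below (b n * z) \<kappa>) \<le> prob ({y. \<exists>i<\<kappa> Q. b n * z < y Q i} \<union> ?F)"
      unfolding one_minus_family_below E by (intro finite_measure_mono sets.Un sets_family_above) auto
    also have "\<dots> \<le> ?E n + prob ?F"
      unfolding E by (intro measure_Un_le sets_family_above)
    also have "prob ?F \<le> (\<Sum>q\<in>UNIV - {Q}. real (\<kappa> q) * tail q (b n * z))"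
      by (rule prob_family_above_le) (simp_all add: prob_abs_gt)
    finally have "\<rho> ^ n * (1 - prob (family_below (b n * z) \<kappa>)) \<le> \<rho> ^ n * (?E n + (\<Sum>q\<in>UNIV - {Q}. real (\<kappa> q) * tail q (b n * z)))"
      using \<rho> by (intro mult_left_mono) auto
    also have "\<dots> = \<rho> ^ n * ?E n + (\<Sum>q\<in>UNIV - {Q}. real (\<kappa> q) * (\<rho> ^ n * tail q (b n * z)))"
      by (simp add: distrib_left sum_distrib_left mult_ac)
    finally show "\<rho> ^ n * (1 - prob (family_below (b n * z) \<kappa>))
      \<le> \<rho> ^ n * ?E n + (\<Sum>q\<in>UNIV - {Q}. real (\<kappa> q) * (\<rho> ^ n * tail q (b n * z)))" .
  qed
  have "(\<lambda>n. \<rho> ^ n * ?E n + (\<Sum>q\<in>UNIV - {Q}. real (\<kappa> q) * (\<rho> ^ n * tail q (b n * z))))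
    \<longlonglongrightarrow> z powr (-\<alpha>) * exceed_mass (\<kappa> Q) + (\<Sum>q\<in>UNIV - {Q}. real (\<kappa> q) * 0)"
    by (intro tendsto_add tendsto_exceed[OF z] tendsto_sum tendsto_mult tendsto_const tail_negligible z) auto
  then show "(\<lambda>n. \<rho> ^ n * ?E n + (\<Sum>q\<in>UNIV - {Q}. real (\<kappa> q) * (\<rho> ^ n * tail q (b n * z))))
    \<longlonglongrightarrow> z powr (-\<alpha>) * exceed_mass (\<kappa> Q)" by simp
qed

lemma exceed_mass_nonneg: "0 \<le> exceed_mass g" by (simp add: exceed_mass_def)

text \<open>Linear growth in \<open>g\<close>, inherited from a union bound before the limit, makes
  \<open>exceed_mass\<close> integrable under first moments of the offspring counts.\<close>

lemma exceed_mass_le: "\<exists>C. \<forall>g. exceed_mass g \<le> C * real g"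
proof -
  obtain C where C: "\<forall>\<^sub>F n in sequentially. \<rho> ^ n * tail Q (b n * 1) \<le> C"
    using tail_upper[of 1] by auto
  have "exceed_mass g \<le> C * real g" for g
  proof -
    have "(\<lambda>n. \<rho> ^ n * prob {y. \<exists>i<g. b n * 1 < y Q i}) \<longlonglongrightarrow> exceed_mass g"
      using tendsto_exceed[of 1 g] by simp
    moreover have "\<forall>\<^sub>F n in sequentially. \<rho> ^ n * prob {y. \<exists>i<g. b n * 1 < y Q i} \<le> C * real g"
      using C
    proof eventually_elim
      case (elim n)
      have "prob {y. \<exists>q\<in>{Q}. \<exists>i<g. b n * 1 < y q i} \<le> (\<Sum>q\<in>{Q}. real g * tail q (b n * 1))"
        using prob_family_above_le[of "b n * 1" "\<lambda>q. tail q (b n * 1)" "{Q}" "\<lambda>_. g"] by (simp add: prob_abs_gt)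
      then have "\<rho> ^ n * prob {y. \<exists>i<g. b n * 1 < y Q i} \<le> \<rho> ^ n * (real g * tail Q (b n * 1))"
        using \<rho> by (intro mult_left_mono) auto
      also have "\<dots> = real g * (\<rho> ^ n * tail Q (b n * 1))" by (simp add: mult_ac)
      also have "\<dots> \<le> real g * C" using elim by (intro mult_left_mono) auto
      finally show ?case by (simp add: mult.commute)
    qed
    ultimately show ?thesis by (intro tendsto_upperbound) auto
  qed
  then show ?thesis by blast
qed

text \<open>The recursion for \<open>no_jump_prob\<close> linearised at 1: the root family
  contributes a mean of \<open>exceed_mass\<close>, and its members contribute their own rates
  through the mean matrix.\<close>

primrec jump_rate :: "('q \<Rightarrow> ('q \<Rightarrow> nat) pmf) \<Rightarrow> real \<Rightarrow> nat \<Rightarrow> 'q \<Rightarrow> real" where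
  "jump_rate offs z 0 p = 0"
| "jump_rate offs z (Suc r) p = z powr (-\<alpha>) * measure_pmf.expectation (offs p) (\<lambda>\<kappa>. exceed_mass (\<kappa> Q))
     + (\<Sum>q\<in>UNIV. mean_offspring offs p q * jump_rate offs z r q)"

lemma integrable_exceed_mass:
  assumes offs: "\<And>p q. integrable (measure_pmf (offs p)) (\<lambda>k. real (k q))"
  shows "integrable (measure_pmf (offs p)) (\<lambda>\<kappa>. exceed_mass (\<kappa> Q))"
proof -
  obtain C where C: "\<And>g. exceed_mass g \<le> C * real g" using exceed_mass_le by blast
  show ?thesis
  proof (rule Bochner_Integration.integrable_bound)
    show "integrable (measure_pmf (offs p)) (\<lambda>\<kappa>. C * real (\<kappa> Q))" using offs by simp
    show "AE \<kappa> in measure_pmf (offs p). norm (exceed_mass (\<kappa> Q)) \<le> norm (C * real (\<kappa> Q))"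
      using C by (intro AE_I2) (auto simp: exceed_mass_nonneg intro: order_trans[OF _ abs_ge_self])
  qed simp
qed

text \<open>The recursion is expanded for each fixed offspring vector; dominated convergence passes
  to the mean, since the scaled failure probability is at most linear in the offspring
  counts.\<close>

lemma tendsto_no_jump_prob:
  assumes offs: "\<And>p q. integrable (measure_pmf (offs p)) (\<lambda>k. real (k q))" and z: "0 < z"
  shows "(\<lambda>n. \<rho> ^ n * (1 - no_jump_prob offs D (b n * z) r p)) \<longlonglongrightarrow> jump_rate offs z r p"
proof (induction r arbitrary: p)
  case (Suc r)
  let ?f = "\<lambda>n q. no_jump_prob offs D (b n * z) r q"
  let ?a = "\<lambda>n \<kappa>. prob (family_below (b n * z) \<kappa>)"
  let ?g = "\<lambda>n \<kappa>. ?a n \<kappa> * (\<Prod>q\<in>UNIV. ?f n q ^ \<kappa> q)"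
  let ?lim = "\<lambda>\<kappa>. z powr (-\<alpha>) * exceed_mass (\<kappa> Q) + (\<Sum>q\<in>UNIV. real (\<kappa> q) * jump_rate offs z r q)"
  have f1: "(\<lambda>n. ?f n q) \<longlonglongrightarrow> 1" for q by (rule tendsto_one_if_scaled[OF \<rho> Suc])
  have lim: "(\<lambda>n. \<rho> ^ n * (1 - ?g n \<kappa>)) \<longlonglongrightarrow> ?lim \<kappa>" for \<kappa>
  proof (rule tendsto_scaled_mult[OF tendsto_family_below[OF z]])
    show "(\<lambda>n. \<rho> ^ n * (1 - (\<Prod>q\<in>UNIV. ?f n q ^ \<kappa> q))) \<longlonglongrightarrow> (\<Sum>q\<in>UNIV. real (\<kappa> q) * jump_rate offs z r q)"
      by (rule tendsto_scaled_prod)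
        (auto intro!: tendsto_scaled_power Suc f1 tendsto_eq_intros)
    show "(\<lambda>n. ?a n \<kappa>) \<longlonglongrightarrow> 1"
      by (rule tendsto_one_if_scaled[OF \<rho> tendsto_family_below[OF z]])
  qed
  obtain C where C: "0 < C" "\<forall>\<^sub>F n in sequentially. \<forall>q. \<rho> ^ n * tail q (b n * z) \<le> C"
    using tail_bound[OF z] by blast
  have "\<forall>\<^sub>F n in sequentially. \<rho> ^ n * (1 - ?f n q) \<le> jump_rate offs z r q + 1" for q
    using order_tendstoD(2)[OF Suc[of q], of "jump_rate offs z r q + 1"] by (auto elim: eventually_mono)
  then have "\<forall>\<^sub>F n in sequentially. \<forall>q. \<rho> ^ n * (1 - ?f n q) \<le> jump_rate offs z r q + 1"
    by (rule eventually_all_finite)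
  with C(2) have "\<forall>\<^sub>F n in sequentially. \<forall>q. \<rho> ^ n * tail q (b n * z) \<le> C \<and> \<rho> ^ n * (1 - ?f n q) \<le> jump_rate offs z r q + 1"
    by eventually_elim simp
  then obtain N where N: "\<And>n q. n \<ge> N \<Longrightarrow> \<rho> ^ n * tail q (b n * z) \<le> C \<and> \<rho> ^ n * (1 - ?f n q) \<le> jump_rate offs z r q + 1"
    unfolding eventually_sequentially by blast
  have g01: "0 \<le> ?g n \<kappa>" "?g n \<kappa> \<le> 1" for n \<kappa>
  proof -
    show "0 \<le> ?g n \<kappa>" by (intro mult_nonneg_nonneg prod_nonneg) (auto simp: no_jump_prob_nonneg)
    have "?g n \<kappa> \<le> 1 * 1"
      by (intro mult_mono prod_le_1 prod_nonneg) (auto simp: no_jump_prob_nonneg no_jump_prob_le_1 power_le_one)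
    then show "?g n \<kappa> \<le> 1" by simp
  qed
  have bound: "norm (\<rho> ^ n * (1 - ?g n \<kappa>)) \<le> (\<Sum>q\<in>UNIV. real (\<kappa> q) * (C + (jump_rate offs z r q + 1)))" if "n \<ge> N" for n \<kappa>
  proof -
    let ?pi = "\<Prod>q\<in>UNIV. ?f n q ^ \<kappa> q"
    have pi: "0 \<le> ?pi" "?pi \<le> 1"
      by (auto intro!: prod_nonneg prod_le_1 simp: no_jump_prob_nonneg no_jump_prob_le_1 power_le_one)
    \<comment> \<open>The failure of a product is at most the sum of the failures of its two
      factors.\<close>
    have "0 \<le> (1 - ?a n \<kappa>) * (1 - ?pi)" using pi by (intro mult_nonneg_nonneg) auto
    then have "1 - ?g n \<kappa> \<le> (1 - ?a n \<kappa>) + (1 - ?pi)" by (simp add: algebra_simps)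
    also have "1 - ?pi \<le> (\<Sum>q\<in>UNIV. 1 - ?f n q ^ \<kappa> q)"
      by (rule one_minus_prod_le) (auto simp: no_jump_prob_nonneg no_jump_prob_le_1 power_le_one)
    also have "\<dots> \<le> (\<Sum>q\<in>UNIV. real (\<kappa> q) * (1 - ?f n q))"
      by (intro sum_mono one_minus_power_le no_jump_prob_nonneg no_jump_prob_le_1)
    also have "1 - ?a n \<kappa> \<le> (\<Sum>q\<in>UNIV. real (\<kappa> q) * tail q (b n * z))"
      by (rule one_minus_family_below_le)
    finally have "1 - ?g n \<kappa> \<le> (\<Sum>q\<in>UNIV. real (\<kappa> q) * (tail q (b n * z) + (1 - ?f n q)))"
      by (simp add: sum.distrib distrib_left)
    then have "\<rho> ^ n * (1 - ?g n \<kappa>) \<le> \<rho> ^ n * (\<Sum>q\<in>UNIV. real (\<kappa> q) * (tail q (b n * z) + (1 - ?f n q)))"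
      using \<rho> by (intro mult_left_mono) auto
    also have "\<dots> = (\<Sum>q\<in>UNIV. real (\<kappa> q) * (\<rho> ^ n * tail q (b n * z) + \<rho> ^ n * (1 - ?f n q)))"
      unfolding sum_distrib_left by (intro sum.cong refl) (simp add: algebra_simps)
    also have "\<dots> \<le> (\<Sum>q\<in>UNIV. real (\<kappa> q) * (C + (jump_rate offs z r q + 1)))"
      using N[OF that] by (intro sum_mono mult_left_mono add_mono) auto
    finally show ?thesis using g01[of n \<kappa>] \<rho> by simp
  qed
  have int_g: "integrable (measure_pmf (offs p)) (?g n)" for n
    using g01 by (intro measure_pmf.integrable_const_bound[where B = 1]) auto
  \<comment> \<open>The shift by \<open>N\<close> makes the dominating bound valid at every
    index.\<close>
  have "(\<lambda>n. measure_pmf.expectation (offs p) (\<lambda>\<kappa>. \<rho> ^ (n + N) * (1 - ?g (n + N) \<kappa>))) \<longlonglongrightarrow> measure_pmf.expectation (offs p) ?lim"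
  proof (rule integral_dominated_convergence)
    show "integrable (measure_pmf (offs p)) (\<lambda>\<kappa>. \<Sum>q\<in>UNIV. real (\<kappa> q) * (C + (jump_rate offs z r q + 1)))"
      using offs by (intro Bochner_Integration.integrable_sum integrable_mult_left) auto
    show "AE \<kappa> in measure_pmf (offs p). (\<lambda>n. \<rho> ^ (n + N) * (1 - ?g (n + N) \<kappa>)) \<longlonglongrightarrow> ?lim \<kappa>"
      by (intro AE_I2 LIMSEQ_ignore_initial_segment lim)
    show "AE \<kappa> in measure_pmf (offs p). norm (\<rho> ^ (n + N) * (1 - ?g (n + N) \<kappa>))
       \<le> (\<Sum>q\<in>UNIV. real (\<kappa> q) * (C + (jump_rate offs z r q + 1)))" for n
      by (intro AE_I2 bound) simp
  qed simp_all
  then have "(\<lambda>n. measure_pmf.expectation (offs p) (\<lambda>\<kappa>. \<rho> ^ n * (1 - ?g n \<kappa>))) \<longlonglongrightarrow> measure_pmf.expectation (offs p) ?lim"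
    by (rule LIMSEQ_offset)
  moreover have "measure_pmf.expectation (offs p) (\<lambda>\<kappa>. \<rho> ^ n * (1 - ?g n \<kappa>)) = \<rho> ^ n * (1 - no_jump_prob offs D (b n * z) (Suc r) p)" for n
    using int_g[of n] by simp
  moreover have "measure_pmf.expectation (offs p) ?lim = jump_rate offs z (Suc r) p"
  proof -
    have int1: "integrable (measure_pmf (offs p)) (\<lambda>\<kappa>. z powr (-\<alpha>) * exceed_mass (\<kappa> Q))"
      by (intro integrable_mult_right integrable_exceed_mass offs)
    have int2: "integrable (measure_pmf (offs p)) (\<lambda>\<kappa>. real (\<kappa> q) * jump_rate offs z r q)" for q
      by (intro integrable_mult_left offs)
    have "measure_pmf.expectation (offs p) ?lim = measure_pmf.expectation (offs p) (\<lambda>\<kappa>. z powr (-\<alpha>) * exceed_mass (\<kappa> Q))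
       + measure_pmf.expectation (offs p) (\<lambda>\<kappa>. \<Sum>q\<in>UNIV. real (\<kappa> q) * jump_rate offs z r q)"
      by (intro Bochner_Integration.integral_add int1 Bochner_Integration.integrable_sum int2)
    also have "measure_pmf.expectation (offs p) (\<lambda>\<kappa>. \<Sum>q\<in>UNIV. real (\<kappa> q) * jump_rate offs z r q)
       = (\<Sum>q\<in>UNIV. measure_pmf.expectation (offs p) (\<lambda>\<kappa>. real (\<kappa> q) * jump_rate offs z r q))"
      by (intro Bochner_Integration.integral_sum int2)
    finally show ?thesis by simp
  qed
  ultimately show ?case by (simp only:)
qed simp

end

section \<open>Convergence of the rightmost position\<close>

lemma no_jump_split:
  "m \<le> n \<Longrightarrow> no_jump r k x 0 n c \<longleftrightarrow> no_jump r k x 0 m c \<and> no_jump r k x m n c"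
  unfolding no_jump_def by (subst ivl_disj_un_two(3)[of 0 m n, symmetric]) (auto simp: ball_Un)

locale heavy_tailed_walk =
  branching_walk_harmonic P root_law offs D T K X \<rho> u +
  tails: heavy_tails D Q \<rho> \<alpha> \<beta> b lam
  for P :: "'a measure" and root_law :: "'q::finite pmf" and offs D T K X \<rho> u Q \<alpha> \<beta> b lam +
  fixes \<sigma> :: "'q \<Rightarrow> real" and W :: "'a \<Rightarrow> real"
  assumes left_eigenvector:
      "\<And>q. (\<Sum>p\<in>UNIV. \<sigma> p * mean_offspring offs p q) = \<rho> * \<sigma> q"
    and \<sigma>_nonneg: "\<And>q. 0 \<le> \<sigma> q"
    and W_measurable[measurable]: "W \<in> borel_measurable P"
    and W_pos: "AE \<omega> in P. 0 < W \<omega>"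
    and W_limit: "AE \<omega> in P. \<forall>q. (\<lambda>n. real (type_count \<omega> n q) / \<rho> ^ n)
                    \<longlonglongrightarrow> W \<omega> * \<sigma> q"
begin

text \<open>This is the mean of \<open>exceed_mass G\<close> for the variable \<open>G\<close> of
  the limit law, written through the offspring laws.\<close>

definition mean_exceed :: real where
  "mean_exceed = (\<Sum>p\<in>UNIV. \<sigma> p * measure_pmf.expectation (offs p) (\<lambda>\<kappa>. tails.exceed_mass (\<kappa> Q)))"

lemma mean_exceed_nonneg: "0 \<le> mean_exceed"
  unfolding mean_exceed_def
  by (intro sum_nonneg mult_nonneg_nonneg \<sigma>_nonneg integral_nonneg_AE AE_I2 tails.exceed_mass_nonneg)

text \<open>Summation against a left eigenvector turns the mean matrix in the recursion for
  \<open>jump_rate\<close> into a factor \<rho>, so each generation adds one term of a geometric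
  sum.\<close>

lemma sum_jump_rate:
  "(\<Sum>p\<in>UNIV. \<sigma> p * tails.jump_rate offs z r p) = z powr (-\<alpha>) * mean_exceed * (\<Sum>i<r. \<rho> ^ i)"
proof (induction r)
  case (Suc r)
  have "(\<Sum>p\<in>UNIV. \<sigma> p * (\<Sum>q\<in>UNIV. mean_offspring offs p q * tails.jump_rate offs z r q))
     = (\<Sum>q\<in>UNIV. (\<Sum>p\<in>UNIV. \<sigma> p * mean_offspring offs p q) * tails.jump_rate offs z r q)"
    unfolding sum_distrib_left sum_distrib_right by (subst sum.swap) (simp add: mult.assoc)
  also have "\<dots> = \<rho> * (\<Sum>q\<in>UNIV. \<sigma> q * tails.jump_rate offs z r q)"
    by (simp add: left_eigenvector sum_distrib_left mult.assoc)
  also have "\<dots> = z powr (-\<alpha>) * mean_exceed * (\<rho> * (\<Sum>i<r. \<rho> ^ i))"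
    by (simp add: Suc)
  also have "\<rho> * (\<Sum>i<r. \<rho> ^ i) = (\<Sum>i<r. \<rho> ^ Suc i)"
    by (simp add: sum_distrib_left)
  finally have "(\<Sum>p\<in>UNIV. \<sigma> p * tails.jump_rate offs z (Suc r) p)
    = z powr (-\<alpha>) * mean_exceed + z powr (-\<alpha>) * mean_exceed * (\<Sum>i<r. \<rho> ^ Suc i)"
    by (simp add: distrib_left sum.distrib mean_exceed_def sum_distrib_left mult_ac)
  also have "\<dots> = z powr (-\<alpha>) * mean_exceed * (\<Sum>i<Suc r. \<rho> ^ i)"
    by (simp add: sum.lessThan_Suc_shift distrib_left del: sum.lessThan_Suc)
  finally show ?case .
qed simp

lemma tendsto_prob_no_jump_recent:
  assumes z: "0 < z"
  shows "(\<lambda>n. prob (no_jump_event (n - r) n (b n * z)))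
     \<longlonglongrightarrow> (\<integral>\<omega>. exp (- (mean_exceed * ((\<Sum>i<r. \<rho> ^ i) / \<rho> ^ r) * W \<omega> * z powr (-\<alpha>))) \<partial>P)"
proof (rule LIMSEQ_offset[where k = r])
  let ?f = "\<lambda>n q. no_jump_prob offs D (b (n + r) * z) r q"
  \<comment> \<open>After the shift, \<open>n\<close> is the generation where the subtrees start
    while the threshold has index \<open>n + r\<close>: about \<open>\<rho> ^ n\<close> subtrees
    meet a failure probability of order \<open>\<rho> ^ (- n - r)\<close>, which leaves the divisor
    \<open>\<rho> ^ r\<close>.\<close>
  let ?J = "\<lambda>q. tails.jump_rate offs z r q / \<rho> ^ r"
  have f: "(\<lambda>n. \<rho> ^ n * (1 - ?f n q)) \<longlonglongrightarrow> ?J q" for q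
  proof -
    have "(\<lambda>n. \<rho> ^ (n + r) * (1 - ?f n q) / \<rho> ^ r) \<longlonglongrightarrow> ?J q"
      using \<rho>_pos LIMSEQ_ignore_initial_segment[OF tails.tendsto_no_jump_prob[OF integrable_offspring z, where r = r and p = q], of r]
      by (intro tendsto_divide tendsto_const) auto
    then show ?thesis using \<rho>_pos by (simp add: power_add)
  qed
  have "(\<lambda>n. \<integral>\<omega>. (\<Prod>q\<in>UNIV. ?f n q ^ type_count \<omega> n q) \<partial>P) \<longlonglongrightarrow> (\<integral>\<omega>. (\<Prod>q\<in>UNIV. exp (- (?J q * (W \<omega> * \<sigma> q)))) \<partial>P)"
  proof (rule integral_dominated_convergence[where w = "\<lambda>_. 1"])
    show "(\<lambda>\<omega>. \<Prod>q\<in>UNIV. ?f n q ^ type_count \<omega> n q) \<in> borel_measurable P" for n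
      by (intro borel_measurable_prod measurable_compose[OF measurable_generation_count]) simp
    show "AE \<omega> in P. (\<lambda>n. \<Prod>q\<in>UNIV. ?f n q ^ type_count \<omega> n q) \<longlonglongrightarrow> (\<Prod>q\<in>UNIV. exp (- (?J q * (W \<omega> * \<sigma> q))))"
      using W_limit
    proof eventually_elim
      case (elim \<omega>)
      show ?case
        by (intro tendsto_prod tendsto_power_exp[OF \<rho>_pos f D.no_jump_prob_le_1 elim[rule_format]])
    qed
    show "AE \<omega> in P. norm (\<Prod>q\<in>UNIV. ?f n q ^ type_count \<omega> n q) \<le> 1" for n
    proof (intro AE_I2)
      fix \<omega>
      have "0 \<le> (\<Prod>q\<in>UNIV. ?f n q ^ type_count \<omega> n q)" by (intro prod_nonneg) (simp add: D.no_jump_prob_nonneg)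
      moreover have "(\<Prod>q\<in>UNIV. ?f n q ^ type_count \<omega> n q) \<le> 1"
        by (intro prod_le_1) (simp add: D.no_jump_prob_nonneg D.no_jump_prob_le_1 power_le_one)
      ultimately show "norm (\<Prod>q\<in>UNIV. ?f n q ^ type_count \<omega> n q) \<le> 1" by simp
    qed
  qed simp_all
  moreover have "(\<Prod>q\<in>UNIV. exp (- (?J q * (W \<omega> * \<sigma> q)))) = exp (- (mean_exceed * ((\<Sum>i<r. \<rho> ^ i) / \<rho> ^ r) * W \<omega> * z powr (-\<alpha>)))" for \<omega>
  proof -
    have "(\<Sum>q\<in>UNIV. - (?J q * (W \<omega> * \<sigma> q))) = - ((\<Sum>q\<in>UNIV. \<sigma> q * tails.jump_rate offs z r q) / \<rho> ^ r * W \<omega>)"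
      unfolding sum_divide_distrib sum_distrib_right sum_negf[symmetric]
      by (intro sum.cong refl) (simp add: mult_ac)
    then show ?thesis by (simp add: exp_sum[symmetric] sum_jump_rate mult_ac)
  qed
  ultimately show "(\<lambda>n. prob (no_jump_event (n + r - r) (n + r) (b (n + r) * z)))
     \<longlonglongrightarrow> (\<integral>\<omega>. exp (- (mean_exceed * ((\<Sum>i<r. \<rho> ^ i) / \<rho> ^ r) * W \<omega> * z powr (-\<alpha>))) \<partial>P)"
    by (simp add: prob_no_jump)
qed

text \<open>The families before generation \<open>n - r\<close> have mean number of order
  \<open>\<rho> ^ (n - r)\<close>, against a tail of order \<open>\<rho> ^ (- n)\<close>. The
  constant precedes the quantifier over \<open>r\<close>, so that \<open>r\<close> can tend to
  infinity after \<open>n\<close>.\<close>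

lemma prob_early_jump_bound:
  assumes z: "0 < z"
  shows "\<exists>C. \<forall>r. \<forall>\<^sub>F n in sequentially.
    prob (jump_event 0 (n - r) (b n * z)) \<le> C * inverse \<rho> ^ r"
proof -
  obtain C where C: "0 < C" "\<forall>\<^sub>F n in sequentially. \<forall>q. \<rho> ^ n * tails.tail q (b n * z) \<le> C"
    using tails.tail_bound[OF z] by blast
  define C' where "C' = C * (\<rho> / Min (range u)) * Max (range u) / (\<rho> - 1)"
  have u: "0 < Min (range u)" "0 < Max (range u)" using u_pos by (auto simp: Max_gr_iff)
  have "\<forall>\<^sub>F n in sequentially.
    prob (jump_event 0 (n - r) (b n * z)) \<le> C' * inverse \<rho> ^ r" for r
    using C(2) eventually_ge_at_top[of r]
  proof eventually_elim
    case (elim n)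
    have "tails.tail q (b n * z) \<le> C / \<rho> ^ n" for q
      using elim(1)[rule_format, of q] \<rho>_pos by (simp add: le_divide_eq mult.commute)
    then have "prob (jump_event 0 (n - r) (b n * z))
      \<le> C / \<rho> ^ n * (\<rho> / Min (range u)) * (\<Sum>j<n - r. \<rho> ^ j) * Max (range u)"
      using C(1) \<rho>_pos by (intro prob_early_jump_le) (auto simp: tails.prob_abs_gt)
    also have "(\<Sum>j<n - r. \<rho> ^ j) = (\<rho> ^ (n - r) - 1) / (\<rho> - 1)"
      using \<rho>_pos by (subst geometric_sum) auto
    also have "C / \<rho> ^ n * (\<rho> / Min (range u)) * ((\<rho> ^ (n - r) - 1) / (\<rho> - 1)) * Max (range u)
      \<le> C / \<rho> ^ n * (\<rho> / Min (range u)) * (\<rho> ^ (n - r) / (\<rho> - 1)) * Max (range u)"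
      using less_imp_le[OF C(1)] \<rho>_pos less_imp_le[OF u(1)] less_imp_le[OF u(2)]
      by (intro mult_right_mono mult_left_mono divide_right_mono mult_nonneg_nonneg divide_nonneg_nonneg) simp_all
    also have "\<dots> = C' * (\<rho> ^ (n - r) / \<rho> ^ n)" by (simp add: C'_def mult_ac)
    also have "\<rho> ^ (n - r) / \<rho> ^ n = inverse \<rho> ^ r"
      using \<rho>_pos elim(2) by (simp add: power_diff power_inverse divide_inverse)
    finally show ?case .
  qed
  then show ?thesis by blast
qed

lemma sets_no_jump: "(no_jump_event m n c) \<in> events"
  using pred_model_compose[of "\<lambda>r z. no_jump r (fst z) (snd z) m n c", OF D.pred_no_jump] by simp

lemma sets_not_no_jump: "(jump_event m n c) \<in> events"
  using pred_model_compose[of "\<lambda>r z. \<not> no_jump r (fst z) (snd z) m n c", OF D.pred_no_jump[THEN pred_intros_logic(2)]] by simp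

lemma tendsto_exp_laplace:
  assumes c: "\<And>i. 0 \<le> c i" and lim: "c \<longlonglongrightarrow> l"
  shows "(\<lambda>i. \<integral>\<omega>. exp (- (c i * W \<omega>)) \<partial>P) \<longlonglongrightarrow> (\<integral>\<omega>. exp (- (l * W \<omega>)) \<partial>P)"
proof (rule integral_dominated_convergence[where w = "\<lambda>_. 1"])
  show "AE \<omega> in P. norm (exp (- (c i * W \<omega>))) \<le> 1" for i
    using W_pos by eventually_elim (use c[of i] in simp)
  show "AE \<omega> in P. (\<lambda>i. exp (- (c i * W \<omega>))) \<longlonglongrightarrow> exp (- (l * W \<omega>))"
    by (intro AE_I2 tendsto_intros lim)
qed simp_all

text \<open>For fixed \<open>r\<close> the probability differs from that for the last
  \<open>r\<close> generations by at most the early-jump error. As \<open>r\<close> grows, the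
  normalised geometric sum tends to \<open>1 / (\<rho> - 1)\<close>, which is the origin of this
  factor in the constant.\<close>

lemma tendsto_prob_no_jump:
  assumes z: "0 < z"
  shows "(\<lambda>n. prob (no_jump_event 0 n (b n * z)))
     \<longlonglongrightarrow> (\<integral>\<omega>. exp (- (mean_exceed / (\<rho> - 1) * z powr (-\<alpha>) * W \<omega>)) \<partial>P)"
proof -
  let ?p = "\<lambda>n r. prob (no_jump_event (n - r) n (b n * z))"
  let ?F = "\<lambda>r. \<integral>\<omega>. exp (- (mean_exceed * ((\<Sum>i<r. \<rho> ^ i) / \<rho> ^ r) * W \<omega> * z powr (-\<alpha>))) \<partial>P"
  obtain C where C: "\<And>r. \<forall>\<^sub>F n in sequentially.
    prob (jump_event 0 (n - r) (b n * z)) \<le> C * inverse \<rho> ^ r"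
    using prob_early_jump_bound[OF z] by blast
  have inv0: "(\<lambda>r. inverse \<rho> ^ r) \<longlonglongrightarrow> 0"
    using \<rho>_pos by (intro LIMSEQ_power_zero) (simp add: inverse_less_1_iff)
  have F: "?F \<longlonglongrightarrow> (\<integral>\<omega>. exp (- (mean_exceed / (\<rho> - 1) * z powr (-\<alpha>) * W \<omega>)) \<partial>P)"
  proof -
    have sum_eq: "(\<Sum>i<r. \<rho> ^ i) / \<rho> ^ r = (1 - inverse \<rho> ^ r) / (\<rho> - 1)" for r
      using \<rho>_pos by (subst geometric_sum) (auto simp: power_inverse field_simps)
    have "(\<lambda>r. mean_exceed * ((1 - inverse \<rho> ^ r) / (\<rho> - 1)) * z powr (-\<alpha>))
       \<longlonglongrightarrow> mean_exceed * ((1 - 0) / (\<rho> - 1)) * z powr (-\<alpha>)"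
      using \<rho>_pos by (intro tendsto_intros inv0) auto
    then have "(\<lambda>r. mean_exceed * ((\<Sum>i<r. \<rho> ^ i) / \<rho> ^ r) * z powr (-\<alpha>)) \<longlonglongrightarrow> mean_exceed / (\<rho> - 1) * z powr (-\<alpha>)"
      by (simp add: sum_eq)
    from tendsto_exp_laplace[OF _ this]
    show ?thesis using mean_exceed_nonneg \<rho>_pos by (simp add: mult_ac sum_nonneg)
  qed
  show ?thesis
  proof (rule tendsto_between)
    show "(\<lambda>n. ?p n r - C * inverse \<rho> ^ r) \<longlonglongrightarrow> ?F r - C * inverse \<rho> ^ r" for r
      by (intro tendsto_diff tendsto_const tendsto_prob_no_jump_recent z)
    show "(\<lambda>n. ?p n r) \<longlonglongrightarrow> ?F r" for r
      by (rule tendsto_prob_no_jump_recent[OF z])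
    show "\<forall>\<^sub>F n in sequentially. prob (no_jump_event 0 n (b n * z)) \<le> ?p n r" for r
      by (intro always_eventually allI finite_measure_mono sets_no_jump) (auto simp: no_jump_def)
    show "\<forall>\<^sub>F n in sequentially. ?p n r - C * inverse \<rho> ^ r \<le> prob (no_jump_event 0 n (b n * z))" for r
      using C[of r]
    proof eventually_elim
      case (elim n)
      have "?p n r \<le> prob ((no_jump_event 0 n (b n * z))
          \<union> (jump_event 0 (n - r) (b n * z)))"
        by (intro finite_measure_mono sets.Un sets_no_jump sets_not_no_jump)
          (auto simp: no_jump_split[of "n - r" n])
      also have "\<dots> \<le> prob (no_jump_event 0 n (b n * z))
          + prob (jump_event 0 (n - r) (b n * z))"
        by (intro measure_Un_le sets_no_jump sets_not_no_jump)
      finally show ?case using elim by simp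
    qed
    have "(\<lambda>r. ?F r - C * inverse \<rho> ^ r) \<longlonglongrightarrow> (\<integral>\<omega>. exp (- (mean_exceed / (\<rho> - 1) * z powr (-\<alpha>) * W \<omega>)) \<partial>P) - C * 0"
      by (intro tendsto_diff F tendsto_mult tendsto_const inv0)
    then show "(\<lambda>r. ?F r - C * inverse \<rho> ^ r) \<longlonglongrightarrow> (\<integral>\<omega>. exp (- (mean_exceed / (\<rho> - 1) * z powr (-\<alpha>) * W \<omega>)) \<partial>P)"
      by simp
    show "?F \<longlonglongrightarrow> (\<integral>\<omega>. exp (- (mean_exceed / (\<rho> - 1) * z powr (-\<alpha>) * W \<omega>)) \<partial>P)"
      by (rule F)
  qed simp
qed

text \<open>About \<open>\<rho> ^ n\<close> paths and a factor of order \<open>n ^ 2\<close> for the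
  places of the two steps meet the squared tail at \<open>b m\<close>, of order
  \<open>\<rho> ^ (- 2 * m)\<close>. With \<open>m\<close> at least \<open>3 * n / 4\<close> a decay
  of \<open>\<rho> ^ (- n / 2)\<close> remains.\<close>

lemma tendsto_prob_two_large_steps:
  "(\<lambda>n. prob (two_jumps_event n (b (n - n div 4)))) \<longlonglongrightarrow> 0"
proof -
  let ?p = "\<lambda>n. prob (two_jumps_event n (b (n - n div 4)))"
  obtain C where C: "0 < C" "\<forall>\<^sub>F n in sequentially. \<forall>q. \<rho> ^ n * tails.tail q (b n * 1) \<le> C"
    using tails.tail_bound[of 1] by auto
  then obtain N where N: "\<And>n q. n \<ge> N \<Longrightarrow> \<rho> ^ n * tails.tail q (b n) \<le> C"
    unfolding eventually_sequentially by auto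
  have u: "0 < Min (range u)" "0 < Max (range u)" using u_pos by (auto simp: Max_gr_iff)
  define U where "U = Max (range u) / Min (range u)"
  have U: "0 < U" unfolding U_def using u(2,1) by (rule divide_pos_pos)
  \<comment> \<open>The decay \<open>\<rho> ^ (- n / 2)\<close> is split into two factors
    \<open>inverse a ^ n\<close>, one for each factor \<open>n\<close>.\<close>
  define a where "a = root 4 \<rho>"
  have a: "1 < a" "a ^ 4 = \<rho>" using \<rho>_pos by (simp_all add: a_def)
  have "(\<lambda>n. real n * inverse a ^ n) \<longlonglongrightarrow> 0"
    using powser_times_n_limit_0[of "inverse a"] a by (simp add: inverse_less_1_iff)
  then have lim: "(\<lambda>n. exp 1 * U * C\<^sup>2 * ((real n * inverse a ^ n) * (real n * inverse a ^ n))) \<longlonglongrightarrow> exp 1 * U * C\<^sup>2 * (0 * 0)"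
    by (intro tendsto_intros)
  have bound: "?p n \<le> exp 1 * U * C\<^sup>2 * ((real n * inverse a ^ n) * (real n * inverse a ^ n))" if n: "2 * N + 1 \<le> n" for n
  proof -
    define m where "m = n - n div 4"
    have m: "N \<le> m" using n by (simp add: m_def)
    have m4: "6 * n \<le> 8 * m" by (simp add: m_def)
    define \<tau> where "\<tau> = C / \<rho> ^ m"
    have \<tau>: "0 < \<tau>" "\<And>q. tails.tail q (b m) \<le> \<tau>"
      using N[OF m] C(1) \<rho>_pos by (auto simp: \<tau>_def le_divide_eq mult.commute)
    \<comment> \<open>This choice keeps \<open>(1 + s * \<tau>) ^ n\<close> below
      \<open>exp 1\<close> while \<open>1 / s\<close> is only \<open>n * \<tau>\<close>.\<close>
    define s where "s = 1 / (real n * \<tau>)"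
    have s: "0 < s" "s * \<tau> = 1 / real n" using \<tau> n by (auto simp: s_def)
    have R: "\<rho> ^ n / (\<rho> ^ m)\<^sup>2 \<le> inverse a ^ n * inverse a ^ n"
    proof -
      have "a ^ (4 * n) * a ^ (2 * n) \<le> a ^ (8 * m)"
        using a m4 by (simp add: power_add[symmetric])
      then have "\<rho> ^ n * a ^ (2 * n) \<le> (\<rho> ^ m)\<^sup>2"
        by (simp add: a(2)[symmetric] power_mult[symmetric] mult.commute)
      then show ?thesis using a \<rho>_pos
        by (simp add: divide_le_eq power_inverse field_simps power_add[symmetric] mult_2[symmetric])
    qed
    have "?p n \<le> ((1 + s * \<tau>) * \<rho>) ^ n * Max (range u) / (Min (range u) * (1 + s)\<^sup>2)"
      unfolding m_def[symmetric] using s \<tau> by (intro prob_two_large_steps_le) (auto simp: tails.prob_abs_gt)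
    also have "\<dots> = (1 + 1 / real n) ^ n * \<rho> ^ n * U / (1 + s)\<^sup>2"
      unfolding s(2) by (simp add: power_mult_distrib U_def)
    also have "\<dots> \<le> exp 1 * \<rho> ^ n * U / s\<^sup>2"
    proof (intro frac_le mult_mono)
      have "(1 + 1 / real n) ^ n \<le> exp (1 / real n) ^ n"
        by (intro power_mono exp_ge_add_one_self_aux) auto
      also have "\<dots> = exp 1" using n by (simp add: exp_of_nat_mult[symmetric])
      finally show "(1 + 1 / real n) ^ n \<le> exp 1" .
    qed (use s U \<rho>_pos in \<open>auto intro!: power_mono\<close>)
    also have "\<dots> = exp 1 * U * C\<^sup>2 * (real n)\<^sup>2 * (\<rho> ^ n / (\<rho> ^ m)\<^sup>2)"
      using \<rho>_pos C(1) by (simp add: s_def \<tau>_def power_divide power_mult_distrib field_simps)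
    also have "\<dots> \<le> exp 1 * U * C\<^sup>2 * (real n)\<^sup>2 * (inverse a ^ n * inverse a ^ n)"
      using U by (intro mult_left_mono R) simp
    finally show ?thesis
      by (simp add: power2_eq_square mult_ac)
  qed
  show ?thesis
  proof (rule tendsto_sandwich[OF _ _ tendsto_const])
    show "\<forall>\<^sub>F n in sequentially. ?p n \<le> exp 1 * U * C\<^sup>2 * ((real n * inverse a ^ n) * (real n * inverse a ^ n))"
      using eventually_ge_at_top[of "2 * N + 1"] by eventually_elim (rule bound)
    show "(\<lambda>n. exp 1 * U * C\<^sup>2 * ((real n * inverse a ^ n) * (real n * inverse a ^ n))) \<longlonglongrightarrow> 0"
      using lim by simp
  qed simp
qed

text \<open>Off the event of two large steps, comparing the maximum with single displacements costs
  at most \<open>n * b (n - n div 4)\<close>, eventually at most \<open>\<delta> i * b n\<close>.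
  Shifting the level \<open>x\<close> absorbs this error, and continuity of the limit in
  \<open>x\<close> removes the shift.\<close>

lemma tendsto_prob_rightmost:
  assumes x: "0 < x"
  shows "(\<lambda>n. prob {\<omega> \<in> space P. rightmost (T \<omega>) (K \<omega>) (X \<omega>) n < b n * x})
     \<longlonglongrightarrow> (\<integral>\<omega>. exp (- (mean_exceed / (\<rho> - 1) * x powr (-\<alpha>) * W \<omega>)) \<partial>P)"
proof -
  let ?A = "\<lambda>n. {\<omega> \<in> space P. rightmost (T \<omega>) (K \<omega>) (X \<omega>) n < b n * x}"
  let ?B = "\<lambda>n c. (no_jump_event 0 n (b n * c))"
  let ?E = "\<lambda>n. (two_jumps_event n (b (n - n div 4)))"
  let ?F = "\<lambda>c. \<integral>\<omega>. exp (- (mean_exceed / (\<rho> - 1) * c powr (-\<alpha>) * W \<omega>)) \<partial>P"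
  have A: "?A n \<in> events" for n
    using pred_model_compose[of "\<lambda>r z. rightmost r (fst z) (snd z) n < b n * x", OF D.pred_rightmost_less] by simp
  have E: "?E n \<in> events" for n
    using pred_model_compose[of "\<lambda>r z. \<exists>v\<in>generation r (fst z) n. 2 \<le> large_steps (b (n - n div 4)) (snd z) v", OF D.pred_exists_large_steps] by simp
  \<comment> \<open>The denominator \<open>3 + i\<close> keeps \<open>x - 2 * \<delta> i\<close>
    positive.\<close>
  define \<delta> where "\<delta> i = x / (3 + real i)" for i :: nat
  have \<delta>: "0 < \<delta> i" "2 * \<delta> i < x" for i
  proof -
    have "x * 2 < x * (3 + real i)" using x by (intro mult_strict_left_mono) auto
    then show "0 < \<delta> i" "2 * \<delta> i < x" using x by (simp_all add: \<delta>_def divide_less_eq mult.commute)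
  qed
  have \<delta>0: "\<delta> \<longlonglongrightarrow> 0" unfolding \<delta>_def by real_asymp
  have F_lim: "(\<lambda>i. ?F (c i)) \<longlonglongrightarrow> ?F x" if "c \<longlonglongrightarrow> x" for c
  proof (rule tendsto_exp_laplace)
    show "(\<lambda>i. mean_exceed / (\<rho> - 1) * c i powr (-\<alpha>)) \<longlonglongrightarrow> mean_exceed / (\<rho> - 1) * x powr (-\<alpha>)"
      using x by (intro tendsto_intros that) auto
  qed (use mean_exceed_nonneg \<rho>_pos in simp)
  have small: "\<forall>\<^sub>F n in sequentially. 1 \<le> n \<and> real n * b (n - n div 4) \<le> \<delta> i * b n" for i
    by (intro eventually_conj tails.b_ratio \<delta> eventually_ge_at_top)
  show ?thesis
  proof (rule tendsto_between)
    show "(\<lambda>n. prob (?B n (x - 2 * \<delta> i)) - prob (?E n)) \<longlonglongrightarrow> ?F (x - 2 * \<delta> i) - 0" for i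
      using \<delta>[of i] by (intro tendsto_diff tendsto_prob_no_jump tendsto_prob_two_large_steps) auto
    show "(\<lambda>n. prob (?B n (x + \<delta> i)) + prob (?E n)) \<longlonglongrightarrow> ?F (x + \<delta> i) + 0" for i
      using \<delta>[of i] by (intro tendsto_add tendsto_prob_no_jump tendsto_prob_two_large_steps) auto
    show "\<forall>\<^sub>F n in sequentially. prob (?B n (x - 2 * \<delta> i)) - prob (?E n) \<le> prob (?A n)" for i
      using small[of i]
    proof eventually_elim
      case (elim n)
      have bn: "0 < b n" "0 < b (n - n div 4)" using elim by (auto intro!: tails.b_pos)
      have "prob (?B n (x - 2 * \<delta> i)) \<le> prob (?A n \<union> ?E n)"
      proof (rule finite_measure_mono_AE)
        show "AE \<omega> in P. \<omega> \<in> ?B n (x - 2 * \<delta> i) \<longrightarrow> \<omega> \<in> ?A n \<union> ?E n"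
          using AE_offspring_ge_1
        proof eventually_elim
          case k: (elim \<omega>)
          show ?case
          proof (intro impI)
            assume B: "\<omega> \<in> ?B n (x - 2 * \<delta> i)"
            have "rightmost (T \<omega>) (K \<omega>) (X \<omega>) n < b n * x" if "\<omega> \<notin> ?E n"
            proof (rule rightmost_less)
              show "1 \<le> K \<omega> i q" for i q using k by blast
              show "large_steps (b (n - n div 4)) (X \<omega>) v \<le> 1" if "v \<in> generation (T \<omega>) (K \<omega>) n" for v
                using \<open>\<omega> \<notin> ?E n\<close> B that by force
              show "no_jump (T \<omega>) (K \<omega>) (X \<omega>) 0 n (b n * (x - 2 * \<delta> i))" using B by simp
              show "0 \<le> b n * (x - 2 * \<delta> i)" "0 \<le> b (n - n div 4)" using bn \<delta>[of i] by simp_all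
              \<comment> \<open>One \<open>\<delta> i\<close> pays for the small steps; the other
                keeps the final inequality strict.\<close>
              have "b n * (x - 2 * \<delta> i) + real n * b (n - n div 4) \<le> b n * (x - 2 * \<delta> i) + \<delta> i * b n"
                using elim by simp
              also have "\<dots> = b n * x - b n * \<delta> i" by (simp add: algebra_simps)
              also have "\<dots> < b n * x" using bn \<delta>[of i] by simp
              finally show "b n * (x - 2 * \<delta> i) + real n * b (n - n div 4) < b n * x" .
            qed
            then show "\<omega> \<in> ?A n \<union> ?E n" using B by blast
          qed
        qed
      qed (intro sets.Un A E)
      also have "\<dots> \<le> prob (?A n) + prob (?E n)" by (intro measure_Un_le A E)
      finally show ?case by simp
    qed
    show "\<forall>\<^sub>F n in sequentially. prob (?A n) \<le> prob (?B n (x + \<delta> i)) + prob (?E n)" for i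
      using small[of i]
    proof eventually_elim
      case (elim n)
      have bn: "0 < b n" "0 < b (n - n div 4)" using elim by (auto intro!: tails.b_pos)
      have "prob (?A n) \<le> prob (?B n (x + \<delta> i) \<union> ?E n)"
      proof (rule finite_measure_mono_AE)
        show "AE \<omega> in P. \<omega> \<in> ?A n \<longrightarrow> \<omega> \<in> ?B n (x + \<delta> i) \<union> ?E n"
          using AE_offspring_ge_1
        proof eventually_elim
          case k: (elim \<omega>)
          show ?case
          proof (intro impI)
            assume A': "\<omega> \<in> ?A n"
            have "no_jump (T \<omega>) (K \<omega>) (X \<omega>) 0 n (b n * (x + \<delta> i))" if "\<omega> \<notin> ?E n"
            proof (rule no_jump_if_rightmost_less)
              show "1 \<le> K \<omega> i q" for i q using k by blast
              show "large_steps (b (n - n div 4)) (X \<omega>) v \<le> 1" if "v \<in> generation (T \<omega>) (K \<omega>) n" for v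
                using \<open>\<omega> \<notin> ?E n\<close> A' that by force
              show "rightmost (T \<omega>) (K \<omega>) (X \<omega>) n < b n * x" using A' by simp
              show "0 \<le> b (n - n div 4)" using bn by simp
              have "1 * b (n - n div 4) \<le> real n * b (n - n div 4)"
                using elim bn by (intro mult_right_mono) auto
              also have "\<dots> \<le> \<delta> i * b n" using elim by simp
              also have "\<dots> < b n * (x + \<delta> i)" using bn x by (simp add: algebra_simps)
              finally show "b (n - n div 4) < b n * (x + \<delta> i)" by simp
              show "b n * x \<le> b n * (x + \<delta> i) - real n * b (n - n div 4)"
                using elim by (simp add: algebra_simps)
            qed
            then show "\<omega> \<in> ?B n (x + \<delta> i) \<union> ?E n" using A' by blast
          qed
        qed
      qed (intro sets.Un sets_no_jump E)
      also have "\<dots> \<le> prob (?B n (x + \<delta> i)) + prob (?E n)" by (intro measure_Un_le sets_no_jump E)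
      finally show ?case .
    qed
    have "(\<lambda>i. x - 2 * \<delta> i) \<longlonglongrightarrow> x - 2 * 0" "(\<lambda>i. x + \<delta> i) \<longlonglongrightarrow> x + 0"
      by (intro tendsto_intros \<delta>0)+
    then have "(\<lambda>i. x - 2 * \<delta> i) \<longlonglongrightarrow> x" "(\<lambda>i. x + \<delta> i) \<longlonglongrightarrow> x" by simp_all
    from this[THEN F_lim]
    show "(\<lambda>i. ?F (x - 2 * \<delta> i) - 0) \<longlonglongrightarrow> ?F x" "(\<lambda>i. ?F (x + \<delta> i) + 0) \<longlonglongrightarrow> ?F x"
      by simp_all
  qed simp
qed

end

section \<open>The limiting constant\<close>

lemma has_sum_finite_sum:
  fixes f :: "'i \<Rightarrow> 'a \<Rightarrow> 'b::topological_comm_monoid_add"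
  assumes "finite I" "\<And>i. i \<in> I \<Longrightarrow> (f i has_sum s i) A"
  shows "((\<lambda>x. \<Sum>i\<in>I. f i x) has_sum (\<Sum>i\<in>I. s i)) A"
  using assms by (induction I rule: finite_induct) (auto intro: has_sum_add)

lemma H_set_subset_exceed:
  assumes "set js \<subseteq> {0, 1}" "1 \<le> sum_list js"
  shows "H_set js \<subseteq> exceed_set (length js) 1"
proof
  fix y assume y: "y \<in> H_set js"
  have "\<exists>j\<in>set js. j \<noteq> 0"
  proof (rule ccontr)
    assume "\<not> ?thesis"
    then have "sum_list js = 0" by (simp add: sum_list_eq_0_iff)
    with assms(2) show False by simp
  qed
  then obtain m where "m \<in> set js" "m \<noteq> 0" by blast
  with assms(1) have "1 \<in> set js" by auto
  then obtain j where j: "j < length js" "js ! j = 1" unfolding in_set_conv_nth by blast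
  then have "1 < y j" using y by (auto simp: H_set_def G_set_def)
  then show "y \<in> exceed_set (length js) 1" using j(1) by (auto simp: exceed_set_def)
qed

section \<open>Mass of the patterns of large coordinates\<close>

context heavy_tails
begin

lemma sets_lam_coordinate: "{y \<in> punctured. E y} \<in> sets lam" if "{y. E y} \<in> sets borel" for E :: "(nat \<Rightarrow> real) \<Rightarrow> bool"
proof -
  have "{y \<in> punctured. E y} = {y. E y} \<inter> punctured" by auto
  then show ?thesis
    unfolding sets_lam using that by (subst sets_restrict_space_iff) (auto intro!: borel_open open_Compl)
qed

text \<open>By scaling, the mass of \<open>{y. c < y i}\<close> is continuous in \<open>c\<close>.\<close>

lemma exceed_mass_boundary: "emeasure lam ({y. \<exists>i<g. y i = 1}) = 0"
proof -
  have meas[measurable]: "(\<lambda>y :: nat \<Rightarrow> real. y i) \<in> borel_measurable borel" for i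
    by (intro borel_measurable_continuous_onI continuous_on_product_coordinates)
  let ?A = "\<lambda>i. {y :: nat \<Rightarrow> real. y i = 1}"
  let ?S = "\<lambda>i c. {y :: nat \<Rightarrow> real. c < y i}"
  have S: "?S i c \<in> sets lam" if "0 \<le> c" for i c
    by (rule sets_lam_open) (use that in \<open>auto intro!: open_Collect_less continuous_on_product_coordinates\<close>)
  have S_sub: "?S i c \<subseteq> exceed_set (Suc i) c" for i c by (auto simp: exceed_set_def)
  have fin: "emeasure lam (?S i c) < \<infinity>" if "0 < c" for i c
    using emeasure_mono[OF S_sub[of c i] exceed_set_lam[of c "Suc i"]] emeasure_exceed_finite[OF that, of "Suc i"] that
    by (auto intro: le_less_trans)
  have A: "?A i \<in> sets lam" for i
  proof -
    have "?A i = ?S i (1 / 2) - ({y. 1 / 2 < y i \<and> y i \<noteq> 1} \<inter> punctured)" by auto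
    moreover have "{y. 1 / 2 < y i \<and> y i \<noteq> 1} \<inter> punctured = {y \<in> punctured. 1 / 2 < y i \<and> y i \<noteq> 1}" by auto
    moreover have "{y \<in> punctured. 1 / 2 < y i \<and> y i \<noteq> 1} \<in> sets lam"
      by (rule sets_lam_coordinate) measurable
    ultimately show ?thesis using S[of "1 / 2" i] by auto
  qed
  have A_fin: "emeasure lam (?A i) < \<infinity>" for i
  proof (rule le_less_trans[OF _ fin[of "1 / 2" i]])
    show "emeasure lam (?A i) \<le> emeasure lam (?S i (1 / 2))"
      by (rule emeasure_mono) (use S[of "1 / 2" i] in auto)
  qed simp
  have scale: "emeasure lam (?S i c) = ennreal (c powr (-\<alpha>)) * emeasure lam (?S i 1)" if "0 < c" for i c
  proof -
    have "(\<lambda>y i. c * y i) ` ?S i 1 = ?S i c"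
    proof (intro set_eqI iffI)
      fix y assume "y \<in> ?S i c"
      then have "(\<lambda>i. y i / c) \<in> ?S i 1" using that by (auto simp: field_simps)
      then show "y \<in> (\<lambda>y i. c * y i) ` ?S i 1"
        using that by (intro image_eqI[of _ _ "\<lambda>i. y i / c"]) auto
    qed (use that in \<open>auto simp: field_simps\<close>)
    then show ?thesis using lam_scaling[OF that S[of 1 i]] by simp
  qed
  have A0: "emeasure lam (?A i) = 0" for i
  proof -
    let ?s = "\<lambda>c. measure lam (?S i c)"
    \<comment> \<open>For \<open>c < 1\<close> the hyperplane and the half-space above 1 are
      disjoint parts of the half-space above \<open>c\<close>. As \<open>c\<close> tends to 1, the
      mass of the latter tends to that of the half-space above 1, which leaves nothing for the
      hyperplane.\<close>
    have add: "?s 1 + measure lam (?A i) \<le> ?s c" if "0 < c" "c < 1" for c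
    proof -
      have "emeasure lam (?S i 1 \<union> ?A i) = emeasure lam (?S i 1) + emeasure lam (?A i)"
        by (rule plus_emeasure[symmetric]) (use S[of 1 i] A in auto)
      moreover have "emeasure lam (?S i 1 \<union> ?A i) \<le> emeasure lam (?S i c)"
        by (rule emeasure_mono) (use that S[of c i] in auto)
      ultimately have le: "emeasure lam (?S i 1) + emeasure lam (?A i) \<le> emeasure lam (?S i c)" by simp
      then have "enn2real (emeasure lam (?S i 1) + emeasure lam (?A i)) \<le> ?s c"
        unfolding measure_def using fin[OF that(1), of i] by (intro enn2real_mono) auto
      then show ?thesis using fin[of 1 i] A_fin[of i] by (simp add: measure_def enn2real_plus)
    qed
    have "(\<lambda>n. (1 - 1 / real (n + 2)) powr (-\<alpha>) * ?s 1) \<longlonglongrightarrow> (1 - 0) powr (-\<alpha>) * ?s 1"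
      by (intro tendsto_intros LIMSEQ_ignore_initial_segment[OF lim_1_over_n]) auto
    moreover have "?s 1 + measure lam (?A i) \<le> (1 - 1 / real (n + 2)) powr (-\<alpha>) * ?s 1" for n
    proof -
      have c: "0 < 1 - 1 / real (n + 2)" "1 - 1 / real (n + 2) < 1" by (auto simp: field_simps)
      have "?s (1 - 1 / real (n + 2)) = (1 - 1 / real (n + 2)) powr (-\<alpha>) * ?s 1"
        using scale[OF c(1), of i] by (simp add: measure_def enn2real_mult)
      then show ?thesis using add[OF c] by simp
    qed
    ultimately have "?s 1 + measure lam (?A i) \<le> (1 - 0) powr (-\<alpha>) * ?s 1"
      by (intro tendsto_lowerbound[of _ "(1 - 0) powr (-\<alpha>) * ?s 1" sequentially]) auto
    then have "measure lam (?A i) = 0" by (simp add: measure_le_0_iff)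
    with A_fin[of i] show ?thesis by (auto simp: measure_def enn2real_eq_0_iff)
  qed
  have "{y. \<exists>i<g. y i = 1} = (\<Union>i<g. ?A i)" by auto
  moreover have "(\<Union>i<g. ?A i) \<in> null_sets lam"
    using A0 A by (intro null_sets_UN') (auto intro: null_setsI)
  ultimately show ?thesis by (simp add: null_setsD1)
qed

text \<open>The sets of the patterns are disjoint and fill \<open>exceed_set g 1\<close> up to
  vectors with an entry equal to 1, the value that both \<open>G_set 0\<close> and
  \<open>G_set 1\<close> leave out; these vectors form a null set.\<close>

lemma sum_H_set:
  "(\<Sum>js | length js = g \<and> set js \<subseteq> {0, 1} \<and> 1 \<le> sum_list js \<and> sum_list js \<le> g. measure lam (H_set js)) = exceed_mass g"
proof -
  let ?J = "{js :: nat list. length js = g \<and> set js \<subseteq> {0, 1} \<and> 1 \<le> sum_list js \<and> sum_list js \<le> g}"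
  let ?N = "{y :: nat \<Rightarrow> real. \<exists>i<g. y i = 1}"
  have fin: "finite ?J"
    by (rule finite_subset[OF _ finite_lists_length_eq[of "{0, 1 :: nat}" g]]) auto
  have coord[measurable]: "(\<lambda>y :: nat \<Rightarrow> real. y i) \<in> borel_measurable borel" for i
    by (intro borel_measurable_continuous_onI continuous_on_product_coordinates)
  have sub: "H_set js \<subseteq> exceed_set g 1" if "js \<in> ?J" for js
    using H_set_subset_exceed[of js] that by simp
  have H: "H_set js \<in> sets lam" if js: "js \<in> ?J" for js
  proof -
    have "open {y :: nat \<Rightarrow> real. ereal (y j) \<in> G_set (js ! j)}" for j
    proof -
      have "{y :: nat \<Rightarrow> real. ereal (y j) \<in> G_set (js ! j)} = (if js ! j = 0 then {y. y j < 1} else {y. 1 < y j})"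
        by (auto simp: G_set_def)
      then show ?thesis by (auto intro!: open_Collect_less continuous_on_product_coordinates)
    qed
    then have "open (\<Inter>j\<in>{..<length js}. {y :: nat \<Rightarrow> real. ereal (y j) \<in> G_set (js ! j)})"
      by (intro open_INT) auto
    moreover have "H_set js = (\<Inter>j\<in>{..<length js}. {y. ereal (y j) \<in> G_set (js ! j)})"
      by (auto simp: H_set_def)
    ultimately have "open (H_set js)" by simp
    moreover have "(\<lambda>_. 0) \<notin> H_set js" using sub[OF js] by (auto simp: exceed_set_def)
    ultimately show ?thesis by (rule sets_lam_open)
  qed
  have disj: "disjoint_family_on H_set ?J"
  proof (unfold disjoint_family_on_def, intro ballI impI)
    fix js ks assume js: "js \<in> ?J" and ks: "ks \<in> ?J" and "js \<noteq> ks"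
    from js ks have len: "length js = g" "length ks = g" by simp_all
    with \<open>js \<noteq> ks\<close> obtain j where j: "j < g" "js ! j \<noteq> ks ! j"
      using nth_equalityI[of js ks] by auto
    have "js ! j \<in> set js" "ks ! j \<in> set ks"
      using len j(1) by simp_all
    then have "js ! j \<in> {0, 1}" "ks ! j \<in> {0, 1}"
      using js ks by blast+
    with j(2) have disj: "G_set (js ! j) \<inter> G_set (ks ! j) = {}"
      by (auto simp: G_set_def)
    show "H_set js \<inter> H_set ks = {}"
    proof (rule equals0I)
      fix y assume "y \<in> H_set js \<inter> H_set ks"
      then have "ereal (y j) \<in> G_set (js ! j)" "ereal (y j) \<in> G_set (ks ! j)"
        using j(1) len by (simp_all add: H_set_def)
      with disj show False by blast
    qed
  qed
  have "exceed_set g 1 - ?N \<subseteq> (\<Union>js\<in>?J. H_set js)"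
  proof
    fix y assume y: "y \<in> exceed_set g 1 - ?N"
    \<comment> \<open>The pattern of \<open>y\<close> marks the entries above 1; at unmarked places
      \<open>y\<close> is strictly below 1 because it avoids \<open>?N\<close>.\<close>
    define js where "js = map (\<lambda>i. if 1 < y i then 1 else 0 :: nat) [0..<g]"
    obtain i where i: "i < g" "1 < y i" using y by (auto simp: exceed_set_def)
    have "1 \<in> set js" using i by (auto simp: js_def)
    then have "1 \<le> sum_list js" by (rule member_le_sum_list) simp
    moreover have "sum_list js \<le> g"
    proof -
      have "sum_list js \<le> sum_list (map (\<lambda>_. 1 :: nat) [0..<g])"
        unfolding js_def by (rule sum_list_mono) simp
      then show ?thesis by (simp add: sum_list_triv)
    qed
    ultimately have "js \<in> ?J" by (auto simp: js_def)
    moreover have "y \<in> H_set js"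
      unfolding H_set_def
    proof (intro CollectI allI impI)
      fix j assume "j < length js"
      then have j: "j < g" by (simp add: js_def)
      then have "y j \<noteq> 1" using y by auto
      then show "ereal (y j) \<in> G_set (js ! j)" using j by (auto simp: js_def G_set_def)
    qed
    ultimately show "y \<in> (\<Union>js\<in>?J. H_set js)" by blast
  qed
  then have ex: "exceed_set g 1 \<subseteq> (\<Union>js\<in>?J. H_set js) \<union> ?N" by blast
  have un: "(\<Union>js\<in>?J. H_set js) \<in> sets lam" using fin H by auto
  have N: "?N \<inter> exceed_set g 1 \<in> null_sets lam"
  proof (rule null_setsI)
    have "?N \<inter> exceed_set g 1 = {y \<in> punctured. (\<exists>i<g. y i = 1) \<and> (\<exists>i<g. 1 < y i)}"
      by (auto simp: exceed_set_def)
    moreover have "{y :: nat \<Rightarrow> real. (\<exists>i\<in>{..<g}. y i = 1) \<and> (\<exists>i\<in>{..<g}. 1 < y i)} \<in> sets borel"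
    proof -
      have "{y \<in> space borel. (\<exists>i\<in>{..<g}. y i = 1) \<and> (\<exists>i\<in>{..<g}. 1 < (y :: nat \<Rightarrow> real) i)} \<in> sets borel" by measurable
      then show ?thesis by simp
    qed
    ultimately show meas: "?N \<inter> exceed_set g 1 \<in> sets lam"
      using sets_lam_coordinate[of "\<lambda>y. (\<exists>i\<in>{..<g}. y i = 1) \<and> (\<exists>i\<in>{..<g}. 1 < y i)"] by (simp add: Bex_def)
    have "?N \<in> sets lam"
    proof -
      have "?N = {y \<in> punctured. \<exists>i\<in>{..<g}. y i = 1}" by auto
      moreover have "{y \<in> space borel. \<exists>i\<in>{..<g}. (y :: nat \<Rightarrow> real) i = 1} \<in> sets borel" by measurable
      ultimately show ?thesis using sets_lam_coordinate[of "\<lambda>y. \<exists>i\<in>{..<g}. y i = 1"] by simp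
    qed
    then have "emeasure lam (?N \<inter> exceed_set g 1) \<le> emeasure lam ?N" by (intro emeasure_mono) auto
    then show "emeasure lam (?N \<inter> exceed_set g 1) = 0" using exceed_mass_boundary[of g] by simp
  qed
  have eq: "exceed_set g 1 = (\<Union>js\<in>?J. H_set js) \<union> (?N \<inter> exceed_set g 1)"
  proof (rule equalityI)
    show "(\<Union>js\<in>?J. H_set js) \<union> (?N \<inter> exceed_set g 1) \<subseteq> exceed_set g 1"
      by (intro Un_least UN_least sub Int_lower2)
    show "exceed_set g 1 \<subseteq> (\<Union>js\<in>?J. H_set js) \<union> (?N \<inter> exceed_set g 1)"
      unfolding Un_Int_distrib by (rule Int_greatest[OF ex Un_upper2])
  qed
  have "emeasure lam (exceed_set g 1) = emeasure lam (\<Union>js\<in>?J. H_set js)"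
    by (subst eq, rule emeasure_Un_null_set[OF un N])
  then have "exceed_mass g = measure lam (\<Union>js\<in>?J. H_set js)"
    by (simp add: exceed_mass_def measure_def)
  also have "\<dots> = (\<Sum>js\<in>?J. measure lam (H_set js))"
  proof (rule measure_finite_Union[OF fin _ disj])
    show "H_set ` ?J \<subseteq> sets lam" using H by auto
    fix js assume js: "js \<in> ?J"
    have "emeasure lam (H_set js) \<le> emeasure lam (exceed_set g 1)"
      by (intro emeasure_mono sub js exceed_set_lam) simp
    then show "emeasure lam (H_set js) \<noteq> \<infinity>" using emeasure_exceed_finite[of 1 g] by auto
  qed
  finally show ?thesis by simp
qed

text \<open>The mean is taken under the discrete law of the number of type-\<open>Q\<close>
  children, so it becomes a sum over family sizes; summability rests on the linear bound for
  \<open>exceed_mass\<close>.\<close>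

lemma expectation_exceed_mass:
  assumes offs: "\<And>p q. integrable (measure_pmf (offs p)) (\<lambda>k. real (k q))"
  shows "((\<lambda>g. measure_pmf.prob (offs p) {k. k Q = g} * exceed_mass g)
      has_sum measure_pmf.expectation (offs p) (\<lambda>\<kappa>. exceed_mass (\<kappa> Q))) UNIV"
proof -
  let ?m = "map_pmf (\<lambda>k. k Q) (offs p)"
  have int: "integrable (measure_pmf ?m) exceed_mass"
    using integrable_exceed_mass[where offs = offs and p = p, OF offs] by simp
  have pmf: "pmf ?m g = measure_pmf.prob (offs p) {k. k Q = g}" for g
    by (simp add: pmf_map vimage_def)
  have "integrable (count_space UNIV) (\<lambda>g. pmf ?m g * exceed_mass g)"
    using int by (subst (asm) measure_pmf_eq_density) (simp add: integrable_density)
  then have sum: "Infinite_Set_Sum.abs_summable_on (\<lambda>g. pmf ?m g * exceed_mass g) UNIV"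
    by (simp add: abs_summable_on_def)
  have "measure_pmf.expectation (offs p) (\<lambda>\<kappa>. exceed_mass (\<kappa> Q)) = measure_pmf.expectation ?m exceed_mass"
    by simp
  also have "\<dots> = infsetsum (\<lambda>g. pmf ?m g * exceed_mass g) UNIV"
    by (rule pmf_expectation_eq_infsetsum)
  also have "\<dots> = infsum (\<lambda>g. pmf ?m g * exceed_mass g) UNIV"
    by (rule infsetsum_infsum[OF sum])
  finally have "measure_pmf.expectation (offs p) (\<lambda>\<kappa>. exceed_mass (\<kappa> Q)) = infsum (\<lambda>g. pmf ?m g * exceed_mass g) UNIV" .
  moreover have "(\<lambda>g. pmf ?m g * exceed_mass g) summable_on UNIV"
    using sum by (rule abs_summable_summable[OF abs_summable_equivalent[THEN iffD2]])
  ultimately show ?thesis unfolding pmf by simp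
qed

end

context heavy_tailed_walk
begin

lemma kappa_eq: "kappa offs \<rho> (\<chi> q. \<sigma> q) Q lam = mean_exceed / (\<rho> - 1)"
proof -
  have "((\<lambda>g. \<Sum>q\<in>UNIV. \<sigma> q * (measure_pmf.prob (offs q) {k. k Q = g} * tails.exceed_mass g)) has_sum mean_exceed) UNIV"
    unfolding mean_exceed_def
    by (intro has_sum_finite_sum has_sum_cmult_right tails.expectation_exceed_mass integrable_offspring) simp
  then have "((\<lambda>g. G_prob offs (\<chi> q. \<sigma> q) Q g * tails.exceed_mass g) has_sum mean_exceed) UNIV"
    by (simp add: G_prob_def sum_distrib_right mult.assoc)
  \<comment> \<open>The term for \<open>g = 0\<close> vanishes because \<open>exceed_set 0 1\<close>
    is empty, so the sum may start at 1.\<close>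
  then have "((\<lambda>g. G_prob offs (\<chi> q. \<sigma> q) Q g * tails.exceed_mass g) has_sum mean_exceed) {1..}"
    by (rule has_sum_cong_neutral[THEN iffD1, rotated -1])
      (auto simp: not_le tails.exceed_mass_def exceed_set_def)
  then show ?thesis
    unfolding kappa_def tails.sum_H_set by (simp add: infsumI divide_inverse mult.commute)
qed

end

theorem corollary3p4:
  fixes P :: "'a measure"
    and root_law :: "'q::finite pmf"
    and offs :: "'q \<Rightarrow> ('q \<Rightarrow> nat) pmf"
    and D :: "('q \<Rightarrow> nat \<Rightarrow> real) measure"
    and T :: "'a \<Rightarrow> 'q"
    and K :: "'a \<Rightarrow> 'q vertex \<times> 'q \<Rightarrow> 'q \<Rightarrow> nat"
    and X :: "'a \<Rightarrow> 'q vertex \<Rightarrow> 'q \<Rightarrow> nat \<Rightarrow> real"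
    and Q :: 'q
    and \<rho> \<alpha> \<beta> :: real
    and \<sigma> \<theta> :: "real^'q"
    and W :: "'a \<Rightarrow> real"
    and b :: "nat \<Rightarrow> real"
    and lam :: "(nat \<Rightarrow> real) measure"
    and x :: real
  assumes model: "branching_random_walk P root_law offs D T K X"
    and B1_finite: "\<And>p q. integrable (measure_pmf (offs p)) (\<lambda>k. real (k q))"
    and B1_PF: "perron_frobenius_eigenvalue (mean_matrix offs) \<rho>"
    and B1_supercritical: "1 < \<rho>"
    and left_eigenvector: "\<sigma> v* mean_matrix offs = \<rho> *s \<sigma>" "(\<Sum>q\<in>UNIV. \<sigma> $ q) = 1"
    and right_eigenvector: "mean_matrix offs *v \<theta> = \<rho> *s \<theta>" "\<sigma> \<bullet> \<theta> = 1"
    and B2: "\<And>p q. integrable (measure_pmf (offs p)) (\<lambda>k. real (k q) * ln (real (k q)))"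
    and W_measurable: "W \<in> borel_measurable P"
    and W_positive: "AE \<omega> in P. 0 < W \<omega>"
    and W_limit: "AE \<omega> in P. (\<lambda>n. inverse (\<rho> ^ n) *\<^sub>R type_counts (T \<omega>) (K \<omega>) n)
                    \<longlonglongrightarrow> W \<omega> *\<^sub>R \<sigma>"
    and D1: "\<And>p i. distr D borel (\<lambda>y. y p i) = distr D borel (\<lambda>y. y p 0)"
    and D2_alpha: "0 < \<alpha>"
    and D2_b: "\<And>n. 1 \<le> n \<Longrightarrow> 0 < b n" "mono_on {1..} b"
    and D2_beta: "0 \<le> \<beta>" "\<beta> \<le> 1"
    and D2_a: "vague_conv_on (- {0 :: ereal})
                 (\<lambda>n. scale_measure (ennreal (\<rho> ^ n))
                        (distr D borel (\<lambda>y. ereal (inverse (b n) * y Q 0))))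
                 (distr (power_law_measure \<alpha> \<beta>) borel ereal)"
    and D2_lam: "sets lam = sets (restrict_space borel punctured)"
    and D2_lam_scaling: "\<And>a A. 0 < a \<Longrightarrow> A \<in> sets lam \<Longrightarrow>
          emeasure lam ((\<lambda>y i. a * y i) ` A) = ennreal (a powr (-\<alpha>)) * emeasure lam A"
    and D2_lam_finite: "\<And>A. A \<in> sets lam \<Longrightarrow> (\<lambda>_. 0) \<notin> closure A \<Longrightarrow> emeasure lam A < \<infinity>"
    and D2_b_HL: "HL_conv
                 (\<lambda>n. scale_measure (ennreal (\<rho> ^ n))
                        (restrict_space (distr D borel (\<lambda>y i. inverse (b n) * y Q i)) punctured))
                 lam"
    and D3: "\<And>p. p \<noteq> Q \<Longrightarrow> \<exists>\<gamma>>0. \<exists>\<epsilon> \<in> borel_measurable borel.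
          (\<forall>t. 0 \<le> \<epsilon> t) \<and>
          (\<forall>s>0. ((\<lambda>t. \<epsilon> (t * s) / \<epsilon> t) \<longlongrightarrow> s powr (-\<gamma>)) at_top) \<and>
          (\<forall>s>0. measure D {y. s < \<bar>y p 0\<bar>} \<le> \<epsilon> s * measure D {y. s < \<bar>y Q 0\<bar>})"
    and x_pos: "0 < x"
  shows "(\<lambda>n. measure P {\<omega> \<in> space P. rightmost (T \<omega>) (K \<omega>) (X \<omega>) n < b n * x})
           \<longlonglongrightarrow> integral\<^sup>L P (\<lambda>\<omega>. exp (- (kappa offs \<rho> \<sigma> Q lam * W \<omega> * x powr (-\<alpha>))))"
proof -
  define \<mu> where "\<mu> p q = measure_pmf.expectation (offs p) (\<lambda>k. real (k q))" for p q
  \<comment> \<open>The signs of the entries of \<theta> are not given; their absolute values turn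
    out to form a positive eigenvector.\<close>
  define u where "u q = \<bar>\<theta> $ q\<bar>" for q
  interpret walk: branching_walk P root_law offs D T K X
    by unfold_locales (rule model)
  \<comment> \<open>Every particle has at least one child of each type. This entrywise bound is what
    makes both eigenvectors positive below.\<close>
  have \<mu>_ge: "1 \<le> \<mu> p q" for p q
  proof -
    have "\<forall>k\<in>set_pmf (offs p). 1 \<le> k q"
      using model by (simp add: branching_random_walk_def)
    then have "AE k in measure_pmf (offs p). 1 \<le> real (k q)"
      by (auto simp: AE_measure_pmf_iff)
    then show ?thesis
      unfolding \<mu>_def by (intro measure_pmf.integral_ge_const B1_finite)
  qed
  have left: "(\<Sum>p\<in>UNIV. \<sigma> $ p * \<mu> p q) = \<rho> * \<sigma> $ q" for q
    using arg_cong[OF left_eigenvector(1), of "\<lambda>v. v $ q"]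
    by (simp add: vector_matrix_mult_def mean_matrix_def \<mu>_def mult.commute)
  have right: "(\<Sum>q\<in>UNIV. \<mu> p q * \<theta> $ q) = \<rho> * \<theta> $ p" for p
    using arg_cong[OF right_eigenvector(1), of "\<lambda>v. v $ p"]
    by (simp add: matrix_vector_mult_def mean_matrix_def \<mu>_def)
  have limit: "AE \<omega> in P. \<forall>q. (\<lambda>n. real (card {v \<in> generation (T \<omega>) (K \<omega>) n. vertex_type (T \<omega>) v = q}) / \<rho> ^ n)
      \<longlonglongrightarrow> W \<omega> * \<sigma> $ q"
    using W_limit
  proof eventually_elim
    case (elim \<omega>)
    show ?case
    proof
      fix q
      from tendsto_vec_nth[OF elim, of q]
      show "(\<lambda>n. real (card {v \<in> generation (T \<omega>) (K \<omega>) n. vertex_type (T \<omega>) v = q}) / \<rho> ^ n) \<longlonglongrightarrow> W \<omega> * \<sigma> $ q"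
        by (simp add: type_counts_def divide_inverse mult.commute)
    qed
  qed
  \<comment> \<open>The sign of \<sigma> is read off from the limit of the normalised counts, which
    are nonnegative, and from the positivity of \<open>W\<close>.\<close>
  have \<sigma>_nonneg: "0 \<le> \<sigma> $ q" for q
  proof (rule ccontr)
    assume neg: "\<not> 0 \<le> \<sigma> $ q"
    from limit W_positive have "AE \<omega> in P. False"
    proof eventually_elim
      case (elim \<omega>)
      have "0 \<le> W \<omega> * \<sigma> $ q"
        using B1_supercritical
        by (intro tendsto_lowerbound[OF elim(1)[rule_format, of q]] always_eventually) auto
      then show False using elim(2) neg by (simp add: zero_le_mult_iff)
    qed
    then show False by simp
  qed
  \<comment> \<open>Since all means are at least 1 and the entries of \<sigma> sum to 1,
    \<open>\<rho> * \<sigma> $ q\<close> is at least 1.\<close>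
  have \<sigma>_pos: "0 < \<sigma> $ q" for q
  proof -
    have "(\<Sum>p\<in>UNIV. \<sigma> $ p * 1) \<le> (\<Sum>p\<in>UNIV. \<sigma> $ p * \<mu> p q)"
      by (intro sum_mono mult_left_mono \<mu>_ge \<sigma>_nonneg)
    then have "1 \<le> \<rho> * \<sigma> $ q" using left left_eigenvector(2) by simp
    then show ?thesis using B1_supercritical by (metis less_le_trans zero_less_mult_pos zero_less_one less_trans)
  qed
  \<comment> \<open>The triangle inequality gives this half of the eigenvector equation for the
    absolute values.\<close>
  have u_le: "\<rho> * u p \<le> (\<Sum>q\<in>UNIV. \<mu> p q * u q)" for p
  proof -
    have "\<rho> * u p = \<bar>\<Sum>q\<in>UNIV. \<mu> p q * \<theta> $ q\<bar>"
      using B1_supercritical by (simp add: right u_def abs_mult)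
    also have "\<dots> \<le> (\<Sum>q\<in>UNIV. \<bar>\<mu> p q * \<theta> $ q\<bar>)" by (rule sum_abs)
    also have "\<dots> = (\<Sum>q\<in>UNIV. \<mu> p q * u q)"
      using order_trans[OF zero_le_one \<mu>_ge] by (simp add: u_def abs_mult)
    finally show ?thesis .
  qed
  \<comment> \<open>Pairing the inequality \<open>u_le\<close> with the positive left eigenvector \<open>\<sigma>\<close> gives equality.\<close>
  have harmonic: "(\<Sum>q\<in>UNIV. \<mu> p q * u q) = \<rho> * u p" for p
  proof -
    have "(\<Sum>p\<in>UNIV. \<sigma> $ p * (\<Sum>q\<in>UNIV. \<mu> p q * u q)) = (\<Sum>q\<in>UNIV. (\<Sum>p\<in>UNIV. \<sigma> $ p * \<mu> p q) * u q)"
      unfolding sum_distrib_left sum_distrib_right by (subst sum.swap) (simp add: mult.assoc)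
    then have "(\<Sum>p\<in>UNIV. \<sigma> $ p * ((\<Sum>q\<in>UNIV. \<mu> p q * u q) - \<rho> * u p)) = 0"
      by (simp add: left right_diff_distrib sum_subtractf mult_ac)
    then have "\<forall>p\<in>UNIV. \<sigma> $ p * ((\<Sum>q\<in>UNIV. \<mu> p q * u q) - \<rho> * u p) = 0"
      using \<sigma>_nonneg u_le by (subst (asm) sum_nonneg_eq_0_iff) auto
    then have "\<sigma> $ p * ((\<Sum>q\<in>UNIV. \<mu> p q * u q) - \<rho> * u p) = 0" by blast
    then show ?thesis using \<sigma>_pos[of p] by simp
  qed
  \<comment> \<open>Some entry of \<theta> is nonzero, and since all means are at least 1 the
    eigenvector equation spreads its positivity to every entry of \<open>u\<close>.\<close>
  have u_pos: "0 < u p" for p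
  proof -
    have "\<theta> \<noteq> 0" using right_eigenvector(2) by auto
    then obtain q where "\<theta> $ q \<noteq> 0" by (auto simp: vec_eq_iff)
    then have "0 < (\<Sum>q\<in>UNIV. 1 * u q)" by (auto simp: u_def intro!: sum_pos2[of _ q])
    also have "\<dots> \<le> (\<Sum>q\<in>UNIV. \<mu> p q * u q)"
      by (intro sum_mono mult_right_mono \<mu>_ge) (simp add: u_def)
    finally show ?thesis using B1_supercritical by (simp add: harmonic zero_less_mult_iff)
  qed
  interpret heavy_tailed_walk P root_law offs D T K X \<rho> u Q \<alpha> \<beta> b lam "\<lambda>q. \<sigma> $ q" W
  proof unfold_locales
    show "(\<Sum>q\<in>UNIV. measure_pmf.expectation (offs p) (\<lambda>k. real (k q)) * u q) = \<rho> * u p" for p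
      using harmonic by (simp add: \<mu>_def)
    show "(\<Sum>p\<in>UNIV. \<sigma> $ p * measure_pmf.expectation (offs p) (\<lambda>k. real (k q))) = \<rho> * \<sigma> $ q" for q
      using left by (simp add: \<mu>_def)
    show "mono_on {1..} b" by (rule D2_b)
  qed (fact B1_finite u_pos B1_supercritical D1 D2_alpha D2_b D2_beta D2_a D2_lam D2_lam_scaling
        D2_lam_finite D2_b_HL D3 \<sigma>_nonneg W_measurable W_positive limit)+
  have "kappa offs \<rho> \<sigma> Q lam = mean_exceed / (\<rho> - 1)"
    using kappa_eq by simp
  then show ?thesis
    using tendsto_prob_rightmost[OF x_pos] by (simp add: mult_ac)
qed

end
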